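(* Let $n\ge 1$, $m\ge 0$ and $d\ge 0$ be integers. If $n\ge 3m$ and $d<2m$, or $n\ge 3m+2$ and $d<2m+1$, then $\mathrm{Aut}(F_n)$ has a fixed point whenever it acts by isometries on a complete $\mathrm{CAT}(0)$ space of dimension $d$.
   Context: $F_n$ is the free group of rank $n$ and $\mathrm{Aut}(F_n)$ its automorphism group. $\mathrm{CAT}(0)$ spaces are non-empty; they are not assumed locally compact. An action by isometries of $\Gamma$ on $X$ is a homomorphism $\Gamma\to\mathrm{Isom}(X)$ (no properness or semisimplicity is assumed); a fixed point is a point $x\in X$ with $\gamma x=x$ for all $\gamma\in\Gamma$. Dimension means topological covering dimension: $\dim(X)\le d$ if for every closed subspace $K\subseteq X$ and every $r\ge d$, every continuous map $K\to\mathbb{S}^r$ to the $r$-sphere extends to a continuous map $X\to\mathbb{S}^r$. *)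

theory Defs
  imports "HOL-Analysis.Analysis" "HOL-Algebra.Bij"
begin

section \<open>Free groups\<close>

text \<open>The letter \<open>(x, True)\<close> stands for the generator \<open>x\<close> and \<open>(x, False)\<close> for its inverse.
  Elements of the free group are the freely reduced words, multiplied by concatenation followed by
  free reduction.\<close>

definition inv_letter :: "'a \<times> bool \<Rightarrow> 'a \<times> bool" where
  "inv_letter l = (fst l, \<not> snd l)"

definition reduced :: "('a \<times> bool) list \<Rightarrow> bool" where
  "reduced w \<longleftrightarrow> successively (\<lambda>k l. l \<noteq> inv_letter k) w"

fun push_letter :: "'a \<times> bool \<Rightarrow> ('a \<times> bool) list \<Rightarrow> ('a \<times> bool) list" where
  "push_letter k [] = [k]"
| "push_letter k (l # w) = (if l = inv_letter k then w else k # l # w)"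

definition free_group :: "'a set \<Rightarrow> ('a \<times> bool) list monoid" where
  "free_group S =
    \<lparr>carrier = {w. reduced w \<and> set w \<subseteq> S \<times> UNIV},
     mult = foldr push_letter,
     one = []\<rparr>"

lemma inv_letter_inv_letter [simp]: "inv_letter (inv_letter k) = k"
  by (simp add: inv_letter_def)

lemma inv_letter_neq [simp]: "inv_letter k \<noteq> k" "k \<noteq> inv_letter k"
  by (auto simp: inv_letter_def prod_eq_iff)

lemma fst_inv_letter [simp]: "fst (inv_letter k) = fst k"
  by (simp add: inv_letter_def)

lemma reduced_Nil [simp]: "reduced []"
  by (simp add: reduced_def)

lemma reduced_ConsD: "reduced (k # w) \<Longrightarrow> reduced w"
  by (cases w) (auto simp: reduced_def)

lemma reduced_push: "reduced w \<Longrightarrow> reduced (push_letter k w)"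
  by (cases w; cases "tl w") (auto simp: reduced_def)

lemma set_push: "set (push_letter k w) \<subseteq> insert k (set w)"
  by (cases w) auto

lemma push_inv: "reduced w \<Longrightarrow> push_letter k (push_letter (inv_letter k) w) = w"
  by (cases w; cases "tl w") (auto simp: reduced_def)

lemma push_reduced: "reduced (k # w) \<Longrightarrow> push_letter k w = k # w"
  by (cases w) (auto simp: reduced_def)

lemma reduced_mult: "reduced v \<Longrightarrow> reduced (foldr push_letter u v)"
  by (induction u) (auto simp: reduced_push)

lemma set_mult: "set (foldr push_letter u v) \<subseteq> set u \<union> set v"
proof (induction u)
  case (Cons k u)
  then show ?case using set_push[of k "foldr push_letter u v"] by auto
qed simp

lemma mult_push:
  assumes "reduced w"
  shows "foldr push_letter (push_letter k v) w = push_letter k (foldr push_letter v w)"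
proof (cases v)
  case (Cons l v')
  then show ?thesis
    using push_inv[OF reduced_mult[OF assms], of k v'] by auto
qed simp

lemma mult_assoc_words:
  assumes "reduced w"
  shows "foldr push_letter (foldr push_letter u v) w = foldr push_letter u (foldr push_letter v w)"
  by (induction u) (simp_all add: mult_push assms)

lemma mult_Nil: "reduced u \<Longrightarrow> foldr push_letter u [] = u"
proof (induction u)
  case (Cons k u)
  then show ?case using push_reduced reduced_ConsD by fastforce
qed simp

lemma reduced_inverse: "reduced w \<Longrightarrow> reduced (rev (map inv_letter w))"
  unfolding reduced_def successively_rev successively_map
  by (erule successively_mono) (metis inv_letter_inv_letter)

lemma inverse_mult:
  assumes "reduced v"
  shows "foldr push_letter (rev (map inv_letter w)) (foldr push_letter w v) = v"
proof (induction w)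
  case (Cons k w)
  then show ?case
    using push_inv[OF reduced_mult[OF assms], of "inv_letter k" w] by simp
qed (simp add: assms)

lemma group_free_group: "group (free_group S)"
proof (rule groupI)
  fix u v assume "u \<in> carrier (free_group S)" "v \<in> carrier (free_group S)"
  then show "u \<otimes>\<^bsub>free_group S\<^esub> v \<in> carrier (free_group S)"
    using set_mult[of u v] by (auto simp: free_group_def reduced_mult)
next
  fix u assume u: "u \<in> carrier (free_group S)"
  have "rev (map inv_letter u) \<in> carrier (free_group S)"
    using u by (fastforce simp: free_group_def reduced_inverse inv_letter_def)
  moreover have "rev (map inv_letter u) \<otimes>\<^bsub>free_group S\<^esub> u = \<one>\<^bsub>free_group S\<^esub>"
    using u inverse_mult[of "[]" u] by (simp add: free_group_def mult_Nil)
  ultimately show "\<exists>v\<in>carrier (free_group S). v \<otimes>\<^bsub>free_group S\<^esub> u = \<one>\<^bsub>free_group S\<^esub>"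
    by blast
qed (auto simp: free_group_def mult_assoc_words)

definition letter_val :: "('g, 'm) monoid_scheme \<Rightarrow> ('a \<Rightarrow> 'g) \<Rightarrow> 'a \<times> bool \<Rightarrow> 'g" where
  "letter_val H f k = (if snd k then f (fst k) else inv\<^bsub>H\<^esub> f (fst k))"

lemma free_group_extend:
  assumes H: "group H" and f: "f \<in> S \<rightarrow> carrier H"
  shows "\<exists>h\<in>hom (free_group S) H. \<forall>x\<in>S. h [(x, True)] = f x"
proof -
  interpret H: group H by fact
  let ?v = "letter_val H f"
  define h where "h = (\<lambda>w. foldr (\<lambda>k a. ?v k \<otimes>\<^bsub>H\<^esub> a) w \<one>\<^bsub>H\<^esub>)"
  have h_simps: "h [] = \<one>\<^bsub>H\<^esub>" "h (k # w) = ?v k \<otimes>\<^bsub>H\<^esub> h w" for k w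
    by (simp_all add: h_def)
  have v_in: "?v k \<in> carrier H" if "k \<in> S \<times> UNIV" for k
    using that f by (auto simp: letter_val_def)
  have h_in: "h w \<in> carrier H" if "set w \<subseteq> S \<times> UNIV" for w
    using that by (induction w) (simp_all add: h_simps v_in)
  have v_inv: "?v (inv_letter k) = inv\<^bsub>H\<^esub> ?v k" if "k \<in> S \<times> UNIV" for k
  proof -
    have "f (fst k) \<in> carrier H" using that f by auto
    then show ?thesis by (simp add: letter_val_def inv_letter_def)
  qed
  have h_push: "h (push_letter k w) = ?v k \<otimes>\<^bsub>H\<^esub> h w"
    if "k \<in> S \<times> UNIV" "set w \<subseteq> S \<times> UNIV" for k w
  proof (cases w)
    case Nil
    then show ?thesis by (simp add: h_simps)
  next
    case (Cons l w')
    then have "h w' = ?v k \<otimes>\<^bsub>H\<^esub> (?v (inv_letter k) \<otimes>\<^bsub>H\<^esub> h w')"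
      using that by (simp add: v_inv v_in h_in H.m_assoc[symmetric])
    then show ?thesis using Cons by (auto simp: h_simps)
  qed
  have h_mult: "h (foldr push_letter u v) = h u \<otimes>\<^bsub>H\<^esub> h v"
    if "set u \<subseteq> S \<times> UNIV" "set v \<subseteq> S \<times> UNIV" for u v
    using that(1)
  proof (induction u)
    case Nil
    then show ?case using that(2) by (simp add: h_simps h_in)
  next
    case (Cons k u)
    have "set (foldr push_letter u v) \<subseteq> S \<times> UNIV"
      using set_mult[of u v] Cons.prems that(2) by auto
    then show ?case
      using Cons that(2) by (simp add: h_simps h_push H.m_assoc v_in h_in)
  qed
  have "h \<in> hom (free_group S) H"
    by (auto simp: hom_def free_group_def h_in h_mult)
  moreover have "h [(x, True)] = f x" if "x \<in> S" for x
    using that funcset_mem[OF f that] by (simp add: h_simps letter_val_def)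
  ultimately show ?thesis by blast
qed

lemma free_group_extend_unique:
  assumes H: "group H" and h: "h \<in> hom (free_group S) H" and h': "h' \<in> hom (free_group S) H"
    and eq: "\<forall>x\<in>S. h [(x, True)] = h' [(x, True)]"
    and w: "w \<in> carrier (free_group S)"
  shows "h w = h' w"
proof -
  interpret h: group_hom "free_group S" H h
    using H h group_free_group by (simp add: group_hom_def group_hom_axioms_def)
  interpret h': group_hom "free_group S" H h'
    using H h' group_free_group by (simp add: group_hom_def group_hom_axioms_def)
  have letter_in: "[k] \<in> carrier (free_group S)" if "fst k \<in> S" for k
    using that by (cases k) (auto simp: free_group_def reduced_def)
  have letter: "h [k] = h' [k]" if "fst k \<in> S" for k
  proof (cases "snd k")
    case True
    then show ?thesis using that eq by (cases k) auto
  next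
    case False
    have "inv\<^bsub>free_group S\<^esub> [(fst k, True)] = [k]"
      using that False letter_in[of "(fst k, True)"] letter_in[of k]
      by (intro group.inv_equality[OF group_free_group])
        (auto simp: free_group_def inv_letter_def prod_eq_iff)
    then show ?thesis
      using that eq letter_in[of "(fst k, True)"] h.hom_inv h'.hom_inv by (metis fst_conv)
  qed
  show ?thesis using w
  proof (induction w)
    case Nil
    then show ?case using h.hom_one h'.hom_one by (simp add: free_group_def)
  next
    case (Cons k w)
    then have k: "fst k \<in> S" and w: "w \<in> carrier (free_group S)"
      and kw: "k # w = [k] \<otimes>\<^bsub>free_group S\<^esub> w"
      by (auto simp: free_group_def push_reduced dest: reduced_ConsD)
    show ?case
      unfolding kw using h.hom_mult h'.hom_mult letter[OF k] Cons.IH[OF w] letter_in[OF k] w by simp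
  qed
qed


section \<open>CAT(0) spaces\<close>

text \<open>\<open>geodesic_segment M d x y S\<close>: the set \<open>S\<close> is the image of a geodesic path in \<open>M\<close> from
  \<open>x\<close> to \<open>y\<close>; the path is parametrised by arc length on \<open>[0, l]\<close>, so \<open>l = d x y\<close>.\<close>

definition geodesic_segment :: "'a set \<Rightarrow> ('a \<Rightarrow> 'a \<Rightarrow> real) \<Rightarrow> 'a \<Rightarrow> 'a \<Rightarrow> 'a set \<Rightarrow> bool" where
  "geodesic_segment M d x y S \<longleftrightarrow>
     (\<exists>l\<ge>0. \<exists>c. c \<in> {0..l} \<rightarrow> M \<and> c 0 = x \<and> c l = y \<and>
        (\<forall>s\<in>{0..l}. \<forall>t\<in>{0..l}. d (c s) (c t) = \<bar>s - t\<bar>) \<and> S = c ` {0..l})"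

text \<open>The point \<open>x'\<close> of the Euclidean segment from \<open>u'\<close> to \<open>v'\<close> is a comparison point for the
  point \<open>x\<close> of a geodesic segment starting at \<open>u\<close>.\<close>

definition comparison_point ::
  "('a \<Rightarrow> 'a \<Rightarrow> real) \<Rightarrow> 'a \<Rightarrow> real^2 \<Rightarrow> real^2 \<Rightarrow> 'a \<Rightarrow> real^2 \<Rightarrow> bool" where
  "comparison_point d u u' v' x x' \<longleftrightarrow> x' \<in> closed_segment u' v' \<and> dist u' x' = d u x"

text \<open>The CAT(0) inequality for the geodesic triangle with vertices \<open>p, q, r\<close> and sides
  \<open>A = [p,q]\<close>, \<open>B = [q,r]\<close>, \<open>C = [r,p]\<close>, and for all its comparison triangles in the Euclidean
  plane. In a tuple \<open>(u, S, u', v')\<close>, \<open>S\<close> is a side starting at the vertex \<open>u\<close>, and \<open>u', v'\<close> are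
  the endpoints of the corresponding side of the comparison triangle.\<close>

definition CAT0_triangle ::
  "('a \<Rightarrow> 'a \<Rightarrow> real) \<Rightarrow> 'a \<Rightarrow> 'a \<Rightarrow> 'a \<Rightarrow> 'a set \<Rightarrow> 'a set \<Rightarrow> 'a set \<Rightarrow> bool" where
  "CAT0_triangle d p q r A B C \<longleftrightarrow>
     (\<forall>p' q' r' :: real^2.
        dist p' q' = d p q \<and> dist q' r' = d q r \<and> dist r' p' = d r p \<longrightarrow>
        (let sides = {(p, A, p', q'), (q, B, q', r'), (r, C, r', p')} in
          \<forall>(u, S, u', v')\<in>sides. \<forall>(w, T, w', z')\<in>sides.
            \<forall>x\<in>S. \<forall>y\<in>T. \<forall>x' y'.
              comparison_point d u u' v' x x' \<and> comparison_point d w w' z' y y' \<longrightarrow>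
              d x y \<le> dist x' y'))"

locale CAT0_space = Metric_space +
  assumes nonempty: "M \<noteq> {}"
    and geodesic: "\<And>x y. x \<in> M \<Longrightarrow> y \<in> M \<Longrightarrow> \<exists>S. geodesic_segment M d x y S"
    and CAT0: "\<And>p q r A B C.
      p \<in> M \<Longrightarrow> q \<in> M \<Longrightarrow> r \<in> M \<Longrightarrow>
      geodesic_segment M d p q A \<Longrightarrow> geodesic_segment M d q r B \<Longrightarrow> geodesic_segment M d r p C \<Longrightarrow>
      CAT0_triangle d p q r A B C"

locale complete_CAT0_space = CAT0_space +
  assumes complete: mcomplete


section \<open>Isometry groups\<close>

text \<open>Isometries of \<open>M\<close> are surjective; as for \<^const>\<open>AutoGroup\<close>, they are represented by
  extensional functions on \<open>M\<close>.\<close>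

definition isometries :: "'a set \<Rightarrow> ('a \<Rightarrow> 'a \<Rightarrow> real) \<Rightarrow> ('a \<Rightarrow> 'a) set" where
  "isometries M d = {f \<in> Bij M. \<forall>x\<in>M. \<forall>y\<in>M. d (f x) (f y) = d x y}"

definition IsomGroup :: "'a set \<Rightarrow> ('a \<Rightarrow> 'a \<Rightarrow> real) \<Rightarrow> ('a \<Rightarrow> 'a) monoid" where
  "IsomGroup M d = BijGroup M \<lparr>carrier := isometries M d\<rparr>"

lemma group_IsomGroup: "group (IsomGroup M d)"
proof -
  interpret B: group "BijGroup M" by (rule group_BijGroup)
  have "subgroup (isometries M d) (BijGroup M)"
  proof (rule subgroup.intro)
    show "isometries M d \<subseteq> carrier (BijGroup M)"
      by (auto simp: isometries_def BijGroup_def)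
    show "\<one>\<^bsub>BijGroup M\<^esub> \<in> isometries M d"
      by (auto simp: isometries_def BijGroup_def id_Bij)
  next
    fix f g assume "f \<in> isometries M d" "g \<in> isometries M d"
    then show "f \<otimes>\<^bsub>BijGroup M\<^esub> g \<in> isometries M d"
      using Bij_imp_funcset[of g M]
      by (auto simp: isometries_def BijGroup_def compose_Bij compose_eq Pi_iff)
  next
    fix f assume f: "f \<in> isometries M d"
    then have fB: "f \<in> Bij M" and iso: "\<And>x y. x \<in> M \<Longrightarrow> y \<in> M \<Longrightarrow> d (f x) (f y) = d x y"
      by (auto simp: isometries_def)
    have f_inv: "f (inv_into M f x) = x" if "x \<in> M" for x
      using that fB by (auto simp: Bij_def bij_betw_def f_inv_into_f)
    have "d (inv_into M f x) (inv_into M f y) = d x y" if "x \<in> M" "y \<in> M" for x y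
      using iso[of "inv_into M f x" "inv_into M f y"] that
      by (simp add: f_inv Bij_inv_into_mem[OF fB])
    then show "inv\<^bsub>BijGroup M\<^esub> f \<in> isometries M d"
      by (simp add: inv_BijGroup[OF fB] isometries_def restrict_inv_into_Bij[OF fB])
  qed
  then show ?thesis
    unfolding IsomGroup_def by (rule B.subgroup_imp_group)
qed


section \<open>Covering dimension\<close>

text \<open>\<open>covering_dim_at_most X n\<close> means \<open>dim X \<le> n\<close>, expressed by extension of maps to spheres. For nonempty
  \<open>X\<close> the dimension is never negative, so \<open>dim X = n\<close> means that \<open>n\<close> is the least natural number
  with \<open>covering_dim_at_most X n\<close>.\<close>

definition covering_dim_at_most :: "'a topology \<Rightarrow> nat \<Rightarrow> bool" where
  "covering_dim_at_most X n \<longleftrightarrow>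
     (\<forall>K r f. closedin X K \<and> r \<ge> n \<and> continuous_map (subtopology X K) (nsphere r) f \<longrightarrow>
        (\<exists>g. continuous_map X (nsphere r) g \<and> (\<forall>x\<in>K. g x = f x)))"

definition has_covering_dim :: "'a topology \<Rightarrow> nat \<Rightarrow> bool" where
  "has_covering_dim X n \<longleftrightarrow> covering_dim_at_most X n \<and> (\<forall>k<n. \<not> covering_dim_at_most X k)"

end

theory Submission
  imports Defs "HOL-Homology.Brouwer_Degree"
begin

text \<open>
  The proof assembles a fixed point of the whole group from fixed points of smaller and smaller pieces,
  using two principles. Fixed sets in a complete CAT(0) space are closed and convex, so that nearest-point
  projection is available: if \<open>A\<close> and \<open>B\<close> both have fixed points and \<open>B\<close> preserves the fixed set of \<open>A\<close>,
  then projecting a fixed point of \<open>B\<close> to the fixed set of \<open>A\<close> gives a common fixed point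
  (\<open>fixset_Un_nonempty\<close>). The second principle is of Helly type and uses the dimension
  (\<open>commuting_families_fixed_point\<close>): if \<open>S\<^sub>1, \<dots>, S\<^sub>l\<close> are mutually commuting finite families of isometries,
  all \<open>k\<^sub>i\<close>-element subsets of \<open>S\<^sub>i\<close> have fixed points, and the dimension is less than \<open>k\<^sub>1 + \<dots> + k\<^sub>l\<close>, then
  some \<open>S\<^sub>i\<close> has a fixed point. Otherwise the nerve of the fixed sets of minimal counterexamples would be a
  join of boundaries of simplices, that is a sphere, of dimension at least that of the space, and it would
  carry a map to the sphere that cannot be extended (\<open>nerve_dimension_bound\<close>).

  For the group, write \<open>x\<^sub>i\<close>, \<open>i < n\<close>, for the free generators. The automorphism group contains
  \<open>m\<close> commuting copies of the automorphism group of a free group of rank three, and one of rank two if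
  \<open>n \<ge> 3 m + 2\<close>. In rank three there are three involutions, any two of which generate a finite group, whose
  products include a transvection; in rank two a transvection is a product of two involutions. Hence the first
  application of the Helly principle, with \<open>k\<^sub>i = 2\<close> in rank three and \<open>k\<^sub>i = 1\<close> in rank two, shows that
  transvections have fixed points (\<open>some_transvection_fixes\<close>).

  In the second application, let \<open>J\<close> be a set of generators. The maps \<open>x\<^sub>i \<mapsto> u x\<^sub>i\<close> and \<open>x\<^sub>i \<mapsto> x\<^sub>i v\<close>, with
  \<open>u\<close> and \<open>v\<close> words in \<open>J\<close>, form \<open>2 (n - card J)\<close> commuting copies of a free group, one for each
  generator outside \<open>J\<close> and each side. As their generators have fixed points, so do these free groups if the
  dimension is less than \<open>2 (n - card J)\<close> (\<open>multipliers_Fix\<close>). Triangular groups are iterated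
  semidirect products of them, so the projection principle applies (\<open>triangular_Fix\<close>).

  In the third application there is a single family, the transvections along the edges of a cycle through all
  generators. Any \<open>dim + 1\<close> of them miss an edge of the cycle, hence are triangular and
  have a common fixed point, so all of them do (\<open>cyclic_transvections_Fix\<close>). Commutators of these give all
  transvections; the finite group of signed permutations normalises them, so it can be adjoined by
  projection. By Nielsen's theorem, which is proved here by Nielsen reduction (\<open>Nielsen_generation\<close>), these
  elements generate the automorphism group.
\<close>

section \<open>The Bruhat--Tits inequality and minimal energy\<close>

text \<open>One side is put on the first axis, and the law of cosines gives the abscissa \<open>s\<close> of the opposite
  vertex. If that side is degenerate, the other two sides have equal length.\<close>

lemma comparison_triangle_exists:
  fixes a b c :: real
  assumes "0 \<le> a" "0 \<le> b" "0 \<le> c" "a \<le> b + c" "b \<le> c + a" "c \<le> a + b"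
  shows "\<exists>p q r :: real^2. dist p q = a \<and> dist q r = b \<and> dist r p = c"
proof (cases "a = 0")
  case True
  then have "b = c" using assms by linarith
  then show ?thesis
    using True assms
    by (intro exI[of _ 0] exI[of _ "vector [c, 0]"]) (auto simp: dist_norm norm_vec_def L2_set_def sum_2)
next
  case False
  then have a: "a > 0" using assms by simp
  define s where "s = (c\<^sup>2 + a\<^sup>2 - b\<^sup>2) / (2 * a)"
  have s2a: "2 * a * s = c\<^sup>2 + a\<^sup>2 - b\<^sup>2" using a by (simp add: s_def)
  have "b\<^sup>2 \<le> (c + a)\<^sup>2" "(a - c)\<^sup>2 \<le> b\<^sup>2"
    using assms by (auto intro!: power_mono simp flip: abs_le_square_iff)
  then have "2 * a * s \<ge> 2 * a * (- c)" "2 * a * s \<le> 2 * a * c"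
    unfolding s2a by (simp_all add: power2_eq_square algebra_simps)
  then have "- c \<le> s" "s \<le> c" using a mult_le_cancel_left_pos[of "2 * a"] by (metis zero_less_numeral mult_pos_pos)+
  then have "s\<^sup>2 \<le> c\<^sup>2" using assms by (simp add: abs_le_square_iff[symmetric])
  define t where "t = sqrt (c\<^sup>2 - s\<^sup>2)"
  have t2: "t\<^sup>2 = c\<^sup>2 - s\<^sup>2" unfolding t_def using \<open>s\<^sup>2 \<le> c\<^sup>2\<close> by simp
  have "(a - s)\<^sup>2 + t\<^sup>2 = b\<^sup>2" using t2 s2a by (simp add: power2_eq_square algebra_simps)
  moreover have "s\<^sup>2 + t\<^sup>2 = c\<^sup>2" using t2 by simp
  ultimately show ?thesis
    using assms a
    by (intro exI[of _ 0] exI[of _ "vector [a, 0]"] exI[of _ "vector [s, t]"])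
      (simp add: dist_norm norm_vec_def L2_set_def sum_2)
qed

lemma euclidean_midpoint_identity:
  fixes p q r :: "'e::real_inner"
  shows "(dist (midpoint p q) r)\<^sup>2 = ((dist r p)\<^sup>2 + (dist r q)\<^sup>2) / 2 - (dist p q)\<^sup>2 / 4"
proof -
  have e: "midpoint p q - r = (1/2) *\<^sub>R ((p - r) + (q - r))"
    by (simp add: midpoint_def scaleR_2 algebra_simps flip: scaleR_add_left)
  define x y where "x = p - r" and "y = q - r"
  have pq: "p - q = x - y" "r - p = - x" "r - q = - y" by (simp_all add: x_def y_def)
  have "(norm ((1/2) *\<^sub>R (x + y)))\<^sup>2 = ((norm x)\<^sup>2 + (norm y)\<^sup>2)/2 - (norm (x - y))\<^sup>2 / 4"
    by (simp add: power2_norm_eq_inner inner_simps inner_commute[of y x] field_simps)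
  then show ?thesis
    unfolding dist_norm e pq by (simp only: x_def y_def norm_minus_cancel)
qed

context CAT0_space
begin

text \<open>The Bruhat--Tits inequality. In the comparison triangle it is the parallelogram law, and the CAT(0)
  inequality transfers it to the space. It is the only consequence of nonpositive curvature used below.\<close>

lemma CN_midpoint:
  assumes x: "x \<in> M" and y: "y \<in> M"
  shows "\<exists>m\<in>M. \<forall>z\<in>M. (d m z)\<^sup>2 \<le> ((d z x)\<^sup>2 + (d z y)\<^sup>2) / 2 - (d x y)\<^sup>2 / 4"
proof -
  obtain A where A: "geodesic_segment M d x y A" using geodesic[OF x y] by blast
  then obtain l c where l: "l \<ge> 0" and c: "c \<in> {0..l} \<rightarrow> M" "c 0 = x" "c l = y"
      "\<forall>s\<in>{0..l}. \<forall>t\<in>{0..l}. d (c s) (c t) = \<bar>s - t\<bar>" "A = c ` {0..l}"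
    unfolding geodesic_segment_def by blast
  have lxy: "l = d x y" using c l by force
  define m where "m = c (l/2)"
  have m: "m \<in> M" "m \<in> A" "d x m = d x y / 2"
    using c l lxy by (auto simp: m_def)
  have "(d m z)\<^sup>2 \<le> ((d z x)\<^sup>2 + (d z y)\<^sup>2) / 2 - (d x y)\<^sup>2 / 4" if z: "z \<in> M" for z
  proof -
    obtain B C where B: "geodesic_segment M d y z B" and C: "geodesic_segment M d z x C"
      using geodesic x y z by blast
    have zC: "z \<in> C" using C unfolding geodesic_segment_def by force
    obtain p q r :: "real^2" where pqr: "dist p q = d x y" "dist q r = d y z" "dist r p = d z x"
      using comparison_triangle_exists[of "d x y" "d y z" "d z x"]
        triangle[OF x z y] triangle[OF y x z] triangle[OF z y x]
      by (auto simp: commute)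
    have "d m z \<le> dist (midpoint p q) r"
      using CAT0[OF x y z A B C] pqr m zC
      unfolding CAT0_triangle_def Let_def comparison_point_def
      by (auto simp: dist_midpoint mdist_zero[OF z])
    then have "(d m z)\<^sup>2 \<le> (dist (midpoint p q) r)\<^sup>2" by (simp add: power_mono)
    then show ?thesis
      unfolding euclidean_midpoint_identity using pqr by (simp add: dist_commute commute)
  qed
  then show ?thesis using m(1) by blast
qed

definition is_CN_midpoint :: "'a \<Rightarrow> 'a \<Rightarrow> 'a \<Rightarrow> bool" where
  "is_CN_midpoint m x y \<longleftrightarrow>
     m \<in> M \<and> (\<forall>z\<in>M. (d m z)\<^sup>2 \<le> ((d z x)\<^sup>2 + (d z y)\<^sup>2) / 2 - (d x y)\<^sup>2 / 4)"

text \<open>Convexity is only required for midpoints, because this is what makes minimising sequences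
  converge.\<close>

definition closed_convex :: "'a set \<Rightarrow> bool" where
  "closed_convex C \<longleftrightarrow> closedin mtopology C \<and> C \<noteq> {} \<and>
     (\<forall>x\<in>C. \<forall>y\<in>C. \<exists>m\<in>C. is_CN_midpoint m x y)"

lemma closed_convex_M: "closed_convex M"
  unfolding closed_convex_def is_CN_midpoint_def
  using CN_midpoint nonempty closedin_topspace[of mtopology] by fastforce

definition energy :: "'b set \<Rightarrow> ('b \<Rightarrow> real) \<Rightarrow> ('b \<Rightarrow> 'a) \<Rightarrow> 'a \<Rightarrow> real" where
  "energy V w p x = (\<Sum>v\<in>V. w v * (d x (p v))\<^sup>2)"

lemma energy_nonneg: "\<forall>v\<in>V. 0 \<le> w v \<Longrightarrow> 0 \<le> energy V w p x"
  unfolding energy_def by (intro sum_nonneg) simp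

text \<open>Strong convexity, summed up from the inequalities for the single squared distances.\<close>

lemma energy_midpoint:
  assumes "is_CN_midpoint m x y" "\<forall>v\<in>V. 0 \<le> w v" "\<forall>v\<in>V. p v \<in> M"
  shows "energy V w p m \<le> (energy V w p x + energy V w p y) / 2 - sum w V * (d x y)\<^sup>2 / 4"
proof -
  have "energy V w p m \<le> (\<Sum>v\<in>V. w v * (((d x (p v))\<^sup>2 + (d y (p v))\<^sup>2) / 2 - (d x y)\<^sup>2 / 4))"
    unfolding energy_def
    using assms by (intro sum_mono mult_left_mono) (auto simp: is_CN_midpoint_def commute)
  also have "\<dots> = (energy V w p x + energy V w p y) / 2 - sum w V * (d x y)\<^sup>2 / 4"
    by (simp add: energy_def right_diff_distrib distrib_left add_divide_distrib sum.distrib sum_subtractf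
        flip: sum_divide_distrib sum_distrib_right)
  finally show ?thesis .
qed

lemma energy_tendsto:
  assumes "limitin mtopology s b sequentially" "\<forall>v\<in>V. p v \<in> M"
  shows "(\<lambda>n. energy V w p (s n)) \<longlonglongrightarrow> energy V w p b"
  unfolding energy_def
proof (intro tendsto_sum tendsto_intros)
  fix v assume v: "v \<in> V"
  have b: "b \<in> M" and sM: "eventually (\<lambda>n. s n \<in> M) sequentially"
    and lim: "(\<lambda>n. d (s n) b) \<longlonglongrightarrow> 0"
    using assms(1) by (auto simp: limitin_metric_dist_null)
  have ev: "eventually (\<lambda>n. dist (d (s n) (p v)) (d b (p v)) \<le> d (s n) b) sequentially"
    using sM
  proof eventually_elim
    case (elim n)
    then show ?case
      using triangle[OF elim b assms(2)[rule_format, OF v]] triangle[OF b elim assms(2)[rule_format, OF v]]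
      by (simp add: dist_real_def commute abs_le_iff)
  qed
  show "(\<lambda>n. d (s n) (p v)) \<longlonglongrightarrow> d b (p v)"
    unfolding tendsto_dist_iff[of _ "d b (p v)"]
    by (rule Lim_null_comparison[OF _ lim]) (use ev in simp)
qed

end

context complete_CAT0_space
begin

text \<open>By strong convexity a minimising sequence is Cauchy. The quadratic growth away from the minimiser is
  kept in the statement: it yields uniqueness, hence equivariance, and later continuity in the weights.\<close>

lemma energy_minimiser_exists:
  assumes C: "closed_convex C"
    and w: "\<forall>v\<in>V. 0 \<le> w v" and p: "\<forall>v\<in>V. p v \<in> M"
    and W: "0 < sum w V"
  shows "\<exists>b\<in>C. \<forall>x\<in>C. energy V w p b + sum w V / 2 * (d x b)\<^sup>2 \<le> energy V w p x"
proof -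
  let ?F = "energy V w p"
  have CM: "C \<subseteq> M" and C0: "C \<noteq> {}" and cl: "closedin mtopology C"
    using C closedin_subset[of mtopology C] by (auto simp: closed_convex_def)
  define I where "I = Inf (?F ` C)"
  have bdd: "bdd_below (?F ` C)" using energy_nonneg[OF w] by (intro bdd_belowI[of _ 0]) auto
  have I: "I \<le> ?F x" if "x \<in> C" for x unfolding I_def using that bdd by (simp add: cINF_lower)
  have "\<exists>x\<in>C. ?F x < I + 1 / real (Suc n)" for n
    using cInf_lessD[of "?F ` C" "I + 1 / real (Suc n)"] C0 by (auto simp: I_def)
  then obtain s where s: "\<And>n. s n \<in> C" "\<And>n. ?F (s n) < I + 1 / real (Suc n)" by metis
  have close: "sum w V * (d x y)\<^sup>2 / 4 \<le> (?F x + ?F y) / 2 - I" if xy: "x \<in> C" "y \<in> C" for x y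
  proof -
    obtain m where m: "m \<in> C" "is_CN_midpoint m x y" using C xy by (auto simp: closed_convex_def)
    have "?F m \<le> (?F x + ?F y) / 2 - sum w V * (d x y)\<^sup>2 / 4"
      by (rule energy_midpoint[OF m(2) w p])
    then show ?thesis using I[OF m(1)] by linarith
  qed
  have "MCauchy s"
    unfolding MCauchy_def
  proof (intro conjI allI impI)
    show "range s \<subseteq> M" using s CM by auto
    fix e :: real assume e: "e > 0"
    define W where "W = sum w V"
    have W0: "W > 0" using assms by (simp add: W_def)
    obtain N where N: "1 / real (Suc N) < W * e\<^sup>2 / 4"
      using reals_Archimedean[of "W * e\<^sup>2 / 4"] e W0 by (auto simp: inverse_eq_divide)
    have "d (s n) (s n') < e" if "N \<le> n" "N \<le> n'" for n n'
    proof -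
      have "1 / real (Suc n) \<le> 1 / real (Suc N)" "1 / real (Suc n') \<le> 1 / real (Suc N)"
        using that by (auto simp: frac_le)
      then have "W * (d (s n) (s n'))\<^sup>2 / 4 < W * e\<^sup>2 / 4"
        using close[OF s(1) s(1), of n n'] s(2)[of n] s(2)[of n'] N[unfolded W_def] unfolding W_def
        by argo
      then have "(d (s n) (s n'))\<^sup>2 < e\<^sup>2" using W0 by simp
      then show ?thesis using e by (simp add: power2_less_imp_less)
    qed
    then show "\<exists>N. \<forall>n n'. N \<le> n \<longrightarrow> N \<le> n' \<longrightarrow> d (s n) (s n') < e" by blast
  qed
  then obtain b where b: "limitin mtopology s b sequentially" using complete by (auto simp: mcomplete_def)
  have bC: "b \<in> C"
    using limitin_closedin[OF b cl] s by auto
  have "?F b \<le> I"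
  proof (rule LIMSEQ_le[OF energy_tendsto[OF b p]])
    show "(\<lambda>n. I + 1 / real (Suc n)) \<longlonglongrightarrow> I"
      using tendsto_add[OF tendsto_const LIMSEQ_Suc[OF lim_1_over_n], of I] by simp
    show "\<exists>N. \<forall>n\<ge>N. energy V w p (s n) \<le> I + 1 / real (Suc n)" using s(2) by (meson less_imp_le)
  qed
  then have "?F b + sum w V / 2 * (d x b)\<^sup>2 \<le> ?F x" if "x \<in> C" for x
    using close[OF that bC] by (simp add: field_simps)
  then show ?thesis using bC by blast
qed

end

section \<open>Fixed sets of isometries\<close>

lemma isometriesD:
  assumes "f \<in> isometries M d"
  shows "x \<in> M \<Longrightarrow> f x \<in> M" "x \<in> M \<Longrightarrow> y \<in> M \<Longrightarrow> d (f x) (f y) = d x y"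
    "f ` M = M" "inj_on f M"
  using assms Bij_imp_funcset[of f M] by (auto simp: isometries_def Bij_def bij_betw_def)

context Metric_space
begin

definition fixset :: "('a \<Rightarrow> 'a) set \<Rightarrow> 'a set" where
  "fixset A = {x \<in> M. \<forall>f\<in>A. f x = x}"

lemma fixset_mono: "A \<subseteq> B \<Longrightarrow> fixset B \<subseteq> fixset A"
  by (auto simp: fixset_def)

lemma continuous_map_isometry:
  assumes "f \<in> isometries M d"
  shows "continuous_map mtopology mtopology f"
  unfolding continuous_map_to_metric
proof (intro ballI allI impI)
  fix x and e :: real assume "x \<in> topspace mtopology" "e > 0"
  then show "\<exists>U. openin mtopology U \<and> x \<in> U \<and> (\<forall>y\<in>U. f y \<in> mball (f x) e)"
    using isometriesD(1,2)[OF assms] by (intro exI[of _ "mball x e"]) auto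
qed

lemma continuous_map_dist:
  assumes "continuous_map X mtopology f" "continuous_map X mtopology g"
  shows "continuous_map X euclideanreal (\<lambda>x. d (f x) (g x))"
  using continuous_map_mdist[of X "metric (M, d)" f g] assms
  by (simp add: mtopology_of_def mspace_metric mdist_metric)

lemma continuous_map_displacement:
  "f \<in> isometries M d \<Longrightarrow> continuous_map mtopology euclideanreal (\<lambda>x. d x (f x))"
  using continuous_map_dist[OF continuous_map_id continuous_map_isometry] by simp

lemma closedin_fixset:
  assumes "A \<subseteq> isometries M d"
  shows "closedin mtopology (fixset A)"
proof (cases "A = {}")
  case False
  have "fixset A = (\<Inter>f\<in>A. {x \<in> topspace mtopology. d x (f x) \<in> {0}})"
    using False isometriesD(1)[OF subsetD[OF assms]] by (auto simp: fixset_def) (metis zero)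
  moreover have "closedin mtopology {x \<in> topspace mtopology. d x (f x) \<in> {0}}" if "f \<in> A" for f
    using that assms
    by (intro closedin_continuous_map_preimage[OF continuous_map_displacement]) auto
  ultimately show ?thesis using False by auto
qed (auto simp: fixset_def)

end

context CAT0_space
begin

lemma CN_midpoint_dist:
  assumes "is_CN_midpoint m x y" "x \<in> M" "y \<in> M"
  shows "(d m x)\<^sup>2 \<le> (d x y)\<^sup>2 / 4" "(d m y)\<^sup>2 \<le> (d x y)\<^sup>2 / 4"
proof -
  have le: "(d m z)\<^sup>2 \<le> ((d z x)\<^sup>2 + (d z y)\<^sup>2) / 2 - (d x y)\<^sup>2 / 4" if "z \<in> M" for z
    using assms(1) that by (simp add: is_CN_midpoint_def)
  show "(d m x)\<^sup>2 \<le> (d x y)\<^sup>2 / 4" "(d m y)\<^sup>2 \<le> (d x y)\<^sup>2 / 4"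
    using le[of x] le[of y] assms by (simp_all add: commute[of y x])
qed

text \<open>The image of a midpoint is again at distance at most half from both ends, and the Bruhat--Tits
  inequality leaves room for only one such point.\<close>

lemma isometry_fixes_midpoint:
  assumes f: "f \<in> isometries M d" and m: "is_CN_midpoint m x y"
    and x: "x \<in> M" "f x = x" and y: "y \<in> M" "f y = y"
  shows "f m = m"
proof -
  have mM: "m \<in> M" using m by (simp add: is_CN_midpoint_def)
  have fm: "f m \<in> M" using isometriesD(1)[OF f mM] .
  have "d (f m) x = d m x" "d (f m) y = d m y"
    using isometriesD(2)[OF f mM x(1)] isometriesD(2)[OF f mM y(1)] x y by auto
  moreover have "(d m (f m))\<^sup>2 \<le> ((d (f m) x)\<^sup>2 + (d (f m) y)\<^sup>2) / 2 - (d x y)\<^sup>2 / 4"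
    using m fm by (simp add: is_CN_midpoint_def)
  ultimately have "(d m (f m))\<^sup>2 \<le> ((d m x)\<^sup>2 + (d m y)\<^sup>2) / 2 - (d x y)\<^sup>2 / 4" by simp
  then have "(d m (f m))\<^sup>2 \<le> 0" using CN_midpoint_dist[OF m x(1) y(1)] by argo
  then show ?thesis using mM fm by simp
qed

lemma closed_convex_fixset:
  assumes A: "A \<subseteq> isometries M d" and ne: "fixset A \<noteq> {}"
  shows "closed_convex (fixset A)"
  unfolding closed_convex_def
proof (intro conjI ballI closedin_fixset A ne)
  fix x y assume xy: "x \<in> fixset A" "y \<in> fixset A"
  then obtain m where m: "is_CN_midpoint m x y"
    using CN_midpoint[of x y] by (auto simp: is_CN_midpoint_def fixset_def)
  then show "\<exists>m\<in>fixset A. is_CN_midpoint m x y"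
    using isometry_fixes_midpoint[OF _ m] xy A
    by (intro bexI[of _ m]) (auto simp: fixset_def is_CN_midpoint_def)
qed

end

context complete_CAT0_space
begin

text \<open>The point of least total squared distance to a finite invariant set is unique, hence fixed.\<close>

lemma finite_invariant_set_fixed_point:
  assumes Q: "finite Q" "Q \<noteq> {}" "Q \<subseteq> M"
    and F: "F \<subseteq> isometries M d" and inv: "\<And>f. f \<in> F \<Longrightarrow> f ` Q \<subseteq> Q"
  shows "fixset F \<noteq> {}"
proof -
  let ?E = "energy Q (\<lambda>_. 1) (\<lambda>v. v)"
  have card: "card Q > 0" using Q by (simp add: card_gt_0_iff)
  obtain b where b: "b \<in> M" "\<And>x. x \<in> M \<Longrightarrow> ?E b + real (card Q) / 2 * (d x b)\<^sup>2 \<le> ?E x"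
    using energy_minimiser_exists[OF closed_convex_M, of Q "\<lambda>_. 1" "\<lambda>v. v"] Q card by auto
  have "f b = b" if f: "f \<in> F" for f
  proof -
    have iso: "f \<in> isometries M d" using f F by auto
    have fQ: "f ` Q = Q" "inj_on f Q"
      using endo_inj_surj[OF Q(1) inv[OF f]] inj_on_subset[OF isometriesD(4)[OF iso] Q(3)] by blast+
    have "?E (f b) = (\<Sum>v\<in>f ` Q. (d (f b) v)\<^sup>2)" using fQ by (simp add: energy_def)
    also have "\<dots> = (\<Sum>v\<in>Q. (d (f b) (f v))\<^sup>2)" by (subst sum.reindex[OF fQ(2)]) simp
    also have "\<dots> = ?E b"
      unfolding energy_def using isometriesD(2)[OF iso b(1)] Q by (intro sum.cong) auto
    finally have "real (card Q) / 2 * (d (f b) b)\<^sup>2 \<le> 0"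
      using b(2)[OF isometriesD(1)[OF iso b(1)]] by simp
    then show ?thesis
      using card isometriesD(1)[OF iso b(1)] b(1) by (simp add: mult_le_0_iff)
  qed
  then show ?thesis using b(1) by (auto simp: fixset_def)
qed

text \<open>The nearest-point projection onto \<open>fixset A\<close> commutes with every isometry preserving
  \<open>fixset A\<close>, so it carries fixed points of \<open>B\<close> to common fixed points. The hypothesis is the inclusion
  that follows from a relation of the form \<open>b a = a' b\<close> without passing to inverses.\<close>

lemma fixset_Un_nonempty:
  assumes A: "A \<subseteq> isometries M d" and B: "B \<subseteq> isometries M d"
    and neA: "fixset A \<noteq> {}" and neB: "fixset B \<noteq> {}"
    and pres: "\<And>b y. b \<in> B \<Longrightarrow> y \<in> M \<Longrightarrow> b y \<in> fixset A \<Longrightarrow> y \<in> fixset A"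
  shows "fixset (A \<union> B) \<noteq> {}"
proof -
  obtain p where p: "p \<in> M" "\<And>b. b \<in> B \<Longrightarrow> b p = p" using neB by (auto simp: fixset_def)
  obtain c where c: "c \<in> fixset A"
      "\<And>x. x \<in> fixset A \<Longrightarrow> (d c p)\<^sup>2 + 1/2 * (d x c)\<^sup>2 \<le> (d x p)\<^sup>2"
    using energy_minimiser_exists[OF closed_convex_fixset[OF A neA], of "{()}" "\<lambda>_. 1" "\<lambda>_. p"] p
    by (auto simp: energy_def)
  have cM: "c \<in> M" using c by (simp add: fixset_def)
  have "b c = c" if b: "b \<in> B" for b
  proof -
    have iso: "b \<in> isometries M d" using b B by auto
    obtain y where y: "y \<in> M" "b y = c" using isometriesD(3)[OF iso] cM by (metis imageE)
    then have yA: "y \<in> fixset A" using pres[OF b y(1)] c(1) by simp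
    have "d y p = d c p" using isometriesD(2)[OF iso y(1) p(1)] y p(2)[OF b] by simp
    then have "(d y c)\<^sup>2 \<le> 0" using c(2)[OF yA] by simp
    then have "y = c" using y cM by simp
    then show ?thesis using y by simp
  qed
  then show ?thesis using c(1) cM by (auto simp: fixset_def)
qed

lemma fixset_Un_commuting:
  assumes A: "A \<subseteq> isometries M d" and B: "B \<subseteq> isometries M d"
    and "fixset A \<noteq> {}" "fixset B \<noteq> {}"
    and comm: "\<And>a b y. a \<in> A \<Longrightarrow> b \<in> B \<Longrightarrow> y \<in> M \<Longrightarrow> a (b y) = b (a y)"
  shows "fixset (A \<union> B) \<noteq> {}"
proof (rule fixset_Un_nonempty[OF assms(1-4)])
  fix b y assume b: "b \<in> B" and y: "y \<in> M" and by_fix: "b y \<in> fixset A"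
  have "a y = y" if a: "a \<in> A" for a
  proof -
    have "b (a y) = b y" using by_fix a comm[OF a b y, symmetric] by (simp add: fixset_def)
    then show ?thesis
      using b B a A y isometriesD(1)[of a M d] isometriesD(4)[of b M d] by (meson inj_onD subsetD)
  qed
  then show "y \<in> fixset A" using y by (simp add: fixset_def)
qed

lemma fixset_UNION_commuting:
  assumes "finite I" and "\<And>i. i \<in> I \<Longrightarrow> A i \<subseteq> isometries M d" and "\<And>i. i \<in> I \<Longrightarrow> fixset (A i) \<noteq> {}"
    and "\<And>i j a b y. i \<in> I \<Longrightarrow> j \<in> I \<Longrightarrow> i \<noteq> j \<Longrightarrow> a \<in> A i \<Longrightarrow> b \<in> A j \<Longrightarrow> y \<in> M \<Longrightarrow> a (b y) = b (a y)"
  shows "fixset (\<Union>i\<in>I. A i) \<noteq> {}"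
  using assms
proof (induction I)
  case empty
  then show ?case using nonempty by (auto simp: fixset_def)
next
  case (insert i I)
  have "fixset (A i \<union> (\<Union>j\<in>I. A j)) \<noteq> {}"
  proof (rule fixset_Un_commuting)
    show "fixset (\<Union>j\<in>I. A j) \<noteq> {}"
      by (rule insert.IH) (use insert.prems in \<open>blast+\<close>)
    fix a b y assume "a \<in> A i" "b \<in> (\<Union>j\<in>I. A j)" "y \<in> M"
    then show "a (b y) = b (a y)" using insert.prems(3) insert.hyps by blast
  qed (use insert.prems in auto)
  then show ?case by simp
qed

section \<open>Weighted barycentres\<close>

text \<open>For nonnegative weights, not all zero, this is the point of least energy; in the other cases the value
  is arbitrary.\<close>

definition barycentre :: "'b set \<Rightarrow> ('b \<Rightarrow> 'a) \<Rightarrow> ('b \<Rightarrow> real) \<Rightarrow> 'a" where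
  "barycentre V p w =
     (SOME b. b \<in> M \<and> (\<forall>x\<in>M. energy V w p b + sum w V / 2 * (d x b)\<^sup>2 \<le> energy V w p x))"

lemma barycentre:
  assumes "\<forall>v\<in>V. 0 \<le> w v" "\<forall>v\<in>V. p v \<in> M" "0 < sum w V"
  shows "barycentre V p w \<in> M"
    and "x \<in> M \<Longrightarrow> energy V w p (barycentre V p w) + sum w V / 2 * (d x (barycentre V p w))\<^sup>2
                     \<le> energy V w p x"
proof -
  have "\<exists>b. b \<in> M \<and> (\<forall>x\<in>M. energy V w p b + sum w V / 2 * (d x b)\<^sup>2 \<le> energy V w p x)"
    using energy_minimiser_exists[OF closed_convex_M assms] by blast
  from someI_ex[OF this]
  show "barycentre V p w \<in> M"
    and "x \<in> M \<Longrightarrow> energy V w p (barycentre V p w) + sum w V / 2 * (d x (barycentre V p w))\<^sup>2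
                     \<le> energy V w p x"
    unfolding barycentre_def by blast+
qed

text \<open>Points of weight zero do not influence the barycentre. This replaces the statement that a
  barycentre lies in the convex hull of the points of positive weight.\<close>

lemma barycentre_fixed:
  assumes "\<forall>v\<in>V. 0 \<le> w v" "\<forall>v\<in>V. p v \<in> M" "0 < sum w V"
    and f: "f \<in> isometries M d" and fp: "\<And>v. v \<in> V \<Longrightarrow> w v \<noteq> 0 \<Longrightarrow> f (p v) = p v"
  shows "f (barycentre V p w) = barycentre V p w"
proof -
  let ?b = "barycentre V p w"
  note b = barycentre[OF assms(1-3)]
  have fb: "f ?b \<in> M" using isometriesD(1)[OF f b(1)] .
  have "w v * (d (f ?b) (p v))\<^sup>2 = w v * (d ?b (p v))\<^sup>2" if v: "v \<in> V" for v
    using isometriesD(2)[OF f b(1), of "p v"] assms(2) v fp[OF v] by (cases "w v = 0") auto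
  then have "energy V w p (f ?b) = energy V w p ?b"
    unfolding energy_def by (rule sum.cong[OF refl])
  then have "sum w V / 2 * (d (f ?b) ?b)\<^sup>2 \<le> 0" using b(2)[OF fb] by simp
  then show ?thesis using assms(3) fb b(1) by (simp add: mult_le_0_iff)
qed

text \<open>A crude bound, uniform in the weights, which makes the estimate of \<open>barycentre_dist\<close> uniform: some
  \<open>p v\<close> is within \<open>R\<close> of the barycentre, since otherwise \<open>p u\<close> would have less energy.\<close>

lemma barycentre_near:
  assumes "\<forall>v\<in>V. 0 \<le> w v" "\<forall>v\<in>V. p v \<in> M" "0 < sum w V"
    and R: "\<forall>u\<in>V. \<forall>v\<in>V. d (p u) (p v) \<le> R" and u: "u \<in> V"
  shows "d (barycentre V p w) (p u) \<le> 2 * R"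
proof -
  let ?b = "barycentre V p w"
  note b = barycentre[OF assms(1-3)]
  have R0: "R \<ge> 0" using R u assms(2) by fastforce
  have "\<exists>v\<in>V. d ?b (p v) \<le> R"
  proof (rule ccontr)
    assume "\<not> ?thesis"
    then have far: "R < d ?b (p v)" if "v \<in> V" for v using that by force
    have le: "w v * (d (p u) (p v))\<^sup>2 \<le> w v * (d ?b (p v))\<^sup>2" if "v \<in> V" for v
      using R u that far[OF that] assms(1) by (intro mult_left_mono power_mono) fastforce+
    obtain v where v: "v \<in> V" "w v > 0"
      using assms(1,3) by (metis less_eq_real_def order_less_irrefl sum.neutral)
    have "(d (p u) (p v))\<^sup>2 < (d ?b (p v))\<^sup>2"
      using R u v(1) far[OF v(1)] by (intro power_strict_mono) fastforce+
    then have "energy V w p (p u) < energy V w p ?b"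
      unfolding energy_def
      using v le assms(3) sum.infinite[of V w] by (intro sum_strict_mono_ex1) fastforce+
    moreover have "energy V w p ?b \<le> energy V w p (p u)"
      using b(2)[of "p u"] assms(2) u assms(3)
      by (smt (verit) divide_nonneg_nonneg mult_nonneg_nonneg zero_le_power2)
    ultimately show False by simp
  qed
  then obtain v where v: "v \<in> V" "d ?b (p v) \<le> R" by blast
  show ?thesis
    using triangle[OF b(1), of "p v" "p u"] assms(2) v u R by force
qed

text \<open>Comparing the energies of the two minimisers for both weights bounds their squared distance
  linearly in the change of the weights.\<close>

lemma barycentre_dist:
  assumes w: "\<forall>v\<in>V. 0 \<le> w v" "0 < sum w V" and w': "\<forall>v\<in>V. 0 \<le> w' v" "0 < sum w' V"
    and p: "\<forall>v\<in>V. p v \<in> M"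
    and R: "\<forall>u\<in>V. \<forall>v\<in>V. d (p u) (p v) \<le> R"
  shows "sum w V / 2 * (d (barycentre V p w') (barycentre V p w))\<^sup>2
           \<le> 8 * R\<^sup>2 * (\<Sum>v\<in>V. \<bar>w' v - w v\<bar>)"
proof -
  let ?b = "barycentre V p w" and ?b' = "barycentre V p w'"
  note b = barycentre[OF w(1) p w(2)] and b' = barycentre[OF w'(1) p w'(2)]
  have near: "(d ?b (p v))\<^sup>2 \<le> 4 * R\<^sup>2" "(d ?b' (p v))\<^sup>2 \<le> 4 * R\<^sup>2" if v: "v \<in> V" for v
    using power_mono[OF barycentre_near[OF w(1) p w(2) R v] nonneg, of 2]
      power_mono[OF barycentre_near[OF w'(1) p w'(2) R v] nonneg, of 2]
    by (simp_all add: power_mult_distrib)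
  have "sum w V / 2 * (d ?b' ?b)\<^sup>2 \<le> energy V w p ?b' - energy V w p ?b" using b(2)[OF b'(1)] by simp
  also have "\<dots> \<le> (energy V w p ?b' - energy V w' p ?b') + (energy V w' p ?b - energy V w p ?b)"
  proof -
    have "energy V w' p ?b' \<le> energy V w' p ?b"
      using b'(2)[OF b(1)] w'(2) by (smt (verit) divide_nonneg_nonneg mult_nonneg_nonneg zero_le_power2)
    then show ?thesis by simp
  qed
  also have "\<dots> = (\<Sum>v\<in>V. (w' v - w v) * ((d ?b (p v))\<^sup>2 - (d ?b' (p v))\<^sup>2))"
    unfolding energy_def by (simp add: algebra_simps flip: sum.distrib sum_subtractf)
  also have "\<dots> \<le> (\<Sum>v\<in>V. \<bar>w' v - w v\<bar> * (8 * R\<^sup>2))"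
  proof (rule sum_mono)
    fix v assume v: "v \<in> V"
    have "\<bar>(d ?b (p v))\<^sup>2 - (d ?b' (p v))\<^sup>2\<bar> \<le> 8 * R\<^sup>2"
      using near[OF v] zero_le_power2[of "d ?b (p v)"] zero_le_power2[of "d ?b' (p v)"] by linarith
    then have "\<bar>w' v - w v\<bar> * \<bar>(d ?b (p v))\<^sup>2 - (d ?b' (p v))\<^sup>2\<bar> \<le> \<bar>w' v - w v\<bar> * (8 * R\<^sup>2)"
      by (intro mult_left_mono) auto
    then show "(w' v - w v) * ((d ?b (p v))\<^sup>2 - (d ?b' (p v))\<^sup>2) \<le> \<bar>w' v - w v\<bar> * (8 * R\<^sup>2)"
      by (simp only: flip: abs_mult)
  qed
  also have "\<dots> = 8 * R\<^sup>2 * (\<Sum>v\<in>V. \<bar>w' v - w v\<bar>)" by (simp only: sum_distrib_right[symmetric] mult.commute)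
  finally show ?thesis .
qed

lemma continuous_map_barycentre:
  assumes V: "finite V" and p: "\<forall>v\<in>V. p v \<in> M"
    and cont: "\<And>v. v \<in> V \<Longrightarrow> continuous_map T euclideanreal (\<lambda>y. w y v)"
    and w: "\<And>y. y \<in> topspace T \<Longrightarrow> \<forall>v\<in>V. 0 \<le> w y v" "\<And>y. y \<in> topspace T \<Longrightarrow> 0 < sum (w y) V"
  shows "continuous_map T mtopology (\<lambda>y. barycentre V p (w y))"
  unfolding continuous_map_to_metric
proof (intro ballI allI impI)
  fix x and e :: real assume x: "x \<in> topspace T" and e: "e > 0"
  let ?b = "\<lambda>y. barycentre V p (w y)"
  define R where "R = 1 + (\<Sum>u\<in>V. \<Sum>v\<in>V. d (p u) (p v))"
  have R: "\<forall>u\<in>V. \<forall>v\<in>V. d (p u) (p v) \<le> R"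
  proof (intro ballI)
    fix u v assume that: "u \<in> V" "v \<in> V"
    have "d (p u) (p v) \<le> (\<Sum>v\<in>V. d (p u) (p v))" using that V by (intro member_le_sum) auto
    also have "\<dots> \<le> (\<Sum>u\<in>V. \<Sum>v\<in>V. d (p u) (p v))"
      using that V by (intro member_le_sum[of u V "\<lambda>u. \<Sum>v\<in>V. d (p u) (p v)"]) (auto intro: sum_nonneg)
    finally show "d (p u) (p v) \<le> R" by (simp add: R_def)
  qed
  have R1: "R \<ge> 1" unfolding R_def by (simp add: sum_nonneg)
  define W where "W = sum (w x) V"
  have W: "W > 0" using w(2)[OF x] by (simp add: W_def)
  define \<eta> where "\<eta> = W / 2 * e\<^sup>2 / (8 * R\<^sup>2)"
  have \<eta>: "\<eta> > 0" using W e R1 by (simp add: \<eta>_def)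
  define U where "U = {y \<in> topspace T. (\<Sum>v\<in>V. \<bar>w y v - w x v\<bar>) \<in> {..<\<eta>}}"
  have "openin T U"
    unfolding U_def
    by (intro openin_continuous_map_preimage[where Y=euclideanreal] continuous_map_sum continuous_map_real_abs
        continuous_map_diff cont V) auto
  moreover have "x \<in> U" using x \<eta> by (simp add: U_def)
  moreover have "?b y \<in> mball (?b x) e" if y: "y \<in> U" for y
  proof -
    have yT: "y \<in> topspace T" using y by (simp add: U_def)
    have b: "?b x \<in> M" "?b y \<in> M"
      using barycentre(1)[OF w(1)[OF x] p w(2)[OF x]]
        barycentre(1)[OF w(1)[OF yT] p w(2)[OF yT]] by auto
    have "W / 2 * (d (?b y) (?b x))\<^sup>2 \<le> 8 * R\<^sup>2 * (\<Sum>v\<in>V. \<bar>w y v - w x v\<bar>)"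
      unfolding W_def
      by (rule barycentre_dist[OF w(1)[OF x] w(2)[OF x] w(1)[OF yT] w(2)[OF yT] p R])
    also have "\<dots> < 8 * R\<^sup>2 * \<eta>" using y R1 by (intro mult_strict_left_mono) (auto simp: U_def)
    also have "\<dots> = W / 2 * e\<^sup>2" using R1 by (simp add: \<eta>_def)
    finally have "(d (?b y) (?b x))\<^sup>2 < e\<^sup>2" using W by simp
    then have "d (?b y) (?b x) < e" using e by (simp add: power2_less_imp_less)
    then show ?thesis using b by (simp add: in_mball commute)
  qed
  ultimately show "\<exists>U. openin T U \<and> x \<in> U \<and> (\<forall>y\<in>U. ?b y \<in> mball (?b x) e)" by blast
qed

end

section \<open>Nerves and covering dimension\<close>

lemma continuous_map_into_nsphere:
  assumes "\<And>i. continuous_map X euclideanreal (\<lambda>x. f x i)"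
    and "\<And>x. x \<in> topspace X \<Longrightarrow> (\<Sum>i\<le>r. (f x i)\<^sup>2) = 1"
    and "\<And>x i. x \<in> topspace X \<Longrightarrow> i > r \<Longrightarrow> f x i = 0"
  shows "continuous_map X (nsphere r) f"
  unfolding nsphere using assms
  by (auto simp: continuous_map_in_subtopology continuous_map_componentwise_UNIV)

lemma topspace_nsphere: "topspace (nsphere r) = {x. (\<Sum>i\<le>r. (x i)\<^sup>2) = 1 \<and> (\<forall>i>r. x i = 0)}"
  by (simp add: nsphere)

lemma norm_pos:
  fixes y :: "nat \<Rightarrow> real"
  assumes "\<exists>i\<le>r. y i \<noteq> 0"
  shows "0 < sqrt (\<Sum>i\<le>r. (y i)\<^sup>2)"
proof -
  obtain i where "i \<le> r" "y i \<noteq> 0" using assms by blast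
  then show ?thesis by (simp add: sum_pos2[of _ i])
qed

lemma continuous_map_normalise:
  assumes cont: "\<And>i. continuous_map X euclideanreal (\<lambda>x. f x i)"
    and nz: "\<And>x. x \<in> topspace X \<Longrightarrow> \<exists>i\<le>r. f x i \<noteq> 0"
    and high: "\<And>x i. x \<in> topspace X \<Longrightarrow> i > r \<Longrightarrow> f x i = 0"
  shows "continuous_map X (nsphere r) (\<lambda>x i. f x i / sqrt (\<Sum>i\<le>r. (f x i)\<^sup>2))"
proof (rule continuous_map_into_nsphere)
  note pos = norm_pos[OF nz]
  fix i show "continuous_map X euclideanreal (\<lambda>x. f x i / sqrt (\<Sum>i\<le>r. (f x i)\<^sup>2))"
    using pos by (intro continuous_map_real_divide continuous_map_sqrt continuous_map_sum
        continuous_map_real_pow cont) (auto simp: less_imp_neq[symmetric])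
next
  fix x assume x: "x \<in> topspace X"
  let ?S = "\<Sum>i\<le>r. (f x i)\<^sup>2"
  have "?S > 0" using norm_pos[OF nz[OF x]] by simp
  moreover have "(\<Sum>i\<le>r. (f x i / sqrt ?S)\<^sup>2) = ?S / (sqrt ?S)\<^sup>2"
    by (simp add: power_divide sum_divide_distrib)
  ultimately show "(\<Sum>i\<le>r. (f x i / sqrt ?S)\<^sup>2) = 1" by simp
qed (simp add: high)

text \<open>The segment between two non-antipodal points of the sphere avoids the origin.\<close>

lemma homotopic_nonantipodal:
  assumes f: "continuous_map X (nsphere r) f" and g: "continuous_map X (nsphere r) g"
    and nonanti: "\<And>x. x \<in> topspace X \<Longrightarrow> \<exists>i\<le>r. f x i \<noteq> - g x i"
  shows "homotopic_with (\<lambda>_. True) X (nsphere r) f g"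
proof -
  let ?T = "prod_topology (top_of_set {0..1::real}) X"
  have fS: "f x \<in> topspace (nsphere r)" and gS: "g x \<in> topspace (nsphere r)" if "x \<in> topspace X" for x
    using that continuous_map_image_subset_topspace[OF f] continuous_map_image_subset_topspace[OF g] by auto
  define q where "q = (\<lambda>(t::real, x) i. (1 - t) * f x i + t * g x i)"
  have q_nonzero: "\<exists>i\<le>r. q (t, x) i \<noteq> 0" if t: "t \<in> {0..1}" and x: "x \<in> topspace X" for t x
  proof (rule ccontr)
    assume "\<not> ?thesis"
    then have q0: "(1 - t) * f x i = - (t * g x i)" if "i \<le> r" for i
      using that by (auto simp: q_def eq_neg_iff_add_eq_0)
    have "(1 - t)\<^sup>2 * (\<Sum>i\<le>r. (f x i)\<^sup>2) = (\<Sum>i\<le>r. ((1 - t) * f x i)\<^sup>2)"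
      by (simp add: sum_distrib_left power_mult_distrib)
    also have "\<dots> = (\<Sum>i\<le>r. (t * g x i)\<^sup>2)" using q0 by simp
    also have "\<dots> = t\<^sup>2 * (\<Sum>i\<le>r. (g x i)\<^sup>2)"
      by (simp add: sum_distrib_left power_mult_distrib)
    finally have "(1 - t)\<^sup>2 = t\<^sup>2" using fS[OF x] gS[OF x] by (simp add: topspace_nsphere)
    then have t: "t = 1/2" by (simp add: power2_eq_square algebra_simps)
    have "f x i = - g x i" if "i \<le> r" for i using q0[OF that] unfolding t by simp
    then show False using nonanti[OF x] by blast
  qed
  have q_cont: "continuous_map ?T euclideanreal (\<lambda>z. q z i)" for i
  proof -
    have proj: "continuous_map (nsphere r) euclideanreal (\<lambda>y. y i)"
      by (rule continuous_map_nsphere_projection)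
    have "continuous_map ?T euclideanreal (\<lambda>z. fst z)"
      using continuous_map_compose[OF continuous_map_fst continuous_map_into_fulltopology[OF continuous_map_id]]
      by (simp add: o_def)
    moreover have "continuous_map ?T euclideanreal (\<lambda>z. f (snd z) i)"
      using continuous_map_compose[OF continuous_map_compose[OF continuous_map_snd f] proj] by (simp add: o_def)
    moreover have "continuous_map ?T euclideanreal (\<lambda>z. g (snd z) i)"
      using continuous_map_compose[OF continuous_map_compose[OF continuous_map_snd g] proj] by (simp add: o_def)
    ultimately show ?thesis
      unfolding q_def case_prod_beta by (intro continuous_intros) auto
  qed
  let ?h = "\<lambda>z i. q z i / sqrt (\<Sum>i\<le>r. (q z i)\<^sup>2)"
  have "continuous_map ?T (nsphere r) ?h"
  proof (rule continuous_map_normalise[OF q_cont])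
    fix z assume z: "z \<in> topspace ?T"
    then show "\<exists>i\<le>r. q z i \<noteq> 0" using q_nonzero[of "fst z" "snd z"] by auto
    show "q z i = 0" if "r < i" for i
      using z that fS[of "snd z"] gS[of "snd z"] by (auto simp: q_def topspace_nsphere)
  qed
  moreover have "?h (0, x) = f x" "?h (1, x) = g x"
    if "x \<in> topspace X" for x
    using fS[OF that] gS[OF that] by (simp_all add: q_def topspace_nsphere)
  ultimately show ?thesis
    by (subst homotopic_with) (auto intro!: exI[of _ ?h])
qed

context complete_CAT0_space
begin

text \<open>The indices in \<open>E\<close> are split into blocks with empty common fixed set, but omitting one index from
  every block leaves a family with a common fixed point. So the nerve of the fixed sets contains a join of
  boundaries of simplices, a sphere of dimension \<open>r = card E - card (blk ` E) - 1\<close>. If the dimension of the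
  space were at most \<open>r\<close>, the identity of this sphere would be null-homotopic.

  In coordinates, a point of the sphere assigns a number to each index, and the representative of
  each block has coordinate \<open>0\<close>. One map, \<open>\<sigma>\<close>, goes from the sphere to the space: it takes a
  barycentre of the points \<open>p v\<close> fixed by all \<open>g e\<close> with \<open>e\<close> not chosen by the transversal \<open>v\<close>. The other one,
  \<open>\<Phi>\<close>, records the displacements \<open>d x (g e x)\<close> relative to the representative of the block. It does not vanish
  on the union \<open>K\<close> of the fixed sets, and its normalisation extends from \<open>K\<close> to a map \<open>G\<close> on the space by the
  assumption on the dimension. The composition of \<open>\<sigma>\<close> with \<open>G\<close> is never antipodal to the
  identity, because \<open>\<sigma>\<close> sends a point to the fixed set of an index whose coordinate is minimal in its block, where
  the displacement is minimal too. It is null-homotopic since the weights of the barycentre can be moved to the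
  constant \<open>1\<close>.\<close>

theorem nerve_dimension_bound:
  fixes E :: "'e set" and blk :: "'e \<Rightarrow> 'b" and g :: "'e \<Rightarrow> 'a \<Rightarrow> 'a"
  assumes dim: "covering_dim_at_most mtopology n"
    and E: "finite E" and g: "\<And>e. e \<in> E \<Longrightarrow> g e \<in> isometries M d"
    and block: "\<And>e. e \<in> E \<Longrightarrow> fixset (g ` {e' \<in> E. blk e' = blk e}) = {}"
    and transversal: "\<And>v. (\<And>e. e \<in> E \<Longrightarrow> v (blk e) \<in> E \<and> blk (v (blk e)) = blk e) \<Longrightarrow>
                        fixset (g ` {e \<in> E. v (blk e) \<noteq> e}) \<noteq> {}"
  shows "card E \<le> card (blk ` E) + n"
proof (rule ccontr)
  assume "\<not> ?thesis"
  then have big: "card E > card (blk ` E) + n" by simp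
  define B where "B = blk ` E"
  have B: "finite B" using E by (simp add: B_def)
  define rep where "rep = (\<lambda>\<beta>. SOME e. e \<in> E \<and> blk e = \<beta>)"
  have rep: "rep \<beta> \<in> E \<and> blk (rep \<beta>) = \<beta>" if "\<beta> \<in> B" for \<beta>
    unfolding rep_def by (rule someI_ex) (use that in \<open>auto simp: B_def\<close>)
  define Q where "Q = E - rep ` B"
  have Q: "finite Q" "Q \<subseteq> E" using E by (auto simp: Q_def)
  have "inj_on rep B" using rep by (metis inj_onI)
  then have "card Q = card E - card B"
    unfolding Q_def using rep B by (subst card_Diff_subset) (auto simp: card_image)
  then have "card Q > n" using big by (simp add: B_def)
  then obtain r where r: "card Q = Suc r" "n \<le> r" by (cases "card Q") auto
  obtain h where h: "bij_betw h {..r} Q"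
    using r Q(1) by (metis card_atMost finite_atMost finite_same_card_bij)
  define k where "k = inv_into {..r} h"
  have hQ: "h i \<in> Q" if "i \<le> r" for i using h that by (auto simp: bij_betw_def)
  have k: "k e \<le> r" "h (k e) = e" if "e \<in> Q" for e
    using h that unfolding k_def by (auto simp: bij_betw_def f_inv_into_f dest: inv_into_into)
  have kh: "k (h i) = i" if "i \<le> r" for i
    using h that unfolding k_def by (auto simp: bij_betw_def)

  (* Fixing the coordinate of each representative to be 0 leaves r + 1 free coordinates. *)
  define Y where "Y = (\<lambda>(y::nat \<Rightarrow> real) e. if e \<in> Q then y (k e) else 0)"
  have Y_cont: "continuous_map (nsphere r) euclideanreal (\<lambda>y. Y y e)" for e
    by (cases "e \<in> Q") (simp_all add: Y_def continuous_map_nsphere_projection)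
  have Y_rep: "Y y (rep \<beta>) = 0" if "\<beta> \<in> B" for y \<beta> using that by (simp add: Y_def Q_def)
  (* The weight of e vanishes iff e is minimal in its block and its block has the largest spread A.
     Sums of positive parts are used in place of minima and maxima because their continuity is immediate. *)
  define blo where "blo = (\<lambda>e. {e' \<in> E. blk e' = blk e})"
  have blo: "finite (blo e)" for e using E by (simp add: blo_def)
  define a where "a = (\<lambda>y e. \<Sum>e'\<in>blo e. max 0 (Y y e - Y y e'))"
  define A where "A = (\<lambda>y \<beta>. \<Sum>e\<in>{e \<in> E. blk e = \<beta>}. a y e)"
  define w where "w = (\<lambda>y e. a y e + (\<Sum>\<beta>\<in>B. max 0 (A y \<beta> - A y (blk e))))"
  have a0: "a y e \<ge> 0" for y e unfolding a_def by (intro sum_nonneg) simp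
  have A0: "A y \<beta> \<ge> 0" for y \<beta> unfolding A_def by (intro sum_nonneg a0)
  have w0: "w y e \<ge> 0" for y e unfolding w_def by (intro add_nonneg_nonneg a0 sum_nonneg) simp
  have a_cont: "continuous_map (nsphere r) euclideanreal (\<lambda>y. a y e)" for e
    unfolding a_def by (intro continuous_intros Y_cont blo) auto
  have A_cont: "continuous_map (nsphere r) euclideanreal (\<lambda>y. A y \<beta>)" for \<beta>
    unfolding A_def using E by (intro continuous_intros a_cont) auto
  have w_cont: "continuous_map (nsphere r) euclideanreal (\<lambda>y. w y e)" for e
    unfolding w_def by (intro continuous_intros a_cont A_cont B) auto

  have w_pos: "\<exists>e\<in>E. blk e = \<beta> \<and> w y e > 0" if y: "y \<in> topspace (nsphere r)" and \<beta>: "\<beta> \<in> B" for y \<beta>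
  proof -
    have "\<exists>i\<le>r. y i \<noteq> 0"
      by (rule ccontr) (use y in \<open>auto simp: topspace_nsphere\<close>)
    then obtain i where i: "i \<le> r" "y i \<noteq> 0" by blast
    define e0 where "e0 = h i"
    have e0: "e0 \<in> E" "Y y e0 \<noteq> 0" using hQ[OF i(1)] Q i kh by (auto simp: e0_def Y_def)
    have b0: "blk e0 \<in> B" using e0 by (auto simp: B_def)
    define e1 where "e1 = rep (blk e0)"
    have e1: "e1 \<in> E" "blk e1 = blk e0" "Y y e1 = 0" using rep[OF b0] Y_rep[OF b0] by (auto simp: e1_def)
    have apos: "a y e > 0" if "e' \<in> blo e" "Y y e > Y y e'" for e e'
      unfolding a_def using that by (intro sum_pos2[OF blo that(1)]) auto
    have "a y e0 > 0 \<or> a y e1 > 0"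
      using apos[of e1 e0] apos[of e0 e1] e0 e1 by (cases "Y y e0 > 0") (auto simp: blo_def)
    then obtain e2 where e2: "e2 \<in> E" "blk e2 = blk e0" "a y e2 > 0" using e0 e1 by blast
    have Apos: "A y (blk e0) > 0"
      unfolding A_def using E e2 a0 by (intro sum_pos2[of _ e2]) auto
    show ?thesis
    proof (cases "A y \<beta> > 0")
      case True
      then obtain e where "e \<in> E" "blk e = \<beta>" "a y e \<noteq> 0"
        unfolding A_def by (metis (mono_tags, lifting) mem_Collect_eq order_less_irrefl sum.neutral)
      moreover then have "a y e > 0" using a0[of y e] by simp
      then have "w y e > 0" unfolding w_def by (intro add_pos_nonneg sum_nonneg) auto
      ultimately show ?thesis by blast
    next
      case False
      have "(\<Sum>\<beta>'\<in>B. max 0 (A y \<beta>' - A y \<beta>)) > 0"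
        using False Apos by (intro sum_pos2[OF B b0]) auto
      then have "w y (rep \<beta>) > 0" unfolding w_def using rep[OF \<beta>] a0[of y "rep \<beta>"] by simp
      then show ?thesis using rep[OF \<beta>] by blast
    qed
  qed
  have w_zero: "\<exists>e\<in>E. w y e = 0 \<and> (\<forall>e'\<in>blo e. Y y e \<le> Y y e')" for y
  proof -
    have "E \<noteq> {}" using r Q by auto
    then have "B \<noteq> {}" by (simp add: B_def)
    then have "Max (A y ` B) \<in> A y ` B" using B by (intro Max_in) auto
    then obtain \<beta> where \<beta>_max: "\<beta> \<in> B" "A y \<beta> = Max (A y ` B)" by auto
    have \<beta>: "\<beta> \<in> B" "\<And>\<beta>'. \<beta>' \<in> B \<Longrightarrow> A y \<beta>' \<le> A y \<beta>"
      unfolding \<beta>_max(2) using \<beta>_max(1) B by auto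
    let ?b = "{e \<in> E. blk e = \<beta>}"
    have "finite ?b" "?b \<noteq> {}" using E \<beta>(1) by (auto simp: B_def)
    then have "Min (Y y ` ?b) \<in> Y y ` ?b" by (intro Min_in) auto
    then obtain e where e_min: "e \<in> ?b" "Y y e = Min (Y y ` ?b)" by auto
    have e: "e \<in> ?b" "\<And>e'. e' \<in> ?b \<Longrightarrow> Y y e \<le> Y y e'"
      unfolding e_min(2) using e_min(1) \<open>finite ?b\<close> by auto
    have "a y e = 0" unfolding a_def using e by (intro sum.neutral) (auto simp: blo_def)
    moreover have "(\<Sum>\<beta>'\<in>B. max 0 (A y \<beta>' - A y (blk e))) = 0"
      using e \<beta> by (intro sum.neutral) auto
    ultimately show ?thesis using e by (intro bexI[of _ e]) (auto simp: w_def blo_def)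
  qed

  (* The barycentre of the points p v with weight the product of the weights of the chosen indices;
     the parameter t deforms all weights to 1. *)
  define V where "V = PiE B (\<lambda>\<beta>. {e \<in> E. blk e = \<beta>})"
  have V: "finite V" unfolding V_def using B E by (intro finite_PiE) auto
  define p where "p = (\<lambda>v. SOME x. x \<in> fixset (g ` {e \<in> E. v (blk e) \<noteq> e}))"
  have p: "p v \<in> fixset (g ` {e \<in> E. v (blk e) \<noteq> e})" if "v \<in> V" for v
  proof -
    have "fixset (g ` {e \<in> E. v (blk e) \<noteq> e}) \<noteq> {}"
      using that by (intro transversal) (auto simp: V_def B_def PiE_def Pi_def)
    then show ?thesis unfolding p_def by (rule some_in_eq[THEN iffD2])
  qed
  have pM: "\<forall>v\<in>V. p v \<in> M" using p by (auto simp: fixset_def)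
  let ?T = "prod_topology (top_of_set {0..1::real}) (nsphere r)"
  define W where "W = (\<lambda>(t::real, y) e. (1 - t) * w y e + t)"
  define L where "L = (\<lambda>z v. \<Prod>\<beta>\<in>B. W z (v \<beta>))"
  define \<sigma> where "\<sigma> = (\<lambda>z. barycentre V p (L z))"
  have W0: "W z e \<ge> 0" if "z \<in> topspace ?T" for z e
    using that w0 by (auto simp: W_def intro!: add_nonneg_nonneg mult_nonneg_nonneg)
  have L0: "\<forall>v\<in>V. L z v \<ge> 0" if "z \<in> topspace ?T" for z
    unfolding L_def using W0[OF that] by (auto intro: prod_nonneg)
  have L1: "sum (L z) V > 0" if z: "z \<in> topspace ?T" for z
  proof -
    obtain t y where ty: "z = (t, y)" "t \<in> {0..1}" "y \<in> topspace (nsphere r)" using z by auto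
    have "\<exists>e. e \<in> E \<and> blk e = \<beta> \<and> w y e > 0" if "\<beta> \<in> B" for \<beta> using w_pos[OF ty(3) that] by blast
    then obtain u where u: "\<And>\<beta>. \<beta> \<in> B \<Longrightarrow> u \<beta> \<in> E \<and> blk (u \<beta>) = \<beta> \<and> w y (u \<beta>) > 0" by metis
    define v where "v = restrict u B"
    have v: "v \<in> V" using u by (auto simp: v_def V_def)
    have "W z (v \<beta>) > 0" if "\<beta> \<in> B" for \<beta>
    proof (cases "t = 1")
      case False
      then show ?thesis using u[OF that] ty that by (auto simp: W_def v_def intro!: add_pos_nonneg)
    qed (use ty in \<open>simp add: W_def\<close>)
    then have "L z v > 0" unfolding L_def by (intro prod_pos) auto
    then show ?thesis using L0[OF z] v by (intro sum_pos2[OF V v]) auto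
  qed
  have W_cont: "continuous_map ?T euclideanreal (\<lambda>z. W z e)" for e
  proof -
    have "continuous_map ?T euclideanreal (\<lambda>z. fst z)"
      using continuous_map_compose[OF continuous_map_fst continuous_map_into_fulltopology[OF continuous_map_id]]
      by (simp add: o_def)
    moreover have "continuous_map ?T euclideanreal (\<lambda>z. w (snd z) e)"
      using continuous_map_compose[OF continuous_map_snd w_cont[of e]] by (simp add: o_def)
    ultimately show ?thesis
      unfolding W_def case_prod_beta by (intro continuous_intros) auto
  qed
  have \<sigma>_cont: "continuous_map ?T mtopology \<sigma>"
    unfolding \<sigma>_def
  proof (rule continuous_map_barycentre[OF V pM])
    show "continuous_map ?T euclideanreal (\<lambda>z. L z v)" for v
      unfolding L_def by (intro continuous_intros W_cont B)
  qed (use L0 L1 in auto)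

  define f where "f = (\<lambda>e x. d x (g e x))"
  have f_cont: "continuous_map mtopology euclideanreal (f e)" if "e \<in> E" for e
    unfolding f_def by (rule continuous_map_displacement[OF g[OF that]])
  have f_zero: "f e x = 0 \<longleftrightarrow> g e x = x" if "e \<in> E" "x \<in> M" for e x
    using isometriesD(1)[OF g[OF that(1)] that(2)] that by (auto simp: f_def)
  define \<Phi> where "\<Phi> = (\<lambda>x i. if i \<le> r then f (h i) x - f (rep (blk (h i))) x else 0)"
  define N where "N = (\<lambda>x. sqrt (\<Sum>i\<le>r. (\<Phi> x i)\<^sup>2))"
  define K where "K = (\<Union>e\<in>E. fixset {g e})"
  have K: "closedin mtopology K"
    unfolding K_def using E g by (intro closedin_Union) (auto intro!: closedin_fixset)
  have in_blocks: "blk e \<in> B" if "e \<in> E" for e using that by (simp add: B_def)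
  have \<Phi>_nonzero: "\<exists>i\<le>r. \<Phi> x i \<noteq> 0" if x: "x \<in> K" for x
  proof (rule ccontr)
    assume "\<not> ?thesis"
    then have \<Phi>0: "\<Phi> x i = 0" if "i \<le> r" for i using that by blast
    have const: "f e x = f (rep (blk e)) x" if e: "e \<in> E" for e
    proof (cases "e \<in> Q")
      case True
      then show ?thesis using \<Phi>0[OF k(1)[OF True]] k[OF True] by (simp add: \<Phi>_def)
    next
      case False
      then obtain \<beta> where "\<beta> \<in> B" "e = rep \<beta>" using e by (auto simp: Q_def)
      then show ?thesis using rep by simp
    qed
    obtain e where e: "e \<in> E" "x \<in> M" "g e x = x" using x by (auto simp: K_def fixset_def)
    have "g e' x = x" if "e' \<in> E" "blk e' = blk e" for e'
      using const[OF that(1)] const[OF e(1)] f_zero[OF e(1,2)] f_zero[OF that(1) e(2)] e(3) that(2) by simp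
    then have "x \<in> fixset (g ` {e' \<in> E. blk e' = blk e})" using e(2) by (auto simp: fixset_def)
    then show False using block[OF e(1)] by simp
  qed
  have \<Phi>_cont: "continuous_map mtopology euclideanreal (\<lambda>x. \<Phi> x i)" for i
  proof (cases "i \<le> r")
    case True
    then have "h i \<in> E" "rep (blk (h i)) \<in> E" using hQ Q rep in_blocks by auto
    then show ?thesis using True unfolding \<Phi>_def by (simp add: continuous_map_diff f_cont)
  qed (simp add: \<Phi>_def)
  have N_pos: "N x > 0" if "x \<in> K" for x unfolding N_def by (rule norm_pos[OF \<Phi>_nonzero[OF that]])
  have \<Phi>_sphere: "continuous_map (subtopology mtopology K) (nsphere r) (\<lambda>x i. \<Phi> x i / N x)"
    unfolding N_def
    by (intro continuous_map_normalise continuous_map_from_subtopology \<Phi>_cont)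
      (use \<Phi>_nonzero in \<open>auto simp: \<Phi>_def\<close>)
  obtain G where G: "continuous_map mtopology (nsphere r) G" "\<And>x. x \<in> K \<Longrightarrow> G x = (\<lambda>i. \<Phi> x i / N x)"
    using dim[unfolded covering_dim_at_most_def, rule_format, OF conjI[OF K conjI[OF r(2) \<Phi>_sphere]]]
    by auto

  have G\<sigma>: "continuous_map ?T (nsphere r) (G \<circ> \<sigma>)" by (rule continuous_map_compose[OF \<sigma>_cont G(1)])
  define u where "u = (\<lambda>y. G (\<sigma> (0, y)))"
  define c where "c = G (barycentre V p (\<lambda>v. 1))"
  have "L (1, y) = (\<lambda>v. 1)" for y by (auto simp: L_def W_def)
  then have \<sigma>1: "G (\<sigma> (1, y)) = c" for y by (simp add: \<sigma>_def c_def)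
  have null: "homotopic_with (\<lambda>_. True) (nsphere r) (nsphere r) u (\<lambda>_. c)"
    by (subst homotopic_with) (use G\<sigma> \<sigma>1 in \<open>auto simp: u_def intro!: exI[of _ "G \<circ> \<sigma>"]\<close>)
  have "homotopic_with (\<lambda>_. True) (nsphere r) (nsphere r) id u"
  proof (rule homotopic_nonantipodal)
    show "continuous_map (nsphere r) (nsphere r) u"
      using homotopic_with_imp_continuous_maps[OF null] by blast
    fix y assume y: "y \<in> topspace (nsphere r)"
    show "\<exists>i\<le>r. id y i \<noteq> - u y i"
    proof (rule ccontr)
      assume "\<not> ?thesis"
      then have anti: "u y i = - y i" if "i \<le> r" for i using that by force
      obtain e where e: "e \<in> E" "w y e = 0" and mn: "\<And>e'. e' \<in> blo e \<Longrightarrow> Y y e \<le> Y y e'"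
        using w_zero[of y] by blast
      have z: "(0, y) \<in> topspace ?T" using y by simp
      define x where "x = \<sigma> (0, y)"
      have x: "x \<in> M" unfolding x_def \<sigma>_def by (rule barycentre(1)[OF L0[OF z] pM L1[OF z]])
      have gx: "g e x = x"
        unfolding x_def \<sigma>_def
      proof (rule barycentre_fixed[OF L0[OF z] pM L1[OF z] g[OF e(1)]])
        fix v assume v: "v \<in> V" and L: "L (0, y) v \<noteq> 0"
        have "W (0, y) (v (blk e)) \<noteq> 0" using L in_blocks[OF e(1)] B by (auto simp: L_def)
        then have "v (blk e) \<noteq> e" using e(2) by (auto simp: W_def)
        then show "g e (p v) = p v" using p[OF v] e(1) by (auto simp: fixset_def)
      qed
      have xK: "x \<in> K" using x gx e(1) by (auto simp: K_def fixset_def)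
      have \<Phi>x: "\<Phi> x i = - (N x * y i)" if "i \<le> r" for i
      proof -
        have "\<Phi> x i / N x = - y i" using anti[OF that] G(2)[OF xK] by (simp add: u_def x_def)
        then show ?thesis using N_pos[OF xK] by (simp add: field_simps)
      qed
      (* In a block, displacement is a decreasing function of the coordinate. As e has minimal coordinate
         and displacement 0, the whole block fixes x. *)
      have fx: "f e' x = f (rep (blk e')) x - N x * Y y e'" if e': "e' \<in> E" for e'
      proof (cases "e' \<in> Q")
        case True
        then show ?thesis using \<Phi>x[OF k(1)[OF True]] k[OF True] by (simp add: \<Phi>_def Y_def)
      next
        case False
        then obtain \<beta> where "\<beta> \<in> B" "e' = rep \<beta>" using e' by (auto simp: Q_def)
        then show ?thesis using rep Y_rep by simp
      qed
      have "g e' x = x" if e': "e' \<in> E" "blk e' = blk e" for e'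
      proof -
        have "f e x = 0" using f_zero[OF e(1) x] gx by simp
        then have "f e' x = N x * (Y y e - Y y e')" using fx[OF e(1)] fx[OF e'(1)] e'(2) by (simp add: algebra_simps)
        also have "\<dots> \<le> 0" using N_pos[OF xK] mn[of e'] e' by (simp add: mult_le_0_iff blo_def)
        finally have "f e' x = 0" by (simp add: f_def order_antisym)
        then show ?thesis using f_zero[OF e'(1) x] by simp
      qed
      then have "x \<in> fixset (g ` {e' \<in> E. blk e' = blk e})" using x by (auto simp: fixset_def)
      then show False using block[OF e(1)] by simp
    qed
  qed simp
  then have "contractible_space (nsphere r)"
    using homotopic_with_trans[OF _ null] by (auto simp: contractible_space_def)
  then show False by (simp add: non_contractible_space_nsphere)
qed

end

context complete_CAT0_space
begin

text \<open>A counterexample gives, in each family, a minimal subset \<open>T i\<close> without common fixed point; it has more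
  than \<open>k i\<close> elements. Proper subsets of different \<open>T i\<close> have fixed points and commute, so their unions have
  common fixed points, and the sets \<open>T i\<close> form the blocks of \<open>nerve_dimension_bound\<close>.\<close>

theorem commuting_families_fixed_point:
  fixes S :: "'i \<Rightarrow> ('a \<Rightarrow> 'a) set" and k :: "'i \<Rightarrow> nat"
  assumes dim: "covering_dim_at_most mtopology n"
    and I: "finite I" and fin: "\<And>i. i \<in> I \<Longrightarrow> finite (S i)"
    and iso: "\<And>i. i \<in> I \<Longrightarrow> S i \<subseteq> isometries M d"
    and comm: "\<And>i j f g x. i \<in> I \<Longrightarrow> j \<in> I \<Longrightarrow> i \<noteq> j \<Longrightarrow> f \<in> S i \<Longrightarrow> g \<in> S j \<Longrightarrow> x \<in> M \<Longrightarrow> f (g x) = g (f x)"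
    and small: "\<And>i A. i \<in> I \<Longrightarrow> A \<subseteq> S i \<Longrightarrow> card A \<le> k i \<Longrightarrow> fixset A \<noteq> {}"
    and big: "n < sum k I"
  shows "\<exists>i\<in>I. fixset (S i) \<noteq> {}"
proof (rule ccontr)
  assume no: "\<not> ?thesis"
  have "\<exists>T. T \<subseteq> S i \<and> fixset T = {} \<and> (\<forall>A. A \<subset> T \<longrightarrow> fixset A \<noteq> {})" if i: "i \<in> I" for i
  proof -
    obtain T where T: "T \<subseteq> S i" "fixset T = {}"
      and least: "\<And>A. A \<subseteq> S i \<and> fixset A = {} \<Longrightarrow> card T \<le> card A"
      using ex_has_least_nat[of "\<lambda>T. T \<subseteq> S i \<and> fixset T = {}" "S i" card] no i by auto
    have "fixset A \<noteq> {}" if "A \<subset> T" for A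
      using psubset_card_mono[OF finite_subset[OF T(1) fin[OF i]] that] least[of A] that T(1) by auto
    then show ?thesis using T by blast
  qed
  then obtain T where T: "\<And>i. i \<in> I \<Longrightarrow> T i \<subseteq> S i" "\<And>i. i \<in> I \<Longrightarrow> fixset (T i) = {}"
    "\<And>i A. i \<in> I \<Longrightarrow> A \<subset> T i \<Longrightarrow> fixset A \<noteq> {}" by metis
  have finT: "finite (T i)" if "i \<in> I" for i using finite_subset[OF T(1) fin] that by blast
  have cardT: "k i + 1 \<le> card (T i)" if "i \<in> I" for i
    using small[OF that T(1)[OF that]] T(2)[OF that] by (metis Suc_eq_plus1 not_less_eq_eq)
  define E where "E = Sigma I T"
  have E: "finite E" using I finT by (simp add: E_def)
  have neT: "T i \<noteq> {}" if "i \<in> I" for i using cardT[OF that] by auto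
  have "fst ` E = I"
  proof
    show "I \<subseteq> fst ` E"
    proof
      fix i assume i: "i \<in> I"
      then obtain a where "a \<in> T i" using neT by blast
      then show "i \<in> fst ` E" using i by (intro image_eqI[of _ _ "(i, a)"]) (auto simp: E_def)
    qed
  qed (auto simp: E_def)
  moreover have "card E \<le> card (fst ` E) + n"
  proof (rule nerve_dimension_bound[OF dim E, of snd])
    show "snd e \<in> isometries M d" if "e \<in> E" for e using that T(1) iso by (cases e) (auto simp: E_def)
  next
    fix e assume "e \<in> E"
    then have i: "fst e \<in> I" by (auto simp: E_def)
    then have "{e' \<in> E. fst e' = fst e} = Pair (fst e) ` T (fst e)" by (auto simp: E_def)
    then show "fixset (snd ` {e' \<in> E. fst e' = fst e}) = {}" using T(2)[OF i] by (simp add: image_image)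
  next
    fix v assume v: "\<And>e. e \<in> E \<Longrightarrow> v (fst e) \<in> E \<and> fst (v (fst e)) = fst e"
    define t where "t = (\<lambda>i. snd (v i))"
    have ve: "v i = (i, t i)" "t i \<in> T i" if i: "i \<in> I" for i
    proof -
      obtain a where "(i, a) \<in> E" using neT[OF i] i by (auto simp: E_def)
      then have "v i \<in> E" "fst (v i) = i" using v[of "(i, a)"] by auto
      then show "v i = (i, t i)" "t i \<in> T i" by (cases "v i"; simp add: t_def E_def)+
    qed
    have "fixset (\<Union>i\<in>I. T i - {t i}) \<noteq> {}"
    proof (rule fixset_UNION_commuting[OF I])
      show "T i - {t i} \<subseteq> isometries M d" if "i \<in> I" for i using T(1) iso that by blast
      show "fixset (T i - {t i}) \<noteq> {}" if "i \<in> I" for i using T(3)[OF that] ve(2)[OF that] by blast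
      fix i j f g x
      assume "i \<in> I" "j \<in> I" "i \<noteq> j" "f \<in> T i - {t i}" "g \<in> T j - {t j}" "x \<in> M"
      then show "f (g x) = g (f x)" using T(1) by (intro comm[of i j]) blast+
    qed
    moreover have "snd ` {e \<in> E. v (fst e) \<noteq> e} \<subseteq> (\<Union>i\<in>I. T i - {t i})"
      using ve by (auto simp: E_def)
    ultimately show "fixset (snd ` {e \<in> E. v (fst e) \<noteq> e}) \<noteq> {}"
      using fixset_mono by blast
  qed
  moreover have "card E = (\<Sum>i\<in>I. card (T i))" using I finT by (simp add: E_def)
  moreover have "(\<Sum>i\<in>I. k i + 1) \<le> (\<Sum>i\<in>I. card (T i))" by (intro sum_mono cardT)
  ultimately show False using big by (simp add: sum_Suc)
qed

end

section \<open>Cancellation in free groups\<close>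

abbreviation (input) winv :: "('a \<times> bool) list \<Rightarrow> ('a \<times> bool) list" where
  "winv w \<equiv> rev (map inv_letter w)"

lemma winv_winv [simp]: "winv (winv w) = w"
  by (simp add: rev_map comp_def)

lemma reduced_append:
  "reduced (u @ v) \<longleftrightarrow> reduced u \<and> reduced v \<and> (u \<noteq> [] \<longrightarrow> v \<noteq> [] \<longrightarrow> hd v \<noteq> inv_letter (last u))"
  by (auto simp: reduced_def successively_append_iff)

lemma mult_reduced_append: "reduced (u @ v) \<Longrightarrow> foldr push_letter u v = u @ v"
proof (induction u)
  case (Cons k u)
  then show ?case using reduced_ConsD[of k "u @ v"] push_reduced[of k "u @ v"] by simp
qed simp

lemma mult_cancel_middle:
  "reduced c \<Longrightarrow> foldr push_letter (a @ winv p) (p @ c) = foldr push_letter a c" if "reduced (p @ c)"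
proof -
  assume "reduced c"
  have "foldr push_letter (winv p) (foldr push_letter p c) = c" by (rule inverse_mult) fact
  then show ?thesis by (simp add: mult_reduced_append[OF that])
qed

text \<open>Every product of reduced words arises by cancelling one maximal piece \<open>p\<close>.\<close>

lemma mult_cancellation:
  assumes "reduced u" "reduced v"
  shows "\<exists>a p c. u = a @ winv p \<and> v = p @ c \<and> foldr push_letter u v = a @ c \<and> reduced (a @ c)"
  using assms(1)
proof (induction u)
  case Nil
  show ?case using assms(2) by (intro exI[of _ "[]"] exI[of _ v]) simp
next
  case (Cons k u)
  obtain a p c where IH: "u = a @ winv p" "v = p @ c" "foldr push_letter u v = a @ c" "reduced (a @ c)"
    using Cons.IH reduced_ConsD[OF Cons.prems] by blast
  show ?case
  proof (cases "a \<noteq> [] \<or> c = [] \<or> hd c \<noteq> inv_letter k")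
    case True
    then have "reduced (k # a @ c)"
      using IH(1,4) Cons.prems reduced_append[of "[k]" "a @ c"] reduced_append[of "[k]" u]
      by (cases a; cases c) (auto simp: reduced_def)
    then show ?thesis using IH push_reduced[of k "a @ c"]
      by (intro exI[of _ "k # a"] exI[of _ p] exI[of _ c]) simp
  next
    case False
    then obtain c' where c: "a = []" "c = inv_letter k # c'" by (cases c) auto
    then show ?thesis using IH reduced_ConsD[of "inv_letter k" c']
      by (intro exI[of _ "[]"] exI[of _ "p @ [inv_letter k]"] exI[of _ c']) simp
  qed
qed

text \<open>If squaring cancelled more than half of a word, the middle of the word would be its own inverse.\<close>

lemma length_square_ge:
  assumes "reduced u"
  shows "length u \<le> length (foldr push_letter u u)"
proof -
  obtain a p c where apc: "u = a @ winv p" "u = p @ c" "foldr push_letter u u = a @ c"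
    using mult_cancellation[OF assms assms] by blast
  have len: "length u = length a + length p" "length u = length p + length c"
    using arg_cong[OF apc(1), of length] arg_cong[OF apc(2), of length] by simp_all
  have "2 * length p \<le> length u"
  proof (rule ccontr)
    assume more: "\<not> 2 * length p \<le> length u"
    have sym: "u ! i = inv_letter (u ! (length u - 1 - i))" if i: "i < length u" "length u - length p \<le> i" for i
    proof -
      define j where "j = length u - 1 - i"
      have j: "j < length p" "length p - 1 - (i - length a) = j" "length a \<le> i" "i - length a < length p"
        using i len by (auto simp: j_def)
      have "u ! i = winv p ! (i - length a)"
        by (subst apc(1)) (use j in \<open>simp add: nth_append\<close>)
      also have "\<dots> = inv_letter (p ! j)"
        using j by (simp add: rev_nth flip: j(2))
      also have "p ! j = u ! j"
        by (subst apc(2)) (use j in \<open>simp add: nth_append\<close>)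
      also have "j = length u - 1 - i" by (simp add: j_def)
      finally show ?thesis .
    qed
    define i where "i = length u div 2"
    have i: "i < length u" "length u - length p \<le> i" using more len unfolding i_def by linarith+
    show False
    proof (cases "even (length u)")
      case True
      then have eq: "length u - 1 - i = i - 1" "i \<ge> 1" using i unfolding i_def by auto
      have "Suc (i - 1) < length u" using i eq by simp
      then have "u ! Suc (i - 1) \<noteq> inv_letter (u ! (i - 1))"
        using assms by (simp add: reduced_def successively_conv_nth)
      then show False using sym[OF i] eq by simp
    next
      case False
      then have "length u - 1 - i = i" unfolding i_def by presburger
      then show False using sym[OF i] by simp
    qed
  qed
  then show ?thesis using apc(3) len by simp
qed

section \<open>A numerical tie-breaker for Nielsen reduction\<close>

text \<open>The letters are read as digits in base \<open>b\<close>, which will be \<open>2 * n\<close>; on words of equal length this is an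
  injective measure that is monotone for the lexicographic order.\<close>

fun word_number :: "nat \<Rightarrow> (nat \<times> bool) list \<Rightarrow> nat" where
  "word_number b [] = 0"
| "word_number b (k # w) = (2 * fst k + of_bool (snd k)) * b ^ length w + word_number b w"

lemma word_number_less:
  "\<forall>k\<in>set w. fst k < n \<Longrightarrow> n \<ge> 1 \<Longrightarrow> word_number (2 * n) w < (2 * n) ^ length w"
proof (induction w)
  case (Cons k w)
  have "2 * fst k + of_bool (snd k) + 1 \<le> 2 * n" using Cons.prems by auto
  then have "(2 * fst k + of_bool (snd k) + 1) * (2 * n) ^ length w \<le> 2 * n * (2 * n) ^ length w"
    by (rule mult_le_mono1)
  then show ?case using Cons by (simp add: add_mult_distrib)
qed simp

lemma digits_unique:
  fixes x y B r s :: nat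
  assumes "x * B + r = y * B + s" "r < B" "s < B"
  shows "x = y \<and> r = s"
proof -
  have "(x * B + r) div B = x" "(y * B + s) div B = y" using assms(2,3) by simp_all
  then have "x = y" using assms(1) by metis
  then show ?thesis using assms(1) by simp
qed

lemma word_number_inject:
  assumes "length v = length w" "\<forall>k\<in>set v. fst k < n" "\<forall>k\<in>set w. fst k < n"
    and "word_number (2 * n) v = word_number (2 * n) w"
  shows "v = w"
  using assms
proof (induction v w rule: list_induct2)
  case (Cons k v l w)
  then have n: "n \<ge> 1" by auto
  let ?B = "(2 * n) ^ length w"
  have less: "word_number (2 * n) v < ?B" "word_number (2 * n) w < ?B"
    using word_number_less[of v n] word_number_less[of w n] Cons n by auto
  have eq: "(2 * fst k + of_bool (snd k)) * ?B + word_number (2 * n) v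
      = (2 * fst l + of_bool (snd l)) * ?B + word_number (2 * n) w"
    using Cons by simp
  have kl: "2 * fst k + of_bool (snd k) = (2 * fst l + of_bool (snd l) :: nat)"
      "word_number (2 * n) v = word_number (2 * n) w"
    using digits_unique[OF eq less] by auto
  have "even (2 * fst k + of_bool (snd k) :: nat) \<longleftrightarrow> even (2 * fst l + of_bool (snd l) :: nat)" using kl(1) by simp
  then have "snd k = snd l" by (auto simp: of_bool_def split: if_splits)
  then have "k = l" using kl(1) by (simp add: prod_eq_iff)
  then show ?case using Cons kl(2) by simp
qed simp

lemma word_number_append: "word_number b (v @ w) = word_number b v * b ^ length w + word_number b w"
  by (induction v) (simp_all add: algebra_simps power_add)

text \<open>Exchanging an initial segment of at most half the length of \<open>w\<close> affects \<open>half w\<close> but not the half of the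
  inverse of \<open>w\<close>.\<close>

definition half :: "'a list \<Rightarrow> 'a list" where
  "half w = take ((length w + 1) div 2) w"

text \<open>Both ends of the word enter, which makes the number invariant under inversion.\<close>

definition halves_number :: "nat \<Rightarrow> (nat \<times> bool) list \<Rightarrow> nat" where
  "halves_number n w = word_number (2 * n) (half w) + word_number (2 * n) (half (winv w))"

lemma halves_number_winv: "halves_number n (winv w) = halves_number n w"
  by (simp add: halves_number_def rev_map comp_def)

lemma halves_number_less:
  assumes pq: "length p = length q" "word_number (2 * n) p < word_number (2 * n) q"
    and c: "length q \<le> length c" and n: "n \<ge> 1"
  shows "halves_number n (p @ c) < halves_number n (q @ c)"
proof -
  let ?h = "(length q + length c + 1) div 2"
  have le: "length q \<le> ?h" "?h \<le> length c" using c by auto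
  have "half (p @ c) = p @ take (?h - length q) c" "half (q @ c) = q @ take (?h - length q) c"
    using pq le by (simp_all add: half_def)
  moreover have "half (winv (p @ c)) = take ?h (winv c)" "half (winv (q @ c)) = take ?h (winv c)"
    using pq le by (simp_all add: half_def add.commute)
  ultimately show ?thesis
    using pq n by (simp add: halves_number_def word_number_append)
qed

section \<open>Automorphisms of a free group and two-sided transvections\<close>

locale free_group_automorphisms =
  fixes n :: nat
begin

abbreviation G :: "(nat \<times> bool) list monoid" where "G \<equiv> free_group {..<n}"
abbreviation Aut :: "((nat \<times> bool) list \<Rightarrow> (nat \<times> bool) list) monoid" where "Aut \<equiv> AutoGroup G"
abbreviation fmult (infixl "\<cdot>" 70) where "u \<cdot> v \<equiv> u \<otimes>\<^bsub>G\<^esub> v"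
abbreviation amult (infixl "\<star>" 70) where "a \<star> b \<equiv> a \<otimes>\<^bsub>Aut\<^esub> b"
abbreviation finv :: "(nat \<times> bool) list \<Rightarrow> (nat \<times> bool) list" where "finv u \<equiv> inv\<^bsub>G\<^esub> u"
abbreviation gen :: "nat \<Rightarrow> (nat \<times> bool) list" where "gen i \<equiv> [(i, True)]"
abbreviation words :: "nat set \<Rightarrow> (nat \<times> bool) list set" where "words J \<equiv> carrier (free_group J)"
abbreviation others :: "nat \<Rightarrow> nat set" where "others i \<equiv> {..<n} - {i}"

sublocale G: group G by (rule group_free_group)
sublocale A: group Aut by (rule G.AutoGroup)

lemma fmult_eq: "u \<cdot> v = foldr push_letter u v"
  by (simp add: free_group_def)

lemma fone_eq: "\<one>\<^bsub>G\<^esub> = []"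
  by (simp add: free_group_def)

lemma words_iff: "w \<in> words J \<longleftrightarrow> reduced w \<and> set w \<subseteq> J \<times> UNIV"
  by (simp add: free_group_def)

lemma words_mono: "J \<subseteq> K \<Longrightarrow> words J \<subseteq> words K"
  by (auto simp: words_iff subset_iff)

lemma letter_in_words [simp]: "[k] \<in> words J \<longleftrightarrow> fst k \<in> J"
  by (cases k) (auto simp: words_iff reduced_def)

lemma Nil_in_words [simp]: "[] \<in> words J"
  by (simp add: words_iff)

lemma words_mult: "u \<in> words J \<Longrightarrow> v \<in> words J \<Longrightarrow> u \<cdot> v \<in> words J"
  using set_mult[of u v] by (auto simp: words_iff fmult_eq reduced_mult)

lemma winv_in_words: "u \<in> words J \<Longrightarrow> winv u \<in> words J"
  by (fastforce simp: words_iff reduced_inverse inv_letter_def)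

lemma finv_eq: "u \<in> carrier G \<Longrightarrow> finv u = winv u"
proof (rule G.inv_equality)
  assume u: "u \<in> carrier G"
  then show "winv u \<cdot> u = \<one>\<^bsub>G\<^esub>"
    using inverse_mult[of "[]" u] by (simp add: fmult_eq fone_eq words_iff mult_Nil)
qed (auto simp: winv_in_words)

lemma words_finv: "J \<subseteq> {..<n} \<Longrightarrow> u \<in> words J \<Longrightarrow> finv u \<in> words J"
  using words_mono[of J "{..<n}"] winv_in_words[of u J] by (auto simp: finv_eq)

lemma finv_letter: "fst k < n \<Longrightarrow> finv [k] = [inv_letter k]"
  by (simp add: finv_eq)

lemma Cons_eq_fmult: "k # w \<in> words J \<Longrightarrow> k # w = [k] \<cdot> w"
  by (simp add: fmult_eq words_iff push_reduced)

lemma Cons_in_words: "k # w \<in> words J \<Longrightarrow> fst k \<in> J \<and> w \<in> words J"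
  by (auto simp: words_iff dest: reduced_ConsD)

lemma fmult_Nil [simp]: "w \<in> carrier G \<Longrightarrow> w \<cdot> [] = w" "w \<in> carrier G \<Longrightarrow> [] \<cdot> w = w"
  by (simp_all flip: fone_eq)

lemma finv_cancel:
  assumes "u \<in> carrier G" "w \<in> carrier G"
  shows "finv u \<cdot> (u \<cdot> w) = w" "u \<cdot> (finv u \<cdot> w) = w"
  using assms by (simp_all flip: G.m_assoc)

lemma words_others: "u \<in> words (others i) \<Longrightarrow> u \<in> carrier G"
  using words_mono[of "others i" "{..<n}"] by auto

lemma Aut_iff: "a \<in> carrier Aut \<longleftrightarrow> a \<in> hom G G \<and> a \<in> Bij (carrier G)"
  by (simp add: AutoGroup_def auto_def)

lemma Aut_closed: "a \<in> carrier Aut \<Longrightarrow> u \<in> carrier G \<Longrightarrow> a u \<in> carrier G"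
  by (auto simp: Aut_iff hom_def)

lemma Aut_mult: "a \<in> carrier Aut \<Longrightarrow> u \<in> carrier G \<Longrightarrow> v \<in> carrier G \<Longrightarrow> a (u \<cdot> v) = a u \<cdot> a v"
  by (auto simp: Aut_iff hom_def)

lemma Aut_group_hom: "a \<in> carrier Aut \<Longrightarrow> group_hom G G a"
  by (simp add: Aut_iff group_hom_def group_hom_axioms_def)

lemma Aut_finv: "a \<in> carrier Aut \<Longrightarrow> u \<in> carrier G \<Longrightarrow> a (finv u) = finv (a u)"
  using group_hom.hom_inv[OF Aut_group_hom] by blast

lemma Aut_Nil: "a \<in> carrier Aut \<Longrightarrow> a [] = []"
  using group_hom.hom_one[OF Aut_group_hom] by (simp add: fone_eq)

lemma Aut_inj: "a \<in> carrier Aut \<Longrightarrow> u \<in> carrier G \<Longrightarrow> v \<in> carrier G \<Longrightarrow> a u = a v \<longleftrightarrow> u = v"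
  by (auto simp: Aut_iff Bij_def bij_betw_def inj_on_def)

lemma Aut_surj: "a \<in> carrier Aut \<Longrightarrow> v \<in> carrier G \<Longrightarrow> \<exists>u\<in>carrier G. a u = v"
  unfolding Aut_iff Bij_def bij_betw_def by (metis (mono_tags) IntD2 imageE mem_Collect_eq)

lemma amult_apply: "a \<in> carrier Aut \<Longrightarrow> b \<in> carrier Aut \<Longrightarrow> u \<in> carrier G \<Longrightarrow> (a \<star> b) u = a (b u)"
  by (simp add: AutoGroup_def BijGroup_def auto_def compose_eq)

lemma aone_apply: "u \<in> carrier G \<Longrightarrow> \<one>\<^bsub>Aut\<^esub> u = u"
  by (simp add: AutoGroup_def BijGroup_def)

lemma Aut_eqI:
  assumes "a \<in> carrier Aut" "b \<in> carrier Aut" "\<And>i. i < n \<Longrightarrow> a (gen i) = b (gen i)"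
  shows "a = b"
proof (rule extensionalityI)
  show "a \<in> extensional (carrier G)" "b \<in> extensional (carrier G)"
    using assms(1,2) by (auto simp: Aut_iff Bij_def)
  show "a u = b u" if "u \<in> carrier G" for u
    using free_group_extend_unique[OF group_free_group, where h=a and h'=b and w=u and S="{..<n}"] assms that by (auto simp: Aut_iff)
qed

lemma Aut_letter:
  assumes "a \<in> carrier Aut" "i < n"
  shows "a [(i, c)] = (if c then a (gen i) else finv (a (gen i)))"
proof (cases c)
  case False
  have "[(i, False)] = finv (gen i)" using assms(2) by (simp add: finv_letter inv_letter_def)
  then show ?thesis using False Aut_finv[OF assms(1), of "gen i"] assms(2) by simp
qed simp

lemma Aut_Cons:
  assumes "a \<in> carrier Aut" "k # w \<in> carrier G"
  shows "a (k # w) = a [k] \<cdot> a w"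
proof -
  have "[k] \<in> carrier G" "w \<in> carrier G" using Cons_in_words[OF assms(2)] by auto
  from Aut_mult[OF assms(1) this] show ?thesis using Cons_eq_fmult[OF assms(2)] by simp
qed

lemma Aut_words:
  assumes a: "a \<in> carrier Aut" and J: "J \<subseteq> {..<n}" and K: "K \<subseteq> {..<n}"
    and gens: "\<And>j. j \<in> J \<Longrightarrow> a (gen j) \<in> words K" and u: "u \<in> words J"
  shows "a u \<in> words K"
  using u
proof (induction u)
  case Nil
  then show ?case by (simp add: Aut_Nil[OF a])
next
  case (Cons k w)
  have k: "fst k \<in> J" "w \<in> words J" using Cons_in_words[OF Cons.prems] by auto
  have "k # w \<in> carrier G" using Cons.prems words_mono[OF J] by blast
  moreover have "a [k] \<in> words K"
    using Aut_letter[OF a, of "fst k" "snd k"] gens[OF k(1)] words_finv[OF K] k(1) J by auto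
  ultimately show ?case using Aut_Cons[OF a] Cons.IH[OF k(2)] words_mult by metis
qed

lemma Aut_fixes_words:
  assumes a: "a \<in> carrier Aut" and J: "J \<subseteq> {..<n}" and gens: "\<And>j. j \<in> J \<Longrightarrow> a (gen j) = gen j"
    and u: "u \<in> words J"
  shows "a u = u"
  using u
proof (induction u)
  case (Cons k w)
  have k: "fst k \<in> J" "w \<in> words J" using Cons_in_words[OF Cons.prems] by auto
  have kw: "k # w \<in> carrier G" using Cons.prems words_mono[OF J] by blast
  have "a [k] = [k]"
    using Aut_letter[OF a, of "fst k" "snd k"] gens[OF k(1)] k(1) J
    by (cases k; cases "snd k") (auto simp: finv_letter inv_letter_def)
  then show ?case using Aut_Cons[OF a kw] Cons.IH[OF k(2)] Cons_eq_fmult[OF kw] by simp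
qed (simp add: Aut_Nil[OF a])

definition gen_hom :: "(nat \<Rightarrow> (nat \<times> bool) list) \<Rightarrow> (nat \<times> bool) list \<Rightarrow> (nat \<times> bool) list" where
  "gen_hom f = restrict (SOME h. h \<in> hom G G \<and> (\<forall>i<n. h (gen i) = f i)) (carrier G)"

lemma gen_hom:
  assumes "\<forall>i<n. f i \<in> carrier G"
  shows "gen_hom f \<in> hom G G" "\<And>i. i < n \<Longrightarrow> gen_hom f (gen i) = f i"
proof -
  have "\<exists>h. h \<in> hom G G \<and> (\<forall>i<n. h (gen i) = f i)"
    using free_group_extend[OF group_free_group, of f "{..<n}" "{..<n}"] assms by auto
  from someI_ex[OF this] have h: "(SOME h. h \<in> hom G G \<and> (\<forall>i<n. h (gen i) = f i)) \<in> hom G G"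
    "\<forall>i<n. (SOME h. h \<in> hom G G \<and> (\<forall>i<n. h (gen i) = f i)) (gen i) = f i" by blast+
  show "gen_hom f \<in> hom G G" unfolding gen_hom_def using h(1) by (auto simp: hom_def)
  show "gen_hom f (gen i) = f i" if "i < n" for i unfolding gen_hom_def using h(2) that by simp
qed

text \<open>Endomorphisms inverse to each other on the generators are inverse to each other.\<close>

lemma gen_hom_inverse_imp_Aut:
  assumes f: "\<forall>i<n. f i \<in> carrier G" and g: "\<forall>i<n. g i \<in> carrier G"
    and fg: "\<forall>i<n. gen_hom f (g i) = gen i" and gf: "\<forall>i<n. gen_hom g (f i) = gen i"
  shows "gen_hom f \<in> carrier Aut"
proof -
  have inverse: "gen_hom f (gen_hom g u) = u"
    if f: "\<forall>i<n. f i \<in> carrier G" and g: "\<forall>i<n. g i \<in> carrier G"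
      and fg: "\<forall>i<n. gen_hom f (g i) = gen i" and u: "u \<in> carrier G" for f g u
  proof -
    have "gen_hom f \<circ> gen_hom g \<in> hom G G"
      by (rule hom_compose[OF gen_hom(1)[OF g] gen_hom(1)[OF f]])
    moreover have "(\<lambda>x. x) \<in> hom G G" by (auto simp: hom_def)
    ultimately have "(gen_hom f \<circ> gen_hom g) u = (\<lambda>x. x) u"
      by (rule free_group_extend_unique[OF group_free_group]) (use fg gen_hom(2)[OF g] u in auto)
    then show ?thesis by simp
  qed
  have "bij_betw (gen_hom f) (carrier G) (carrier G)"
    by (rule bij_betw_byWitness[of _ "gen_hom g"])
      (use inverse[OF f g fg] inverse[OF g f gf] gen_hom(1)[OF f] gen_hom(1)[OF g] in \<open>auto simp: hom_def\<close>)
  then show ?thesis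
    using gen_hom(1)[OF f] by (auto simp: Aut_iff Bij_def gen_hom_def)
qed

text \<open>The map \<open>x\<^sub>i \<mapsto> u x\<^sub>i v\<close>. Allowing words on both sides makes the set of these maps, for fixed \<open>i\<close> and
  \<open>u\<close>, \<open>v\<close> not involving \<open>x\<^sub>i\<close>, a group, with the simple multiplication and conjugation rules \<open>transv_mult\<close> and
  \<open>transv_conj\<close>; all computations with Nielsen transformations reduce to them.\<close>

definition transv :: "nat \<Rightarrow> (nat \<times> bool) list \<Rightarrow> (nat \<times> bool) list \<Rightarrow>
    (nat \<times> bool) list \<Rightarrow> (nat \<times> bool) list" where
  "transv i u v = gen_hom (\<lambda>j. if j = i then u \<cdot> gen i \<cdot> v else gen j)"

lemma transv:
  assumes i: "i < n" and u: "u \<in> words (others i)" and v: "v \<in> words (others i)"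
  shows transv_in_Aut: "transv i u v \<in> carrier Aut"
    and transv_gen: "\<And>j. j < n \<Longrightarrow> transv i u v (gen j) = (if j = i then u \<cdot> gen i \<cdot> v else gen j)"
proof -
  have cl: "\<forall>j<n. (if j = i then u \<cdot> gen i \<cdot> v else gen j) \<in> carrier G"
    if "u \<in> words (others i)" "v \<in> words (others i)" for u v
    using that i words_others by auto
  show g: "transv i u v (gen j) = (if j = i then u \<cdot> gen i \<cdot> v else gen j)" if "j < n" for j
    unfolding transv_def by (rule gen_hom(2)[OF cl[OF u v] that])
  have inverse: "\<forall>j<n. gen_hom (\<lambda>j. if j = i then u \<cdot> gen i \<cdot> v else gen j)
      (if j = i then finv u \<cdot> gen i \<cdot> finv v else gen j) = gen j"
    if u: "u \<in> words (others i)" and v: "v \<in> words (others i)" for u v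
  proof (intro allI impI)
    fix j assume j: "j < n"
    let ?h = "gen_hom (\<lambda>j. if j = i then u \<cdot> gen i \<cdot> v else gen j)"
    have h: "?h \<in> hom G G" by (rule gen_hom(1)[OF cl[OF u v]])
    have hg: "?h (gen j) = (if j = i then u \<cdot> gen i \<cdot> v else gen j)" if "j < n" for j
      by (rule gen_hom(2)[OF cl[OF u v] that])
    have fixw: "?h w = w" if w: "w \<in> words (others i)" for w
    proof -
      have restr: "f \<in> hom (free_group (others i)) G" if "f \<in> hom G G" for f
        unfolding hom_def
      proof (intro CollectI conjI ballI)
        show "f \<in> words (others i) \<rightarrow> carrier G" using that words_others by (auto simp: hom_def)
        fix x y assume "x \<in> words (others i)" "y \<in> words (others i)"
        then have "f (x \<cdot> y) = f x \<cdot> f y" using that words_others by (simp add: hom_def)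
        then show "f (x \<otimes>\<^bsub>free_group (others i)\<^esub> y) = f x \<cdot> f y" by (simp add: free_group_def)
      qed
      have id: "(\<lambda>x. x) \<in> hom G G" by (auto simp: hom_def)
      have "?h w = (\<lambda>x. x) w"
        by (rule free_group_extend_unique[OF group_free_group restr[OF h] restr[OF id] _ w])
          (use hg in auto)
      then show ?thesis by simp
    qed
    have c: "u \<in> carrier G" "v \<in> carrier G" "gen i \<in> carrier G" using u v i words_others by auto
    have inv: "finv u \<in> words (others i)" "finv v \<in> words (others i)"
      using u v by (auto intro!: words_finv)
    show "?h (if j = i then finv u \<cdot> gen i \<cdot> finv v else gen j) = gen j"
    proof (cases "j = i")
      case True
      have "?h (finv u \<cdot> gen i \<cdot> finv v) = ?h (finv u) \<cdot> ?h (gen i) \<cdot> ?h (finv v)"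
        using h c by (simp add: hom_def)
      also have "\<dots> = finv u \<cdot> (u \<cdot> gen i \<cdot> v) \<cdot> finv v"
        using fixw inv hg[OF i] by simp
      also have "\<dots> = gen i" using c by (simp add: G.m_assoc finv_cancel)
      finally show ?thesis using True by simp
    qed (use hg[OF j] in simp)
  qed
  have inv: "finv u \<in> words (others i)" "finv v \<in> words (others i)"
    using u v by (auto intro!: words_finv)
  have "finv (finv u) = u" "finv (finv v) = v" using u v words_others by auto
  then show "transv i u v \<in> carrier Aut"
    unfolding transv_def
    by (intro gen_hom_inverse_imp_Aut[OF cl[OF u v] cl[OF inv] inverse[OF u v]])
      (use inverse[OF inv] in \<open>simp only:\<close>)
qed

lemma transv_fixes_words:
  assumes i: "i < n" and u: "u \<in> words (others i)" and v: "v \<in> words (others i)" and w: "w \<in> words (others i)"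
  shows "transv i u v w = w"
  by (rule Aut_fixes_words[OF transv_in_Aut[OF i u v] _ _ w]) (auto simp: transv_gen[OF i u v])

lemma transv_mult:
  assumes i: "i < n" and "u \<in> words (others i)" "v \<in> words (others i)"
    and "u' \<in> words (others i)" "v' \<in> words (others i)"
  shows "transv i u v \<star> transv i u' v' = transv i (u' \<cdot> u) (v \<cdot> v')"
proof (rule Aut_eqI)
  fix j assume j: "j < n"
  have c: "u \<in> carrier G" "v \<in> carrier G" "u' \<in> carrier G" "v' \<in> carrier G" "gen i \<in> carrier G"
    using assms words_others by auto
  have uu: "u' \<cdot> u \<in> words (others i)" "v \<cdot> v' \<in> words (others i)" using assms words_mult by auto
  have "(transv i u v \<star> transv i u' v') (gen j) = transv i u v (transv i u' v' (gen j))"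
    using assms j by (simp add: amult_apply transv_in_Aut)
  also have "\<dots> = transv i (u' \<cdot> u) (v \<cdot> v') (gen j)"
  proof (cases "j = i")
    case True
    have "transv i u v (u' \<cdot> gen i \<cdot> v') = u' \<cdot> (u \<cdot> gen i \<cdot> v) \<cdot> v'"
      using c assms by (simp add: Aut_mult transv_in_Aut transv_fixes_words transv_gen)
    then show ?thesis using True c uu assms by (simp add: transv_gen G.m_assoc)
  qed (use j assms uu in \<open>simp add: transv_gen\<close>)
  finally show "(transv i u v \<star> transv i u' v') (gen j) = transv i (u' \<cdot> u) (v \<cdot> v') (gen j)" .
qed (use assms words_mult in \<open>auto intro!: transv_in_Aut A.m_closed\<close>)

lemma transv_one: "i < n \<Longrightarrow> transv i [] [] = \<one>\<^bsub>Aut\<^esub>"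
  by (rule Aut_eqI) (auto simp: transv_in_Aut transv_gen aone_apply)

lemma transv_commute:
  assumes i: "i < n" "i' < n" "i \<noteq> i'" and J: "J \<subseteq> {..<n} - {i, i'}"
    and w: "u \<in> words J" "v \<in> words J" "u' \<in> words J" "v' \<in> words J"
  shows "transv i u v \<star> transv i' u' v' = transv i' u' v' \<star> transv i u v"
proof (rule Aut_eqI)
  have sub: "J \<subseteq> others i" "J \<subseteq> others i'" using J by auto
  have w1: "x \<in> words (others i)" "x \<in> words (others i')" "x \<in> carrier G" if "x \<in> words J" for x
    using words_mono[OF sub(1)] words_mono[OF sub(2)] words_others that by blast+
  note W = w1[OF w(1)] w1[OF w(2)] w1[OF w(3)] w1[OF w(4)]
  show "transv i u v \<star> transv i' u' v' \<in> carrier Aut" "transv i' u' v' \<star> transv i u v \<in> carrier Aut"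
    using i W by (auto intro!: transv_in_Aut A.m_closed)
  fix j assume "j < n"
  then show "(transv i u v \<star> transv i' u' v') (gen j) = (transv i' u' v' \<star> transv i u v) (gen j)"
    using i W by (auto simp: amult_apply transv_in_Aut transv_gen Aut_mult transv_fixes_words)
qed

text \<open>The rule is stated without an inverse of \<open>b\<close>. It holds because \<open>b\<close> respects the splitting of the
  generators into one generator and the others.\<close>

lemma transv_conj:
  assumes b: "b \<in> carrier Aut" and i: "i < n" "i' < n" and bi: "b (gen i) = gen i'"
    and bo: "\<And>j. j < n \<Longrightarrow> j \<noteq> i \<Longrightarrow> b (gen j) \<in> words (others i')"
    and u: "u \<in> words (others i)" and v: "v \<in> words (others i)"
  shows "b \<star> transv i u v = transv i' (b u) (b v) \<star> b"
proof (rule Aut_eqI)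
  have bw: "b w \<in> words (others i')" if "w \<in> words (others i)" for w
    by (rule Aut_words[OF b _ _ _ that]) (use bo in auto)
  note W = u v bw[OF u] bw[OF v] words_others[OF u] words_others[OF v]
  show "b \<star> transv i u v \<in> carrier Aut" "transv i' (b u) (b v) \<star> b \<in> carrier Aut"
    using i W b by (auto intro!: transv_in_Aut A.m_closed)
  fix j assume j: "j < n"
  show "(b \<star> transv i u v) (gen j) = (transv i' (b u) (b v) \<star> b) (gen j)"
  proof (cases "j = i")
    case True
    then show ?thesis
      using i W b by (simp add: amult_apply transv_in_Aut transv_gen Aut_mult bi)
  next
    case False
    then show ?thesis
      using i W b j transv_fixes_words[OF i(2) W(3,4) bo[OF j]] by (simp add: amult_apply transv_in_Aut transv_gen)
  qed
qed

lemma transv_conj_invert: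
  assumes b: "b \<in> carrier Aut" and i: "i < n" "i' < n" and bi: "b (gen i) = [(i', False)]"
    and bo: "\<And>j. j < n \<Longrightarrow> j \<noteq> i \<Longrightarrow> b (gen j) \<in> words (others i')"
    and u: "u \<in> words (others i)" and v: "v \<in> words (others i)"
  shows "b \<star> transv i u v = transv i' (finv (b v)) (finv (b u)) \<star> b"
proof (rule Aut_eqI)
  have bw: "b w \<in> words (others i')" if "w \<in> words (others i)" for w
    by (rule Aut_words[OF b _ _ _ that]) (use bo in auto)
  have iv: "finv (b w) \<in> words (others i')" if "w \<in> words (others i)" for w
    by (rule words_finv[OF _ bw[OF that]]) auto
  have bi': "b (gen i) = finv (gen i')" using i bi by (simp add: finv_letter inv_letter_def)
  note W = u v iv[OF u] iv[OF v] words_others[OF u] words_others[OF v] words_others[OF bw[OF u]] words_others[OF bw[OF v]]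
  show "b \<star> transv i u v \<in> carrier Aut" "transv i' (finv (b v)) (finv (b u)) \<star> b \<in> carrier Aut"
    using i W b by (auto intro!: transv_in_Aut A.m_closed)
  fix j assume j: "j < n"
  show "(b \<star> transv i u v) (gen j) = (transv i' (finv (b v)) (finv (b u)) \<star> b) (gen j)"
  proof (cases "j = i")
    case True
    have "(transv i' (finv (b v)) (finv (b u)) \<star> b) (gen i) = finv (finv (b v) \<cdot> gen i' \<cdot> finv (b u))"
      using i W b by (simp add: amult_apply transv_in_Aut bi' Aut_finv transv_gen)
    also have "\<dots> = b u \<cdot> finv (gen i') \<cdot> b v"
      using i W by (simp add: G.inv_mult_group G.m_assoc)
    finally show ?thesis
      using True i W b by (simp add: amult_apply transv_in_Aut transv_gen Aut_mult bi')
  next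
    case False
    then show ?thesis
      using i W b j transv_fixes_words[OF i(2) W(4,3) bo[OF j]] by (simp add: amult_apply transv_in_Aut transv_gen)
  qed
qed

text \<open>Words are multiplied on letter by letter: left multiplications compose in reversed order, right
  multiplications in the given order, and the two sides commute.\<close>

lemma transv_words_in_subgroup:
  assumes H: "subgroup H Aut" and i: "i < n" and J: "J \<subseteq> others i"
    and gens: "\<And>j. j \<in> J \<Longrightarrow> transv i (gen j) [] \<in> H" "\<And>j. j \<in> J \<Longrightarrow> transv i [] (gen j) \<in> H"
    and u: "u \<in> words J" and v: "v \<in> words J"
  shows "transv i u v \<in> H"
proof -
  have JW: "w \<in> words (others i)" "w \<in> carrier G" if "w \<in> words J" for w
    using words_mono[OF J] words_others that by blast+
  have letter_inv: "inv\<^bsub>Aut\<^esub> transv i (gen j) [] = transv i [(j, False)] []"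
      "inv\<^bsub>Aut\<^esub> transv i [] (gen j) = transv i [] [(j, False)]" if j: "j \<in> J" for j
  proof -
    have w: "gen j \<in> words (others i)" "[(j, False)] \<in> words (others i)" using j J by auto
    have "[(j, False)] \<cdot> gen j = []" "gen j \<cdot> [(j, False)] = []"
      by (simp_all add: fmult_eq inv_letter_def)
    then have "transv i [(j, False)] [] \<star> transv i (gen j) [] = \<one>\<^bsub>Aut\<^esub>"
      "transv i [] [(j, False)] \<star> transv i [] (gen j) = \<one>\<^bsub>Aut\<^esub>"
      using i w by (simp_all add: transv_mult transv_one)
    then show "inv\<^bsub>Aut\<^esub> transv i (gen j) [] = transv i [(j, False)] []"
      "inv\<^bsub>Aut\<^esub> transv i [] (gen j) = transv i [] [(j, False)]"
      using i w by (auto intro!: A.inv_equality transv_in_Aut)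
  qed
  have letters: "transv i [k] [] \<in> H" "transv i [] [k] \<in> H" if k: "fst k \<in> J" for k
    using gens[OF k] letter_inv[OF k] subgroup.m_inv_closed[OF H] k by (cases k; cases "snd k"; metis fst_conv snd_conv)+
  have "transv i u [] \<in> H" using u
  proof (induction u)
    case Nil
    then show ?case using subgroup.one_closed[OF H] i by (simp add: transv_one)
  next
    case (Cons k w)
    have k: "fst k \<in> J" "w \<in> words J" using Cons_in_words[OF Cons.prems] by auto
    have "transv i w [] \<star> transv i [k] [] = transv i ([k] \<cdot> w) ([] \<cdot> [])"
      using i JW[OF k(2)] JW[of "[k]"] k by (intro transv_mult) auto
    then have "transv i (k # w) [] = transv i w [] \<star> transv i [k] []"
      using Cons_eq_fmult[OF Cons.prems] by (simp add: fmult_eq)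
    then show ?case using Cons.IH[OF k(2)] letters(1)[OF k(1)] subgroup.m_closed[OF H] by simp
  qed
  moreover have "transv i [] v \<in> H" using v
  proof (induction v)
    case Nil
    then show ?case using subgroup.one_closed[OF H] i by (simp add: transv_one)
  next
    case (Cons k w)
    have k: "fst k \<in> J" "w \<in> words J" using Cons_in_words[OF Cons.prems] by auto
    have "transv i [] [k] \<star> transv i [] w = transv i ([] \<cdot> []) ([k] \<cdot> w)"
      using i JW[OF k(2)] JW[of "[k]"] k by (intro transv_mult) auto
    then have "transv i [] (k # w) = transv i [] [k] \<star> transv i [] w"
      using Cons_eq_fmult[OF Cons.prems] by (simp add: fmult_eq)
    then show ?case using Cons.IH[OF k(2)] letters(2)[OF k(1)] subgroup.m_closed[OF H] by simp
  qed
  moreover have "transv i [] v \<star> transv i u [] = transv i u v"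
    using i JW[OF u] JW[OF v] by (simp add: transv_mult)
  ultimately show ?thesis using subgroup.m_closed[OF H] by metis
qed

end

context free_group_automorphisms
begin

section \<open>Nielsen reduction\<close>

definition signed_perms :: "((nat \<times> bool) list \<Rightarrow> (nat \<times> bool) list) set" where
  "signed_perms = {a \<in> carrier Aut. \<forall>i<n. \<exists>k. fst k < n \<and> a (gen i) = [k]}"

definition letters :: "(nat \<times> bool) set" where
  "letters = {..<n} \<times> UNIV"

lemma letters_iff: "k \<in> letters \<longleftrightarrow> fst k < n"
  by (cases k) (auto simp: letters_def)

lemma inv_letter_letters [simp]: "inv_letter k \<in> letters \<longleftrightarrow> k \<in> letters"
  by (simp add: letters_iff)

lemma Aut_inv_letter: "a \<in> carrier Aut \<Longrightarrow> k \<in> letters \<Longrightarrow> a [inv_letter k] = winv (a [k])"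
  using Aut_finv[of a "[k]"] by (simp add: letters_iff finv_letter finv_eq Aut_closed)

definition total_length :: "((nat \<times> bool) list \<Rightarrow> (nat \<times> bool) list) \<Rightarrow> nat" where
  "total_length a = (\<Sum>i<n. length (a (gen i)))"

definition total_number :: "((nat \<times> bool) list \<Rightarrow> (nat \<times> bool) list) \<Rightarrow> nat" where
  "total_number a = (\<Sum>i<n. halves_number n (a (gen i)))"

text \<open>No multiplication of the image of one letter by the image of another one makes it shorter, or leaves its
  length unchanged while decreasing the tie-breaker. Letters \<open>y\<close> of both signs occur, so this covers
  multiplications on both sides.\<close>

definition Nielsen_reduced :: "((nat \<times> bool) list \<Rightarrow> (nat \<times> bool) list) \<Rightarrow> bool" where
  "Nielsen_reduced a \<longleftrightarrow> (\<forall>y\<in>letters. \<forall>z\<in>letters. fst y \<noteq> fst z \<longrightarrow>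
     length (a [y]) \<le> length (a [z] \<cdot> a [y]) \<and>
     (length (a [z] \<cdot> a [y]) = length (a [y]) \<longrightarrow>
        halves_number n (a [y]) \<le> halves_number n (a [z] \<cdot> a [y])))"

lemma sum_fun_change_one:
  fixes f g :: "nat \<Rightarrow> nat"
  assumes "i < n" "\<And>j. j < n \<Longrightarrow> j \<noteq> i \<Longrightarrow> f j = g j"
  shows "(\<Sum>j<n. f j) + g i = (\<Sum>j<n. g j) + f i"
proof -
  have "(\<Sum>j<n. f j) = f i + (\<Sum>j\<in>{..<n} - {i}. f j)" "(\<Sum>j<n. g j) = g i + (\<Sum>j\<in>{..<n} - {i}. g j)"
    using assms(1) by (simp_all add: sum.remove)
  moreover have "(\<Sum>j\<in>{..<n} - {i}. f j) = (\<Sum>j\<in>{..<n} - {i}. g j)"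
    using assms(2) by (intro sum.cong) auto
  ultimately show ?thesis by simp
qed

text \<open>Composing with a transvection on the right replaces the image of \<open>x\<^sub>i\<close> by its product with the image of
  another letter; the transvection acts on the right side if the letter to be changed is an inverse generator.\<close>

lemma not_Nielsen_reduced_step:
  assumes a: "a \<in> carrier Aut" and not_red: "\<not> Nielsen_reduced a"
  obtains i u v where "i < n" "u \<in> words (others i)" "v \<in> words (others i)"
    "total_length (a \<star> transv i u v) < total_length a \<or>
     (total_length (a \<star> transv i u v) = total_length a \<and> total_number (a \<star> transv i u v) < total_number a)"
proof -
  obtain y z where yz: "y \<in> letters" "z \<in> letters" "fst y \<noteq> fst z"
    and bad: "length (a [z] \<cdot> a [y]) < length (a [y]) \<or>
      (length (a [z] \<cdot> a [y]) = length (a [y]) \<and> halves_number n (a [z] \<cdot> a [y]) < halves_number n (a [y]))"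
    using not_red unfolding Nielsen_reduced_def by (metis linorder_not_le)
  define i where "i = fst y"
  define u v where "u = (if snd y then [z] else [])" and "v = (if snd y then [] else [inv_letter z])"
  have i: "i < n" using yz by (simp add: i_def letters_iff)
  have uv: "u \<in> words (others i)" "v \<in> words (others i)"
    using yz by (auto simp: u_def v_def i_def letters_iff)
  have c: "[z] \<in> carrier G" "[y] \<in> carrier G" "gen i \<in> carrier G" using yz i by (auto simp: letters_iff)
  let ?b = "a \<star> transv i u v"
  have b: "?b (gen j) = a (transv i u v (gen j))" if "j < n" for j
    using a i uv that by (simp add: amult_apply transv_in_Aut)
  have other: "?b (gen j) = a (gen j)" if "j < n" "j \<noteq> i" for j
    using b[OF that(1)] that i uv by (simp add: transv_gen)
  have new: "?b (gen i) = a [z] \<cdot> a [y] \<and> a (gen i) = a [y] \<or>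
             ?b (gen i) = winv (a [z] \<cdot> a [y]) \<and> a (gen i) = winv (a [y])"
  proof (cases "snd y")
    case True
    then have "y = (i, True)" by (simp add: i_def prod_eq_iff)
    then show ?thesis using True b[OF i] i uv a c by (simp add: transv_gen u_def v_def Aut_mult)
  next
    case False
    then have y: "inv_letter y = (i, True)" by (simp add: i_def prod_eq_iff inv_letter_def)
    have "?b (gen i) = a (gen i \<cdot> [inv_letter z])"
      using False b[OF i] i uv by (simp add: transv_gen u_def v_def)
    also have "\<dots> = a [inv_letter y] \<cdot> a [inv_letter z]" using a c yz y by (simp add: Aut_mult letters_iff)
    also have "\<dots> = finv (a [y]) \<cdot> finv (a [z])"
      using a yz c by (simp add: Aut_inv_letter finv_eq Aut_closed)
    also have "\<dots> = finv (a [z] \<cdot> a [y])" using a c by (simp add: G.inv_mult_group Aut_closed)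
    also have "\<dots> = winv (a [z] \<cdot> a [y])" using a c by (simp add: finv_eq Aut_closed)
    finally show ?thesis using Aut_inv_letter[OF a yz(1)] y by simp
  qed
  then have len: "length (?b (gen i)) = length (a [z] \<cdot> a [y])" "length (a (gen i)) = length (a [y])"
    and num: "halves_number n (?b (gen i)) = halves_number n (a [z] \<cdot> a [y])"
      "halves_number n (a (gen i)) = halves_number n (a [y])"
    by (auto simp: halves_number_winv)
  have "total_length ?b + length (a (gen i)) = total_length a + length (?b (gen i))"
    unfolding total_length_def by (rule sum_fun_change_one[OF i]) (simp add: other)
  moreover have "total_number ?b + halves_number n (a (gen i)) = total_number a + halves_number n (?b (gen i))"
    unfolding total_number_def by (rule sum_fun_change_one[OF i]) (simp add: other)
  ultimately show ?thesis using that[OF i uv] bad len num by auto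
qed

context
  fixes a
  assumes a: "a \<in> carrier Aut" and red: "Nielsen_reduced a" and n: "n \<ge> 1"
begin

lemma a_word: "k \<in> letters \<Longrightarrow> reduced (a [k]) \<and> set (a [k]) \<subseteq> {..<n} \<times> UNIV \<and> a [k] \<noteq> []"
proof -
  assume k: "k \<in> letters"
  then have "a [k] \<in> carrier G" using Aut_closed[OF a] by (simp add: letters_iff)
  moreover have "a [k] \<noteq> a []" using Aut_inj[OF a, of "[k]" "[]"] k by (simp add: letters_iff)
  ultimately show ?thesis by (simp add: words_iff Aut_Nil[OF a])
qed

lemma product_length:
  assumes y: "y \<in> letters" and z: "z \<in> letters" and zy: "z \<noteq> inv_letter y"
  shows "length (a [y]) \<le> length (a [y] \<cdot> a [z])" "length (a [z]) \<le> length (a [y] \<cdot> a [z])"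
proof -
  have "length (a [y]) \<le> length (a [y] \<cdot> a [z]) \<and> length (a [z]) \<le> length (a [y] \<cdot> a [z])"
  proof (cases "fst y = fst z")
    case True
    then have "z = y" using zy by (auto simp: inv_letter_def prod_eq_iff)
    then show ?thesis using length_square_ge[of "a [y]"] a_word[OF y] by (simp add: fmult_eq)
  next
    case False
    have c: "a [y] \<in> carrier G" "a [z] \<in> carrier G" using y z a by (auto simp: letters_iff Aut_closed)
    have "length (a [inv_letter y]) \<le> length (a [inv_letter z] \<cdot> a [inv_letter y])"
      using red y z False by (auto simp: Nielsen_reduced_def)
    also have "a [inv_letter z] \<cdot> a [inv_letter y] = finv (a [z]) \<cdot> finv (a [y])"
      using y z c by (simp add: Aut_inv_letter[OF a] finv_eq)
    also have "\<dots> = finv (a [y] \<cdot> a [z])" using c by (simp add: G.inv_mult_group)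
    also have "\<dots> = winv (a [y] \<cdot> a [z])" using c by (simp add: finv_eq)
    finally have "length (a [y]) \<le> length (a [y] \<cdot> a [z])" by (simp add: Aut_inv_letter[OF a y])
    moreover have "length (a [z]) \<le> length (a [y] \<cdot> a [z])"
      using red y z False by (auto simp: Nielsen_reduced_def)
    ultimately show ?thesis by simp
  qed
  then show "length (a [y]) \<le> length (a [y] \<cdot> a [z])" "length (a [z]) \<le> length (a [y] \<cdot> a [z])" by auto
qed

lemma product_cancellation:
  assumes y: "y \<in> letters" and z: "z \<in> letters" and zy: "z \<noteq> inv_letter y"
  obtains b p c where "a [y] = b @ winv p" "a [z] = p @ c" "a [y] \<cdot> a [z] = b @ c" "reduced (b @ c)"
    "2 * length p \<le> length (a [y])" "2 * length p \<le> length (a [z])"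
proof -
  obtain b p c where bpc: "a [y] = b @ winv p" "a [z] = p @ c" "a [y] \<cdot> a [z] = b @ c" "reduced (b @ c)"
    using mult_cancellation[of "a [y]" "a [z]"] a_word[OF y] a_word[OF z] by (auto simp: fmult_eq)
  then show ?thesis using that[OF bpc] product_length[OF y z zy] by simp
qed

text \<open>By \<open>product_length\<close> at most half of \<open>a [y]\<close> cancels on either side. If it cancelled entirely, its two
  halves would be \<open>p\<close> and the inverse of \<open>q\<close> with \<open>p \<noteq> q\<close>. Then one of the two multiplications by \<open>a [y]\<close> would
  exchange an initial segment \<open>p\<close> for \<open>q\<close>, or \<open>q\<close> for \<open>p\<close>, in a neighbouring factor; this preserves length, and
  in one of the two directions it decreases the tie-breaker.\<close>

lemma middle_survives:
  assumes x: "x \<in> letters" and y: "y \<in> letters" and z: "z \<in> letters"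
    and yx: "y \<noteq> inv_letter x" and zy: "z \<noteq> inv_letter y"
    and xy: "a [x] = b @ winv p" "a [y] = p @ b'" and yz: "a [y] = c' @ winv q" "a [z] = q @ c"
    and prod: "a [x] \<cdot> a [y] = b @ b'" "a [y] \<cdot> a [z] = c' @ c"
  shows "length p + length q < length (a [y])"
proof (rule ccontr)
  assume not_less: "\<not> ?thesis"
  have "2 * length p \<le> length (a [x])" "2 * length p \<le> length (a [y])"
    using product_length[OF x y yx] xy(1,2) prod(1) by simp_all
  moreover have "2 * length q \<le> length (a [y])" "2 * length q \<le> length (a [z])"
    using product_length[OF y z zy] yz prod(2) by simp_all
  ultimately have len: "2 * length p = length (a [y])" "2 * length q = length (a [y])"
      "2 * length p \<le> length (a [x])" "2 * length q \<le> length (a [z])"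
    using not_less by auto
  have pq: "length p = length q" using len by simp
  have "p @ b' = c' @ winv q" using xy(2) yz(1) by simp
  moreover have "length p = length c'" using len(2) arg_cong[OF yz(1), of length] pq by simp
  ultimately have c': "c' = p" "b' = winv q" by auto
  have p_neq_q: "p \<noteq> q"
  proof
    assume "p = q"
    then have "a [y] = p @ winv p" using yz(1) c' by simp
    then have "hd (winv p) = inv_letter (last p)" "p \<noteq> []"
      using a_word[OF y] by (cases p rule: rev_cases; auto)+
    then show False using a_word[OF y] \<open>a [y] = p @ winv p\<close> by (auto simp: reduced_append)
  qed
  have xny: "fst x \<noteq> fst y"
  proof
    assume "fst x = fst y"
    then have "x = y" using yx by (auto simp: inv_letter_def prod_eq_iff)
    then have "b @ winv p = p @ winv q" using xy(1) yz(1) c' by simp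
    then have "winv p = winv q" using pq by simp
    then show False using p_neq_q by (metis winv_winv)
  qed
  have zny: "fst z \<noteq> fst y"
  proof
    assume "fst z = fst y"
    then have "z = y" using zy by (auto simp: inv_letter_def prod_eq_iff)
    then have "q @ c = p @ winv q" using yz c' by simp
    then show False using pq p_neq_q by simp
  qed
  have p: "\<forall>k\<in>set p. fst k < n" and q: "\<forall>k\<in>set q. fst k < n"
    using a_word[OF y] yz(1) c' a_word[OF z] yz(2) by auto
  consider "word_number (2 * n) p < word_number (2 * n) q" | "word_number (2 * n) q < word_number (2 * n) p"
    using word_number_inject[OF pq p q] p_neq_q by linarith
  then show False
  proof cases
    case 1
    have "a [y] \<cdot> a [z] = p @ c" using prod(2) c' by simp
    moreover have "halves_number n (p @ c) < halves_number n (q @ c)"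
      by (rule halves_number_less[OF pq 1 _ n]) (use len yz(2) in simp)
    ultimately show False
      using red y z zny yz(2) pq unfolding Nielsen_reduced_def by fastforce
  next
    case 2
    let ?x = "inv_letter x" and ?y = "inv_letter y"
    have c: "a [x] \<in> carrier G" "a [y] \<in> carrier G" using x y a by (auto simp: letters_iff Aut_closed)
    have "a [?y] \<cdot> a [?x] = finv (a [y]) \<cdot> finv (a [x])"
      using x y c by (simp add: Aut_inv_letter[OF a] finv_eq)
    also have "\<dots> = finv (a [x] \<cdot> a [y])" using c by (simp add: G.inv_mult_group)
    also have "\<dots> = winv (a [x] \<cdot> a [y])" using c by (simp add: finv_eq)
    also have "\<dots> = q @ winv b" using prod(1) c' by simp
    finally have "a [?y] \<cdot> a [?x] = q @ winv b" .
    moreover have "a [?x] = p @ winv b" using Aut_inv_letter[OF a x] xy(1) by simp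
    moreover have "halves_number n (q @ winv b) < halves_number n (p @ winv b)"
      by (rule halves_number_less[OF pq[symmetric] 2 _ n]) (use len xy(1) in simp)
    moreover have "?x \<in> letters" "?y \<in> letters" "fst ?x \<noteq> fst ?y" using x y xny by auto
    ultimately show False using red pq unfolding Nielsen_reduced_def by fastforce
  qed
qed

text \<open>Every letter leaves at least one surviving letter in the image of a reduced word. For the induction one has
  to know how much of the image of the first letter survives: exactly what is left by the cancellation with
  the image of the second letter.\<close>

lemma reduced_product_shape:
  assumes "reduced (y # ys)" "set (y # ys) \<subseteq> letters"
  shows "\<exists>t v. a (y # ys) = t @ v \<and> reduced (t @ v) \<and> length ys \<le> length v \<and> t \<noteq> [] \<and>
     (if ys = [] then t = a [y]
      else \<exists>p c. a [y] = t @ winv p \<and> a [hd ys] = p @ c \<and> a [y] \<cdot> a [hd ys] = t @ c)"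
  using assms
proof (induction ys arbitrary: y)
  case Nil
  then show ?case using a_word[of y] by (intro exI[of _ "a [y]"] exI[of _ "[]"]) simp
next
  case (Cons z zs)
  have y: "y \<in> letters" and z: "z \<in> letters" and zy: "z \<noteq> inv_letter y" and zzs: "reduced (z # zs)"
    using Cons.prems by (auto simp: reduced_def)
  obtain t v where tv: "a (z # zs) = t @ v" "reduced (t @ v)" "length zs \<le> length v" "t \<noteq> []"
    and t: "if zs = [] then t = a [z]
      else \<exists>p c. a [z] = t @ winv p \<and> a [hd zs] = p @ c \<and> a [z] \<cdot> a [hd zs] = t @ c"
    using Cons.IH[OF zzs] Cons.prems(2) by auto
  obtain b p c where bpc: "a [y] = b @ winv p" "a [z] = p @ c" "a [y] \<cdot> a [z] = b @ c" "reduced (b @ c)"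
      "2 * length p \<le> length (a [y])" "2 * length p \<le> length (a [z])"
    using product_cancellation[OF y z zy] by blast
  have "length p < length t \<and> (\<exists>s. a [z] = t @ s)"
  proof (cases "zs = []")
    case True
    then show ?thesis using t bpc(6) tv(4) by (cases p) auto
  next
    case False
    then obtain z' zs' where zs: "zs = z' # zs'" by (cases zs) auto
    then obtain q c' where q: "a [z] = t @ winv q" "a [z'] = q @ c'" "a [z] \<cdot> a [z'] = t @ c'"
      using t by auto
    have z': "z' \<in> letters" "z' \<noteq> inv_letter z" using Cons.prems zs by (auto simp: reduced_def)
    have "length p + length q < length (a [z])"
      by (rule middle_survives[OF y z z'(1) zy z'(2) bpc(1,2) q(1,2) bpc(3) q(3)])
    then show ?thesis using q(1) by simp
  qed
  then obtain s where s: "a [z] = t @ s" "length p < length t" by blast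
  then have "take (length p) (p @ c) = take (length p) (t @ s)" using bpc(2) by simp
  then have p_take: "p = take (length p) t" using s(2) by simp
  define t' where "t' = drop (length p) t"
  have t': "t = p @ t'" "t' \<noteq> []" using p_take s(2) by (metis append_take_drop_id t'_def) (use s(2) in \<open>simp add: t'_def\<close>)
  have c: "c = t' @ s" using bpc(2) s(1) t'(1) by simp
  have ptv: "reduced (p @ t' @ v)" using tv(2) t'(1) by simp
  then have t'v: "reduced (t' @ v)" by (simp add: reduced_append)
  have btv: "reduced (b @ t' @ v)"
    using bpc(4) c t'(2) t'v reduced_append[of b c] reduced_append[of b "t' @ v"] by auto
  have "y # z # zs \<in> carrier G" using Cons.prems by (auto simp: words_iff letters_def)
  then have "a (y # z # zs) = a [y] \<cdot> a (z # zs)" by (rule Aut_Cons[OF a])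
  also have "\<dots> = foldr push_letter (b @ winv p) (p @ t' @ v)" using bpc(1) tv(1) t'(1) by (simp add: fmult_eq)
  also have "\<dots> = foldr push_letter b (t' @ v)" by (rule mult_cancel_middle[OF ptv t'v])
  also have "\<dots> = b @ t' @ v" by (rule mult_reduced_append[OF btv])
  finally have "a (y # z # zs) = b @ t' @ v" .
  moreover have "b \<noteq> []" using bpc(1,5) a_word[OF y] by auto
  moreover have "length (z # zs) \<le> length (t' @ v)" using tv(3) t'(2) by (cases t') auto
  ultimately show ?case
    using btv bpc by (intro exI[of _ b] exI[of _ "t' @ v"]) auto
qed

text \<open>A generator is the image of some reduced word, which must have length one, since images are at least as
  long as the words. So every generator is, up to sign, the image of a generator, and finiteness turns this
  surjection into a permutation.\<close>

lemma Nielsen_reduced_imp_signed_perm: "a \<in> signed_perms"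
proof -
  have hit: "\<exists>i<n. \<exists>k. fst k = j \<and> a (gen i) = [k]" if j: "j < n" for j
  proof -
    obtain w where w: "w \<in> carrier G" "a w = gen j" using Aut_surj[OF a, of "gen j"] j by auto
    then have "w \<noteq> []" using Aut_Nil[OF a] by auto
    then obtain y ys where yys: "w = y # ys" by (cases w) auto
    obtain t v where tv: "gen j = t @ v" "length ys \<le> length v" "t \<noteq> []"
      using reduced_product_shape[of y ys] w yys by (auto simp: words_iff letters_def)
    then have "length t + length v = 1" by (metis length_append One_nat_def list.size(3,4) add.commute plus_1_eq_Suc)
    then have "ys = []" using tv by (cases t) auto
    then have ay: "a [y] = gen j" "fst y < n" using w yys by (auto simp: words_iff)
    then have "a (gen (fst y)) = [(j, snd y)]"
      using Aut_inv_letter[OF a, of y] by (cases y; cases "snd y") (auto simp: letters_iff inv_letter_def)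
    then show ?thesis using ay(2) by auto
  qed
  then have "\<forall>j. \<exists>i. j < n \<longrightarrow> i < n \<and> (\<exists>k. fst k = j \<and> a (gen i) = [k])" by blast
  then obtain f where f: "\<And>j. j < n \<Longrightarrow> f j < n \<and> (\<exists>k. fst k = j \<and> a (gen (f j)) = [k])"
    unfolding choice_iff by blast
  have "inj_on f {..<n}"
  proof (rule inj_onI)
    fix i j assume ij: "i \<in> {..<n}" "j \<in> {..<n}" "f i = f j"
    obtain k where "fst k = i" "a (gen (f i)) = [k]" using f[of i] ij by auto
    moreover obtain l where "fst l = j" "a (gen (f j)) = [l]" using f[of j] ij by auto
    ultimately show "i = j" using ij(3) by simp
  qed
  then have surj: "f ` {..<n} = {..<n}" using f by (intro endo_inj_surj) auto
  have "\<exists>k. fst k < n \<and> a (gen i) = [k]" if "i < n" for i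
  proof -
    obtain j where j: "j < n" "i = f j" using surj \<open>i < n\<close> by (metis imageE lessThan_iff)
    then show ?thesis using f[OF j(1)] by auto
  qed
  then show ?thesis using a by (auto simp: signed_perms_def)
qed

end

text \<open>Nielsen's theorem: composing with transvections decreases the measure until the automorphism is Nielsen
  reduced, hence a signed permutation.\<close>

theorem Nielsen_generation:
  assumes H: "subgroup H Aut" and perms: "signed_perms \<subseteq> H"
    and gens: "\<And>i j. i < n \<Longrightarrow> j < n \<Longrightarrow> i \<noteq> j \<Longrightarrow> transv i (gen j) [] \<in> H \<and> transv i [] (gen j) \<in> H"
    and n: "n \<ge> 1"
  shows "H = carrier Aut"
proof
  show "H \<subseteq> carrier Aut" using H by (rule subgroup.subset)
  have "a \<in> H" if "a \<in> carrier Aut" for a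
    using that
  proof (induction "(total_length a, total_number a)" arbitrary: a
      rule: wf_induct_rule[OF wf_lex_prod[OF wf_less_than wf_less_than]])
    case 1
    show ?case
    proof (cases "Nielsen_reduced a")
      case True
      then show ?thesis using Nielsen_reduced_imp_signed_perm[OF 1(2) _ n] perms by blast
    next
      case False
      obtain i u v where iuv: "i < n" "u \<in> words (others i)" "v \<in> words (others i)"
        and less: "total_length (a \<star> transv i u v) < total_length a \<or>
          (total_length (a \<star> transv i u v) = total_length a \<and> total_number (a \<star> transv i u v) < total_number a)"
        using not_Nielsen_reduced_step[OF 1(2) False] by auto
      have t: "transv i u v \<in> H" "transv i u v \<in> carrier Aut"
        using transv_words_in_subgroup[OF H iuv(1) subset_refl _ _ iuv(2,3)] gens[OF iuv(1)] transv_in_Aut[OF iuv]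
        by auto
      have "a \<star> transv i u v \<in> H" by (rule 1(1)) (use less 1(2) t in auto)
      then have "a \<star> transv i u v \<star> inv\<^bsub>Aut\<^esub> transv i u v \<in> H"
        using t(1) subgroup.m_closed[OF H] subgroup.m_inv_closed[OF H] by blast
      then show ?thesis using 1(2) t(2) by (simp add: A.m_assoc)
    qed
  qed
  then show "carrier Aut \<subseteq> H" by blast
qed

end

context free_group_automorphisms
begin

section \<open>Signed permutations and involutions\<close>

lemma hom_letter:
  assumes "h \<in> hom G G" "i < n"
  shows "h [(i, c)] = (if c then h (gen i) else finv (h (gen i)))"
proof (cases c)
  case False
  interpret h: group_hom G G h using assms(1) by (simp add: group_hom_def group_hom_axioms_def)
  have "[(i, False)] = finv (gen i)" using assms(2) by (simp add: finv_letter inv_letter_def)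
  then show ?thesis using False h.hom_inv[of "gen i"] assms(2) by simp
qed simp

text \<open>The map \<open>x\<^sub>i \<mapsto> x\<^bsub>\<pi> i\<^esub>\<close> or its inverse, the latter if \<open>s i\<close> is false.\<close>

definition sperm :: "(nat \<Rightarrow> nat) \<Rightarrow> (nat \<Rightarrow> bool) \<Rightarrow> (nat \<times> bool) list \<Rightarrow> (nat \<times> bool) list" where
  "sperm \<pi> s = gen_hom (\<lambda>i. [(\<pi> i, s i)])"

lemma sperm:
  assumes \<pi>: "\<pi> permutes {..<n}"
  shows sperm_in_Aut: "sperm \<pi> s \<in> carrier Aut"
    and sperm_letter: "\<And>i c. i < n \<Longrightarrow> sperm \<pi> s [(i, c)] = [(\<pi> i, c = s i)]"
    and sperm_in_signed_perms: "sperm \<pi> s \<in> signed_perms"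
proof -
  have letter: "gen_hom (\<lambda>i. [(\<pi> i, s i)]) [(i, c)] = [(\<pi> i, c = s i)]"
    if \<pi>: "\<pi> permutes {..<n}" and i: "i < n" for \<pi> s i c
  proof -
    have cl: "\<forall>i<n. [(\<pi> i, s i)] \<in> carrier G" using permutes_in_image[OF \<pi>] by auto
    then have "finv [(\<pi> i, s i)] = [(\<pi> i, \<not> s i)]"
      using i by (auto simp: finv_letter inv_letter_def)
    then show ?thesis using hom_letter[OF gen_hom(1)[OF cl] i, of c] gen_hom(2)[OF cl i] by (cases c; cases "s i") auto
  qed
  show l: "sperm \<pi> s [(i, c)] = [(\<pi> i, c = s i)]" if "i < n" for i c
    unfolding sperm_def by (rule letter[OF \<pi> that])
  let ?\<rho> = "Hilbert_Choice.inv \<pi>"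
  have \<rho>: "?\<rho> permutes {..<n}" by (rule permutes_inv[OF \<pi>])
  have lt: "\<pi> i < n" "?\<rho> i < n" if "i < n" for i
    using permutes_in_image[OF \<pi>, of i] permutes_in_image[OF \<rho>, of i] that by auto
  show A: "sperm \<pi> s \<in> carrier Aut"
    unfolding sperm_def
    by (rule gen_hom_inverse_imp_Aut[where g="\<lambda>i. [(?\<rho> i, s (?\<rho> i))]"])
      (use lt letter[OF \<pi>] letter[OF \<rho>, where s="\<lambda>i. s (?\<rho> i)"] permutes_inverses[OF \<pi>] in auto)
  show "sperm \<pi> s \<in> signed_perms" unfolding signed_perms_def using A l lt by auto
qed

lemma transv_inv:
  assumes "i < n" "u \<in> words (others i)" "v \<in> words (others i)"
  shows "inv\<^bsub>Aut\<^esub> transv i u v = transv i (finv u) (finv v)"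
proof (rule A.inv_equality)
  have w: "finv u \<in> words (others i)" "finv v \<in> words (others i)" using assms by (auto intro!: words_finv)
  then show "transv i (finv u) (finv v) \<star> transv i u v = \<one>\<^bsub>Aut\<^esub>"
    using assms words_others by (simp add: transv_mult transv_one fone_eq)
  show "transv i u v \<in> carrier Aut" "transv i (finv u) (finv v) \<in> carrier Aut"
    using assms w by (auto intro: transv_in_Aut)
qed

lemma signed_perms_subset: "signed_perms \<subseteq> carrier Aut"
  by (auto simp: signed_perms_def)

lemma signed_perm_letter:
  assumes "w \<in> signed_perms" "fst k < n"
  shows "\<exists>l. fst l < n \<and> w [k] = [l]"
proof -
  obtain l where l: "fst l < n" "w (gen (fst k)) = [l]" using assms by (auto simp: signed_perms_def)
  obtain i c where k: "k = (i, c)" by (cases k)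
  have "w [k] = (if c then [l] else [inv_letter l])"
    using Aut_letter[of w i c] assms signed_perms_subset l finv_letter[of l] by (auto simp: k)
  then show ?thesis using l(1) by (metis fst_inv_letter)
qed

lemma signed_perms_mult:
  assumes "v \<in> signed_perms" "w \<in> signed_perms"
  shows "v \<star> w \<in> signed_perms"
proof -
  have vw: "v \<in> carrier Aut" "w \<in> carrier Aut" using assms signed_perms_subset by auto
  have "\<exists>k. fst k < n \<and> (v \<star> w) (gen i) = [k]" if i: "i < n" for i
  proof -
    obtain k where "fst k < n" "w (gen i) = [k]" using assms(2) i by (auto simp: signed_perms_def)
    then show ?thesis using signed_perm_letter[OF assms(1), of k] i vw by (simp add: amult_apply)
  qed
  then show ?thesis using vw by (simp add: signed_perms_def)
qed

lemma finite_signed_perms: "finite signed_perms"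
proof -
  let ?r = "\<lambda>a. restrict (\<lambda>i. a (gen i)) {..<n}"
  have "?r ` signed_perms \<subseteq> PiE {..<n} (\<lambda>_. (\<lambda>k. [k]) ` letters)"
    by (intro image_subsetI) (auto simp: signed_perms_def letters_iff restrict_PiE_iff)
  moreover have "finite (PiE {..<n} (\<lambda>_. (\<lambda>k. [k]) ` letters))"
    by (intro finite_PiE) (auto simp: letters_def)
  moreover have "inj_on ?r signed_perms"
  proof (rule inj_onI)
    fix a b assume ab: "a \<in> signed_perms" "b \<in> signed_perms" "?r a = ?r b"
    have "a (gen i) = b (gen i)" if "i < n" for i using fun_cong[OF ab(3), of i] that by simp
    then show "a = b" using ab signed_perms_subset by (intro Aut_eqI) auto
  qed
  ultimately show ?thesis using finite_subset finite_imageD by metis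
qed

lemma signed_perm_others:
  assumes w: "w \<in> signed_perms" and i: "i < n" and wi: "w (gen i) = [(i', c)]" and j: "j < n" "j \<noteq> i"
  shows "w (gen j) \<in> words (others i')"
proof -
  have wA: "w \<in> carrier Aut" using w signed_perms_subset by auto
  obtain l where l: "fst l < n" "w (gen j) = [l]" using w j by (auto simp: signed_perms_def)
  have "fst l \<noteq> i'"
  proof
    assume "fst l = i'"
    then have "l = (i', c) \<or> inv_letter l = (i', c)" by (auto simp: inv_letter_def prod_eq_iff)
    then have "w (gen j) = w (gen i) \<or> w (finv (gen j)) = w (gen i)"
      using l wi wA j finv_letter[of l] by (auto simp: Aut_finv)
    then have "gen j = gen i \<or> finv (gen j) = gen i" using Aut_inj[OF wA] i j by auto
    then show False using j by (auto simp: finv_letter inv_letter_def)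
  qed
  then show ?thesis using l by simp
qed

definition supported :: "((nat \<times> bool) list \<Rightarrow> (nat \<times> bool) list) \<Rightarrow> nat set \<Rightarrow> bool" where
  "supported a J \<longleftrightarrow> a \<in> carrier Aut \<and> (\<forall>j\<in>J. a (gen j) \<in> words J) \<and> (\<forall>j<n. j \<notin> J \<longrightarrow> a (gen j) = gen j)"

text \<open>Each automorphism fixes all words in the generators moved by the other one.\<close>

lemma supported_commute:
  assumes a: "supported a J" and b: "supported b K" and JK: "J \<subseteq> {..<n}" "K \<subseteq> {..<n}" "J \<inter> K = {}"
  shows "a \<star> b = b \<star> a"
proof (rule Aut_eqI)
  have A: "a \<in> carrier Aut" "b \<in> carrier Aut" using a b by (auto simp: supported_def)
  then show "a \<star> b \<in> carrier Aut" "b \<star> a \<in> carrier Aut" by auto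
  have fix_a: "a w = w" if "w \<in> words K" for w
    by (rule Aut_fixes_words[OF A(1) JK(2) _ that]) (use a JK in \<open>auto simp: supported_def\<close>)
  have fix_b: "b w = w" if "w \<in> words J" for w
    by (rule Aut_fixes_words[OF A(2) JK(1) _ that]) (use b JK in \<open>auto simp: supported_def\<close>)
  fix j assume j: "j < n"
  consider "j \<in> J" | "j \<in> K" | "j \<notin> J" "j \<notin> K" by blast
  then have "a (b (gen j)) = b (a (gen j))"
  proof cases
    case 1
    then have "b (gen j) = gen j" "b (a (gen j)) = a (gen j)"
      using fix_b a by (auto simp: supported_def)
    then show ?thesis by simp
  next
    case 2
    then have "a (gen j) = gen j" "a (b (gen j)) = b (gen j)"
      using fix_a b by (auto simp: supported_def)
    then show ?thesis by simp
  next
    case 3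
    then show ?thesis using a b j by (simp add: supported_def)
  qed
  then show "(a \<star> b) (gen j) = (b \<star> a) (gen j)" using A j by (simp add: amult_apply)
qed

definition flip :: "nat \<Rightarrow> (nat \<times> bool) list \<Rightarrow> (nat \<times> bool) list" where
  "flip a = sperm id (\<lambda>j. j \<noteq> a)"

definition swap_flip :: "nat \<Rightarrow> nat \<Rightarrow> nat \<Rightarrow> (nat \<times> bool) list \<Rightarrow> (nat \<times> bool) list" where
  "swap_flip a b c = sperm (Transposition.transpose a c) (\<lambda>j. j \<noteq> b)"

text \<open>\<open>x\<^sub>a \<mapsto> x\<^sub>a\<close> inverted and \<open>x\<^sub>b \<mapsto> x\<^sub>b\<close> times the inverse of \<open>x\<^sub>a\<close>. In the graph with two vertices and three
  edges \<open>e, e\<^sub>a, e\<^sub>b\<close> joining them, where \<open>x\<^sub>a\<close> and \<open>x\<^sub>b\<close> run along \<open>e\<^sub>a\<close> and \<open>e\<^sub>b\<close> and back along \<open>e\<close>, it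
  transposes \<open>e\<close> and \<open>e\<^sub>a\<close>. The involutions \<open>theta a b\<close>, \<open>flip c\<close> and \<open>swap_flip a b c\<close> generate finite groups in
  pairs, but together they produce a transvection.\<close>

definition theta :: "nat \<Rightarrow> nat \<Rightarrow> (nat \<times> bool) list \<Rightarrow> (nat \<times> bool) list" where
  "theta a b = transv b [] [(a, False)] \<star> flip a"

lemma flip_letter: "i < n \<Longrightarrow> flip a [(i, c)] = [(i, c = (i \<noteq> a))]"
  unfolding flip_def by (simp add: sperm_letter permutes_id)

lemma flip_in_signed_perms: "flip a \<in> signed_perms"
  unfolding flip_def by (simp add: sperm_in_signed_perms permutes_id)

lemma flip_in_Aut: "flip a \<in> carrier Aut"
  using flip_in_signed_perms signed_perms_subset by blast

lemma flip_flip: "flip a \<star> flip a = \<one>\<^bsub>Aut\<^esub>"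
  by (rule Aut_eqI) (auto simp: flip_in_Aut amult_apply flip_letter aone_apply)

context
  fixes a b
  assumes ab: "a < n" "b < n" "a \<noteq> b"
begin

lemma theta_in_Aut: "theta a b \<in> carrier Aut"
  unfolding theta_def using ab by (auto intro!: transv_in_Aut flip_in_Aut A.m_closed)

lemma theta_gen: "j < n \<Longrightarrow> theta a b (gen j) =
    (if j = a then [(a, False)] else if j = b then [(b, True), (a, False)] else gen j)"
proof -
  assume j: "j < n"
  have t: "transv b [] [(a, False)] \<in> carrier Aut" using ab by (auto intro!: transv_in_Aut)
  have "theta a b (gen j) = transv b [] [(a, False)] [(j, j \<noteq> a)]"
    unfolding theta_def using j by (simp add: amult_apply t flip_in_Aut flip_letter)
  also have "\<dots> = (if j = a then [(a, False)] else if j = b then [(b, True), (a, False)] else gen j)"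
  proof (cases "j = b")
    case True
    have "transv b [] [(a, False)] (gen b) = [] \<cdot> gen b \<cdot> [(a, False)]" using ab by (simp add: transv_gen)
    then show ?thesis using True ab by (simp add: fmult_eq inv_letter_def)
  next
    case False
    then show ?thesis using j ab by (simp add: transv_fixes_words)
  qed
  finally show ?thesis .
qed

lemma theta_letter_a: "theta a b [(a, c)] = [(a, \<not> c)]"
  using Aut_letter[OF theta_in_Aut, of a c] ab by (simp add: theta_gen finv_letter inv_letter_def)

lemma theta_fixes: "j < n \<Longrightarrow> j \<noteq> a \<Longrightarrow> j \<noteq> b \<Longrightarrow> theta a b [(j, c)] = [(j, c)]"
  using Aut_letter[OF theta_in_Aut, of j c] by (simp add: theta_gen finv_letter inv_letter_def)

lemma theta_b: "theta a b (gen b) = gen b \<cdot> [(a, False)]"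
  using ab by (simp add: theta_gen fmult_eq inv_letter_def)

lemma theta_theta: "theta a b \<star> theta a b = \<one>\<^bsub>Aut\<^esub>"
proof (rule Aut_eqI)
  fix j assume j: "j < n"
  have "theta a b (theta a b (gen j)) = gen j"
  proof (cases "j = b")
    case True
    have "theta a b (gen b \<cdot> [(a, False)]) = gen b \<cdot> [(a, False)] \<cdot> gen a"
      using ab theta_in_Aut by (simp add: Aut_mult theta_b theta_letter_a)
    then show ?thesis using True ab by (simp add: theta_b fmult_eq inv_letter_def)
  qed (use j in \<open>cases "j = a"; simp add: theta_letter_a theta_fixes\<close>)
  then show "(theta a b \<star> theta a b) (gen j) = \<one>\<^bsub>Aut\<^esub> (gen j)"
    using j theta_in_Aut by (simp add: amult_apply aone_apply)
qed (auto simp: theta_in_Aut)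

lemma theta_flip: "theta a b \<star> flip a = transv b [] [(a, False)]"
proof -
  have t: "transv b [] [(a, False)] \<in> carrier Aut" using ab by (auto intro!: transv_in_Aut)
  then show ?thesis unfolding theta_def using flip_in_Aut by (simp add: A.m_assoc flip_flip)
qed

lemma theta_supported: "a \<in> J \<Longrightarrow> b \<in> J \<Longrightarrow> J \<subseteq> {..<n} \<Longrightarrow> supported (theta a b) J"
  unfolding supported_def using theta_in_Aut ab
  by (auto simp: theta_gen subset_iff words_iff reduced_def inv_letter_def)

end

lemma flip_supported: "a \<in> J \<Longrightarrow> supported (flip a) J" if "J \<subseteq> {..<n}"
  unfolding supported_def using flip_in_Aut that by (auto simp: flip_letter subset_iff)

context
  fixes a b c
  assumes abc: "a < n" "b < n" "c < n" "a \<noteq> b" "a \<noteq> c" "b \<noteq> c"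
begin

lemma swap_flip_letter: "i < n \<Longrightarrow> swap_flip a b c [(i, e)] = [(Transposition.transpose a c i, e = (i \<noteq> b))]"
  unfolding swap_flip_def using abc by (simp add: sperm_letter permutes_swap_id)

lemma swap_flip_in_signed_perms: "swap_flip a b c \<in> signed_perms"
  unfolding swap_flip_def using abc by (simp add: sperm_in_signed_perms permutes_swap_id)

lemma swap_flip_in_Aut: "swap_flip a b c \<in> carrier Aut"
  using swap_flip_in_signed_perms signed_perms_subset by blast

lemma transpose_less: "i < n \<Longrightarrow> Transposition.transpose a c i < n"
  using abc by (auto simp: Transposition.transpose_def)

lemma swap_flip_involution: "swap_flip a b c \<star> swap_flip a b c = \<one>\<^bsub>Aut\<^esub>"
  using abc by (intro Aut_eqI)
    (auto simp: swap_flip_in_Aut amult_apply swap_flip_letter aone_apply transpose_less Transposition.transpose_def)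

lemma swap_flip_conj_flip: "swap_flip a b c \<star> flip c \<star> swap_flip a b c = flip a"
  using abc by (intro Aut_eqI)
    (auto simp: swap_flip_in_Aut flip_in_Aut amult_apply swap_flip_letter flip_letter transpose_less Transposition.transpose_def)

lemma swap_flip_supported: "{a, b, c} \<subseteq> J \<Longrightarrow> J \<subseteq> {..<n} \<Longrightarrow> supported (swap_flip a b c) J"
  unfolding supported_def using swap_flip_in_Aut abc
  by (auto simp: swap_flip_letter Transposition.transpose_def subset_iff)

lemma theta_commute_flip: "theta a b \<star> flip c = flip c \<star> theta a b"
proof (rule supported_commute[of _ "{a, b}" _ "{c}"])
  show "supported (flip c) {c}" using abc by (intro flip_supported) auto
qed (use abc theta_supported in auto)

text \<open>\<open>theta a b\<close> multiplies \<open>x\<^sub>b\<close> on the right by a power of \<open>x\<^sub>a\<close>, while its conjugate multiplies \<open>x\<^sub>b\<close> on the left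
  by a power of \<open>x\<^sub>c\<close>. It is for this that \<open>swap_flip\<close> inverts \<open>x\<^sub>b\<close>.\<close>

lemma theta_commute_conj:
  "theta a b \<star> (swap_flip a b c \<star> theta a b \<star> swap_flip a b c)
     = (swap_flip a b c \<star> theta a b \<star> swap_flip a b c) \<star> theta a b"
proof -
  let ?t = "theta a b" and ?s = "swap_flip a b c"
  have A: "?t \<in> carrier Aut" "?s \<in> carrier Aut" using abc theta_in_Aut swap_flip_in_Aut by auto
  define r where "r = ?s \<star> ?t \<star> ?s"
  have r: "r \<in> carrier Aut" using A by (simp add: r_def)
  have r_app: "r w = ?s (?t (?s w))" if "w \<in> carrier G" for w
    using that A by (simp add: r_def amult_apply Aut_closed)
  have tb: "?t [(b, False)] = gen a \<cdot> [(b, False)]"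
    using Aut_letter[of ?t b False] abc A by (simp add: theta_gen finv_eq words_iff reduced_def inv_letter_def fmult_eq)
  have r_b: "r (gen b) = gen c \<cdot> gen b"
  proof -
    have "?s (?t (?s (gen b))) = ?s (gen a \<cdot> [(b, False)])"
      using abc tb by (simp add: swap_flip_letter Transposition.transpose_def)
    also have "\<dots> = gen c \<cdot> gen b" using abc A by (simp add: Aut_mult swap_flip_letter Transposition.transpose_def)
    finally show ?thesis using abc r_app by simp
  qed
  have r_other: "r [(j, e)] = [(j, if j = c then \<not> e else e)]" if "j < n" "j \<noteq> b" for j e
    using that abc r_app
    by (cases "j = a"; cases "j = c")
      (simp_all add: swap_flip_letter theta_letter_a theta_fixes Transposition.transpose_def)
  have "?t \<star> r = r \<star> ?t"
  proof (rule Aut_eqI)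
    fix j assume j: "j < n"
    have "?t (r (gen j)) = r (?t (gen j))"
    proof (cases "j = b")
      case True
      have "?t (gen c \<cdot> gen b) = gen c \<cdot> (gen b \<cdot> [(a, False)])"
        using abc A by (simp add: Aut_mult theta_b theta_fixes)
      moreover have "r (gen b \<cdot> [(a, False)]) = (gen c \<cdot> gen b) \<cdot> [(a, False)]"
        using abc r by (simp add: Aut_mult r_b r_other)
      ultimately show ?thesis using True abc by (simp add: r_b theta_b G.m_assoc)
    next
      case False
      then show ?thesis using j abc
        by (cases "j = a"; cases "j = c") (simp_all add: r_other theta_letter_a theta_fixes)
    qed
    then show "(?t \<star> r) (gen j) = (r \<star> ?t) (gen j)" using j A r by (simp add: amult_apply)
  qed (use A r in auto)
  then show ?thesis by (simp add: r_def)
qed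

end

end

section \<open>Actions: fixed points of transvections\<close>

locale Aut_action = complete_CAT0_space M d + free_group_automorphisms n
  for M :: "'a set" and d and n +
  fixes \<phi> :: "((nat \<times> bool) list \<Rightarrow> (nat \<times> bool) list) \<Rightarrow> 'a \<Rightarrow> 'a"
  assumes \<phi>: "\<phi> \<in> hom Aut (IsomGroup M d)"
begin

definition Fix :: "((nat \<times> bool) list \<Rightarrow> (nat \<times> bool) list) set \<Rightarrow> 'a set" where
  "Fix A = fixset (\<phi> ` A)"

definition stab :: "'a set \<Rightarrow> ((nat \<times> bool) list \<Rightarrow> (nat \<times> bool) list) set" where
  "stab Y = {a \<in> carrier Aut. \<forall>y\<in>Y. \<phi> a y = y}"

lemma \<phi>_isometry: "a \<in> carrier Aut \<Longrightarrow> \<phi> a \<in> isometries M d"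
  using \<phi> by (auto simp: hom_def IsomGroup_def)

lemma \<phi>_closed: "a \<in> carrier Aut \<Longrightarrow> x \<in> M \<Longrightarrow> \<phi> a x \<in> M"
  using isometriesD(1)[OF \<phi>_isometry] .

lemma \<phi>_mult: "a \<in> carrier Aut \<Longrightarrow> b \<in> carrier Aut \<Longrightarrow> x \<in> M \<Longrightarrow> \<phi> (a \<star> b) x = \<phi> a (\<phi> b x)"
  using \<phi> \<phi>_isometry[of a] \<phi>_isometry[of b]
  by (simp add: hom_def IsomGroup_def BijGroup_def isometries_def compose_eq)

lemma \<phi>_one: "x \<in> M \<Longrightarrow> \<phi> \<one>\<^bsub>Aut\<^esub> x = x"
proof -
  interpret h: group_hom Aut "IsomGroup M d" \<phi>
    using \<phi> group_IsomGroup A.group_axioms by (simp add: group_hom_def group_hom_axioms_def)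
  show "x \<in> M \<Longrightarrow> \<phi> \<one>\<^bsub>Aut\<^esub> x = x" using h.hom_one by (simp add: IsomGroup_def BijGroup_def)
qed

lemma \<phi>_inj: "a \<in> carrier Aut \<Longrightarrow> x \<in> M \<Longrightarrow> y \<in> M \<Longrightarrow> \<phi> a x = \<phi> a y \<Longrightarrow> x = y"
  using isometriesD(4)[OF \<phi>_isometry] by (meson inj_onD)

lemma Fix_iff: "x \<in> Fix A \<longleftrightarrow> x \<in> M \<and> (\<forall>a\<in>A. \<phi> a x = x)"
  by (auto simp: Fix_def fixset_def)

lemma Fix_mono: "A \<subseteq> B \<Longrightarrow> Fix B \<subseteq> Fix A"
  unfolding Fix_def by (intro fixset_mono image_mono)

lemma Fix_nonempty_mono: "A \<subseteq> B \<Longrightarrow> Fix B \<noteq> {} \<Longrightarrow> Fix A \<noteq> {}"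
  using Fix_mono by blast

lemma Fix_empty: "Fix {} \<noteq> {}"
  using nonempty by (auto simp: Fix_def fixset_def)

lemma stab_subgroup: "Y \<subseteq> M \<Longrightarrow> subgroup (stab Y) Aut"
proof (rule A.subgroupI)
  assume Y: "Y \<subseteq> M"
  show "stab Y \<noteq> {}" using Y \<phi>_one by (auto simp: stab_def intro!: exI[of _ "\<one>\<^bsub>Aut\<^esub>"])
  fix a assume a: "a \<in> stab Y"
  then have "\<phi> (inv\<^bsub>Aut\<^esub> a) y = y" if "y \<in> Y" for y
    using \<phi>_mult[of "inv\<^bsub>Aut\<^esub> a" a y] that Y \<phi>_one[of y] by (auto simp: stab_def)
  then show "inv\<^bsub>Aut\<^esub> a \<in> stab Y" using a by (auto simp: stab_def)
  fix b assume "b \<in> stab Y"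
  then show "a \<star> b \<in> stab Y" using a Y \<phi>_mult[of a b] by (auto simp: stab_def)
qed (auto simp: stab_def)

lemma Fix_subset: "Fix A \<subseteq> M"
  by (auto simp: Fix_iff)

lemma subset_stab_Fix: "A \<subseteq> carrier Aut \<Longrightarrow> A \<subseteq> stab (Fix A)"
  by (auto simp: stab_def Fix_iff)

lemma Fix_stab: "x \<in> M \<Longrightarrow> A \<subseteq> stab {x} \<Longrightarrow> x \<in> Fix A"
  by (auto simp: stab_def Fix_iff)

text \<open>The form of \<open>fixset_Un_nonempty\<close> used for semidirect products: \<open>B\<close> normalises a group with the same fixed
  set as \<open>A\<close>.\<close>

lemma Fix_Un_nonempty:
  assumes A: "A \<subseteq> carrier Aut" and B: "B \<subseteq> carrier Aut" and ne: "Fix A \<noteq> {}" "Fix B \<noteq> {}"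
    and normal: "\<And>a b. a \<in> A \<Longrightarrow> b \<in> B \<Longrightarrow> \<exists>a'\<in>stab (Fix A). b \<star> a = a' \<star> b"
  shows "Fix (A \<union> B) \<noteq> {}"
  unfolding Fix_def image_Un
proof (rule fixset_Un_nonempty)
  show "\<phi> ` A \<subseteq> isometries M d" "\<phi> ` B \<subseteq> isometries M d" using A B \<phi>_isometry by auto
  show "fixset (\<phi> ` A) \<noteq> {}" "fixset (\<phi> ` B) \<noteq> {}" using ne by (simp_all add: Fix_def)
  fix f y assume "f \<in> \<phi> ` B" and y: "y \<in> M" and fy: "f y \<in> fixset (\<phi> ` A)"
  then obtain b where b: "b \<in> B" "f = \<phi> b" by auto
  have "\<phi> a y = y" if a: "a \<in> A" for a
  proof -
    obtain a' where a': "a' \<in> stab (Fix A)" "b \<star> a = a' \<star> b" using normal[OF a b(1)] by blast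
    have cl: "a \<in> carrier Aut" "b \<in> carrier Aut" "a' \<in> carrier Aut"
      using a b a' A B by (auto simp: stab_def)
    have "\<phi> b (\<phi> a y) = \<phi> a' (\<phi> b y)" using a'(2) cl y by (simp flip: \<phi>_mult)
    also have "\<dots> = \<phi> b y" using a'(1) fy b by (simp add: stab_def Fix_def)
    finally show ?thesis using \<phi>_inj[OF cl(2)] \<phi>_closed cl y by blast
  qed
  then show "y \<in> fixset (\<phi> ` A)" using y by (auto simp: fixset_def)
qed

lemma Fix_Un_commuting:
  assumes A: "A \<subseteq> carrier Aut" and B: "B \<subseteq> carrier Aut" and ne: "Fix A \<noteq> {}" "Fix B \<noteq> {}"
    and comm: "\<And>a b. a \<in> A \<Longrightarrow> b \<in> B \<Longrightarrow> a \<star> b = b \<star> a"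
  shows "Fix (A \<union> B) \<noteq> {}"
proof (rule Fix_Un_nonempty[OF A B ne])
  fix a b assume ab: "a \<in> A" "b \<in> B"
  then show "\<exists>a'\<in>stab (Fix A). b \<star> a = a' \<star> b"
    using comm[OF ab] subset_stab_Fix[OF A] by (intro bexI[of _ a]) auto
qed

lemma Fix_conjugate:
  assumes b: "b \<in> carrier Aut" and ne: "Fix A \<noteq> {}" and C: "C \<subseteq> carrier Aut"
    and conj: "\<And>c. c \<in> C \<Longrightarrow> \<exists>a\<in>stab (Fix A). c \<star> b = b \<star> a"
  shows "Fix C \<noteq> {}"
proof -
  obtain y where y: "y \<in> Fix A" using ne by blast
  have "\<phi> c (\<phi> b y) = \<phi> b y" if c: "c \<in> C" for c
  proof -
    obtain a where a: "a \<in> stab (Fix A)" "c \<star> b = b \<star> a" using conj[OF c] by blast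
    have "a \<in> carrier Aut" "c \<in> carrier Aut" "y \<in> M" using a c C y by (auto simp: stab_def Fix_iff)
    then have "\<phi> c (\<phi> b y) = \<phi> b (\<phi> a y)" using a(2) b by (simp flip: \<phi>_mult)
    then show ?thesis using a(1) y by (simp add: stab_def)
  qed
  then have "\<phi> b y \<in> Fix C" using \<phi>_closed[OF b] y by (auto simp: Fix_iff)
  then show ?thesis by blast
qed

lemma Fix_involution:
  assumes "a \<in> carrier Aut" "a \<star> a = \<one>\<^bsub>Aut\<^esub>"
  shows "Fix {a} \<noteq> {}"
proof -
  obtain p where p: "p \<in> M" using nonempty by blast
  have "\<phi> a (\<phi> a p) = p" using assms p \<phi>_one[OF p] by (simp flip: \<phi>_mult)
  then show ?thesis
    unfolding Fix_def using assms p \<phi>_isometry \<phi>_closed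
    by (intro finite_invariant_set_fixed_point[of "{p, \<phi> a p}"]) auto
qed

lemma Fix_signed_perms: "Fix signed_perms \<noteq> {}"
proof -
  obtain p where p: "p \<in> M" using nonempty by blast
  show ?thesis
    unfolding Fix_def
  proof (rule finite_invariant_set_fixed_point[of "(\<lambda>w. \<phi> w p) ` signed_perms"])
    show "finite ((\<lambda>w. \<phi> w p) ` signed_perms)" using finite_signed_perms by simp
    show "(\<lambda>w. \<phi> w p) ` signed_perms \<noteq> {}" using flip_in_signed_perms by blast
    show "(\<lambda>w. \<phi> w p) ` signed_perms \<subseteq> M" "\<phi> ` signed_perms \<subseteq> isometries M d"
      using signed_perms_subset \<phi>_closed p \<phi>_isometry by auto
    fix f assume "f \<in> \<phi> ` signed_perms"
    then obtain v where v: "v \<in> signed_perms" "f = \<phi> v" by auto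
    have "\<phi> v (\<phi> w p) = \<phi> (v \<star> w) p" if "w \<in> signed_perms" for w
      using v that p signed_perms_subset by (intro \<phi>_mult[symmetric]) auto
    then show "f ` (\<lambda>w. \<phi> w p) ` signed_perms \<subseteq> (\<lambda>w. \<phi> w p) ` signed_perms"
      using v signed_perms_mult by auto
  qed
qed

text \<open>The commuting involutions \<open>a\<close> and \<open>s a s\<close> have a common fixed point, and \<open>s\<close> exchanges them, so it
  preserves their common fixed set.\<close>

lemma Fix_dihedral:
  assumes a: "a \<in> carrier Aut" "a \<star> a = \<one>\<^bsub>Aut\<^esub>" and s: "s \<in> carrier Aut" "s \<star> s = \<one>\<^bsub>Aut\<^esub>"
    and comm: "a \<star> (s \<star> a \<star> s) = (s \<star> a \<star> s) \<star> a"
  shows "Fix {a, s} \<noteq> {}"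
proof -
  define r where "r = s \<star> a \<star> s"
  have r: "r \<in> carrier Aut" using a s by (simp add: r_def)
  have cancel: "s \<star> (s \<star> x) = x" "a \<star> (a \<star> x) = x" if "x \<in> carrier Aut" for x
    using that a s by (simp_all flip: A.m_assoc)
  have rr: "r \<star> r = \<one>\<^bsub>Aut\<^esub>" using a s by (simp add: r_def A.m_assoc cancel)
  have "Fix ({a} \<union> {r}) \<noteq> {}"
    by (rule Fix_Un_commuting) (use a r rr Fix_involution comm in \<open>auto simp: r_def\<close>)
  then have ar: "Fix {a, r} \<noteq> {}" by (simp add: insert_commute)
  have "s \<star> a = r \<star> s" "s \<star> r = a \<star> s" using a s by (simp_all add: r_def A.m_assoc cancel)
  then have "Fix ({a, r} \<union> {s}) \<noteq> {}"
    using subset_stab_Fix[of "{a, r}"] a r s ar Fix_involution[OF s]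
    by (intro Fix_Un_nonempty) auto
  then show ?thesis by (rule Fix_nonempty_mono[rotated]) auto
qed

lemma commuting_families_Fix:
  assumes dim: "covering_dim_at_most mtopology q" and I: "finite I"
    and fin: "\<And>i. i \<in> I \<Longrightarrow> finite (S i)" and S: "\<And>i. i \<in> I \<Longrightarrow> S i \<subseteq> carrier Aut"
    and comm: "\<And>i j a b. i \<in> I \<Longrightarrow> j \<in> I \<Longrightarrow> i \<noteq> j \<Longrightarrow> a \<in> S i \<Longrightarrow> b \<in> S j \<Longrightarrow> a \<star> b = b \<star> a"
    and small: "\<And>i B. i \<in> I \<Longrightarrow> B \<subseteq> S i \<Longrightarrow> card B \<le> k i \<Longrightarrow> Fix B \<noteq> {}"
    and big: "q < sum k I"
  shows "\<exists>i\<in>I. Fix (S i) \<noteq> {}"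
  unfolding Fix_def
proof (rule commuting_families_fixed_point[OF dim I _ _ _ _ big])
  show "finite (\<phi> ` S i)" "\<phi> ` S i \<subseteq> isometries M d" if "i \<in> I" for i
    using fin[OF that] S[OF that] \<phi>_isometry by auto
next
  fix i j f g x
  assume ij: "i \<in> I" "j \<in> I" "i \<noteq> j" and "f \<in> \<phi> ` S i" "g \<in> \<phi> ` S j" and x: "x \<in> M"
  then obtain a b where ab: "a \<in> S i" "b \<in> S j" "f = \<phi> a" "g = \<phi> b" by auto
  then have "a \<in> carrier Aut" "b \<in> carrier Aut" using S ij by auto
  then show "f (g x) = g (f x)" using ab x comm[OF ij ab(1,2)] by (simp flip: \<phi>_mult)
next
  fix i B assume i: "i \<in> I" and B: "B \<subseteq> \<phi> ` S i" "card B \<le> k i"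
  then obtain C where C: "C \<subseteq> S i" "inj_on \<phi> C" "B = \<phi> ` C" by (auto simp: subset_image_inj)
  then show "fixset B \<noteq> {}" using small[OF i C(1)] B(2) by (simp add: card_image Fix_def)
qed

lemma subset_of_three:
  assumes "B \<subseteq> {x, y, z}" "card B \<le> 2"
  shows "B \<subseteq> {x, y} \<or> B \<subseteq> {x, z} \<or> B \<subseteq> {y, z}"
proof (rule ccontr)
  assume "\<not> ?thesis"
  then have "x \<in> B" "y \<in> B" "z \<in> B" "x \<noteq> y" "y \<noteq> z" "x \<noteq> z" using assms(1) by auto
  then have "card {x, y, z} = 3" "{x, y, z} \<subseteq> B" by auto
  then show False using assms card_mono[of B "{x, y, z}"] finite_subset[OF assms(1)] by auto
qed

text \<open>Each of the \<open>m\<close> triples of generators carries three involutions whose pairs have fixed points,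
  contributing \<open>2\<close> to the bound on the dimension; a further pair of generators carries two involutions and
  contributes \<open>1\<close>. A common fixed point of one of these families is fixed by the product of \<open>theta\<close> and a
  \<open>flip\<close>, which is a transvection.\<close>

lemma some_transvection_fixes:
  assumes dim: "covering_dim_at_most mtopology q"
    and q: "(n \<ge> 3 * m \<and> q < 2 * m) \<or> (n \<ge> 3 * m + 2 \<and> q < 2 * m + 1)"
  shows "\<exists>a b. a < n \<and> b < n \<and> a \<noteq> b \<and> Fix {transv b [] [(a, False)]} \<noteq> {}"
proof -
  define I where "I = (if n \<ge> 3 * m + 2 then {..m} else {..<m})"
  define J where "J = (\<lambda>i. if i < m then {3*i, 3*i+1, 3*i+2} else {3*i, 3*i+1})"
  define S where "S = (\<lambda>i. if i < m
      then {theta (3*i) (3*i+1), flip (3*i+2), swap_flip (3*i) (3*i+1) (3*i+2)}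
      else {theta (3*i) (3*i+1), flip (3*i)})"
  define k :: "nat \<Rightarrow> nat" where "k = (\<lambda>i. if i < m then 2 else 1)"
  have n: "3 * m \<le> n" using q by auto
  have lt: "3*i < n" "3*i+1 < n" if "i \<in> I" for i
    using that n by (auto simp: I_def split: if_splits)
  have lt2: "3*i+2 < n" if "i < m" for i using that n by simp
  have J: "J i \<subseteq> {..<n}" if "i \<in> I" for i using lt[OF that] lt2 by (auto simp: J_def)
  have supp: "supported a (J i)" if i: "i \<in> I" and a: "a \<in> S i" for a i
  proof (cases "i < m")
    case True
    then show ?thesis
      using a lt[OF i] lt2[OF True] J[OF i]
      by (auto simp: S_def J_def intro: theta_supported flip_supported swap_flip_supported)
  next
    case False
    then show ?thesis
      using a lt[OF i] J[OF i] by (auto simp: S_def J_def intro: theta_supported flip_supported)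
  qed
  have flip_Fix: "Fix {flip a} \<noteq> {}" for a
    by (rule Fix_involution[OF flip_in_Aut flip_flip])
  have theta_Fix: "Fix {theta (3*i) (3*i+1)} \<noteq> {}" if "i \<in> I" for i
    using lt[OF that] by (intro Fix_involution theta_in_Aut theta_theta) auto
  have "\<exists>i\<in>I. Fix (S i) \<noteq> {}"
  proof (rule commuting_families_Fix[OF dim])
    show "q < sum k I"
    proof (cases "n \<ge> 3 * m + 2")
      case True
      then have "sum k I = sum k {..<m} + k m" by (simp add: I_def flip: lessThan_Suc_atMost)
      then show ?thesis using q by (auto simp: k_def)
    next
      case False
      then show ?thesis using q by (auto simp: I_def k_def)
    qed
    show "finite I" "\<And>i. finite (S i)" by (auto simp: I_def S_def)
    show "S i \<subseteq> carrier Aut" if "i \<in> I" for i using supp[OF that] by (auto simp: supported_def)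
    show "a \<star> b = b \<star> a" if "i \<in> I" "j \<in> I" "i \<noteq> j" "a \<in> S i" "b \<in> S j" for i j a b
    proof (rule supported_commute[OF supp[OF that(1,4)] supp[OF that(2,5)] J[OF that(1)] J[OF that(2)]])
      show "J i \<inter> J j = {}" using \<open>i \<noteq> j\<close> by (auto simp: J_def split: if_splits; presburger)
    qed
    fix i B assume i: "i \<in> I" and B: "B \<subseteq> S i" "card B \<le> k i"
    show "Fix B \<noteq> {}"
    proof (cases "i < m")
      case True
      let ?t = "theta (3*i) (3*i+1)" and ?f = "flip (3*i+2)" and ?s = "swap_flip (3*i) (3*i+1) (3*i+2)"
      note abc = lt[OF i] lt2[OF True]
      have A: "?t \<in> carrier Aut" "?f \<in> carrier Aut" "?s \<in> carrier Aut"
        using abc theta_in_Aut flip_in_Aut swap_flip_in_Aut by auto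
      have "Fix ({?t} \<union> {?f}) \<noteq> {}"
        using A theta_Fix[OF i] flip_Fix theta_commute_flip[of "3*i" "3*i+1" "3*i+2"] abc
        by (intro Fix_Un_commuting) auto
      then have "Fix {?t, ?f} \<noteq> {}" by (simp add: insert_commute)
      moreover have "Fix {?t, ?s} \<noteq> {}"
        using abc by (intro Fix_dihedral A theta_theta swap_flip_involution theta_commute_conj) auto
      moreover have "{?f, ?s} \<subseteq> signed_perms"
        using flip_in_signed_perms swap_flip_in_signed_perms abc by auto
      then have "Fix {?f, ?s} \<noteq> {}" using Fix_signed_perms Fix_nonempty_mono by blast
      moreover have "B \<subseteq> {?t, ?f} \<or> B \<subseteq> {?t, ?s} \<or> B \<subseteq> {?f, ?s}"
        using B True by (intro subset_of_three) (auto simp: S_def k_def)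
      ultimately show ?thesis using Fix_nonempty_mono by blast
    next
      case False
      then have "B \<subseteq> {theta (3*i) (3*i+1), flip (3*i)}" "card B \<le> 1" using B by (auto simp: S_def k_def)
      then have "B \<subseteq> {theta (3*i) (3*i+1)} \<or> B \<subseteq> {flip (3*i)}"
        using card_le_Suc0_iff_eq[of B] finite_subset[of B] by auto
      then show ?thesis using theta_Fix[OF i] flip_Fix Fix_nonempty_mono by blast
    qed
  qed
  then obtain i where i: "i \<in> I" "Fix (S i) \<noteq> {}" by blast
  then obtain p where p: "p \<in> Fix (S i)" by blast
  let ?a = "3*i" and ?b = "3*i+1"
  have pM: "p \<in> M" using p by (simp add: Fix_iff)
  have H: "subgroup (stab {p}) Aut" using pM by (intro stab_subgroup) auto
  have S_stab: "S i \<subseteq> stab {p}"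
    using supp[OF i(1)] p by (auto simp: stab_def Fix_iff supported_def)
  have "flip ?a \<in> stab {p}"
  proof (cases "i < m")
    case True
    then have "flip ?a = swap_flip ?a ?b (3*i+2) \<star> flip (3*i+2) \<star> swap_flip ?a ?b (3*i+2)"
      using lt[OF i(1)] lt2 by (intro swap_flip_conj_flip[symmetric]) auto
    moreover have "swap_flip ?a ?b (3*i+2) \<in> stab {p}" "flip (3*i+2) \<in> stab {p}"
      using S_stab True by (auto simp: S_def)
    ultimately show ?thesis using subgroup.m_closed[OF H] by simp
  qed (use S_stab in \<open>auto simp: S_def\<close>)
  moreover have "theta ?a ?b \<in> stab {p}" using S_stab by (auto simp: S_def split: if_splits)
  moreover have "theta ?a ?b \<star> flip ?a = transv ?b [] [(?a, False)]"
    using lt[OF i(1)] by (intro theta_flip) auto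
  ultimately have "transv ?b [] [(?a, False)] \<in> stab {p}" using subgroup.m_closed[OF H] by metis
  then have "Fix {transv ?b [] [(?a, False)]} \<noteq> {}" using Fix_stab[OF pM] by blast
  then show ?thesis using lt[OF i(1)] by (intro exI[of _ ?a] exI[of _ ?b]) auto
qed

end

lemma ex_permutation_moving_two:
  assumes "a \<in> S" "b \<in> S" "a \<noteq> b" "i \<in> S" "j \<in> S" "i \<noteq> j"
  shows "\<exists>\<pi>. \<pi> permutes S \<and> \<pi> a = i \<and> \<pi> b = j"
proof -
  define b' where "b' = Transposition.transpose a i b"
  have b': "b' \<in> S" "b' \<noteq> i" using assms by (auto simp: b'_def Transposition.transpose_def)
  have "Transposition.transpose b' j \<circ> Transposition.transpose a i permutes S"
    using assms b' by (intro permutes_compose permutes_swap_id)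
  moreover have "(Transposition.transpose b' j \<circ> Transposition.transpose a i) a = i"
    using assms b' by (auto simp: Transposition.transpose_def)
  moreover have "(Transposition.transpose b' j \<circ> Transposition.transpose a i) b = j"
    by (simp add: b'_def)
  ultimately show ?thesis by blast
qed

context Aut_action
begin

text \<open>Left and right transvections by one generator; a common name lets every argument treat the two sides
  at once.\<close>

definition side :: "bool \<Rightarrow> nat \<Rightarrow> nat \<Rightarrow> (nat \<times> bool) list \<Rightarrow> (nat \<times> bool) list" where
  "side s i j = (if s then transv i (gen j) [] else transv i [] (gen j))"

lemma side_in_Aut: "i < n \<Longrightarrow> j < n \<Longrightarrow> i \<noteq> j \<Longrightarrow> side s i j \<in> carrier Aut"
  by (auto simp: side_def intro!: transv_in_Aut)

lemma side_inv:
  assumes "i < n" "j < n" "i \<noteq> j"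
  shows "inv\<^bsub>Aut\<^esub> side s i j = (if s then transv i [(j, False)] [] else transv i [] [(j, False)])"
  using assms by (auto simp: side_def transv_inv finv_letter inv_letter_def finv_eq)

text \<open>A signed permutation that inverts \<open>x\<^sub>i\<close> exchanges the two sides and inverts the multiplier.\<close>

lemma side_conj:
  assumes \<pi>: "\<pi> permutes {..<n}" and ij: "i < n" "j < n" "i \<noteq> j" and j: "e j"
  shows "sperm \<pi> e \<star> (if e i then side s i j else inv\<^bsub>Aut\<^esub> side (\<not> s) i j) = side s (\<pi> i) (\<pi> j) \<star> sperm \<pi> e"
proof -
  let ?w = "sperm \<pi> e"
  have w: "?w \<in> carrier Aut" by (rule sperm_in_Aut[OF \<pi>])
  have \<pi>ij: "\<pi> i < n" using permutes_in_image[OF \<pi>, of i] ij by simp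
  have oth: "?w (gen l) \<in> words (others (\<pi> i))" if "l < n" "l \<noteq> i" for l
    using that sperm_letter[OF \<pi> that(1)] permutes_in_image[OF \<pi>, of l] permutes_inj[OF \<pi>]
    by (auto simp: inj_eq)
  have nil: "[] \<in> words (others i)" and g: "[(j, c)] \<in> words (others i)" for c using ij by auto
  have wj: "?w [(j, c)] = [(\<pi> j, c)]" for c using sperm_letter[OF \<pi> ij(2)] j by simp
  have wnil: "?w [] = []" by (rule Aut_Nil[OF w])
  have fin: "finv [(\<pi> j, False)] = gen (\<pi> j)" "finv [] = []"
    using permutes_in_image[OF \<pi>, of j] ij by (auto simp: finv_letter inv_letter_def finv_eq)
  show ?thesis
  proof (cases "e i")
    case True
    then have "?w (gen i) = gen (\<pi> i)" using sperm_letter[OF \<pi> ij(1)] by simp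
    from transv_conj[OF w ij(1) \<pi>ij this oth]
    show ?thesis using True nil g wj wnil by (simp add: side_def)
  next
    case False
    then have "?w (gen i) = [(\<pi> i, False)]" using sperm_letter[OF \<pi> ij(1)] by simp
    from transv_conj_invert[OF w ij(1) \<pi>ij this oth]
    show ?thesis
      unfolding side_inv[OF ij] using False nil g wj wnil fin by (cases s) (simp_all add: side_def)
  qed
qed

text \<open>Transvections are conjugate, up to inversion, under signed permutations.\<close>

lemma all_transvections_Fix:
  assumes ab: "a < n" "b < n" "a \<noteq> b" and ne: "Fix {transv b [] [(a, False)]} \<noteq> {}"
    and ij: "i < n" "j < n" "i \<noteq> j"
  shows "Fix {side s i j} \<noteq> {}"
proof -
  let ?A = "{transv b [] [(a, False)]}"
  have H: "subgroup (stab (Fix ?A)) Aut" by (rule stab_subgroup[OF Fix_subset])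
  have "?A \<subseteq> carrier Aut" using ab by (auto intro!: transv_in_Aut)
  then have inv: "inv\<^bsub>Aut\<^esub> side False b a \<in> stab (Fix ?A)"
    using subset_stab_Fix[of ?A] ab by (simp add: side_inv)
  then have "side False b a \<in> stab (Fix ?A)"
    using subgroup.m_inv_closed[OF H inv] side_in_Aut[of b a False] ab by simp
  obtain \<pi> where \<pi>: "\<pi> permutes {..<n}" "\<pi> b = i" "\<pi> a = j"
    using ex_permutation_moving_two[of b "{..<n}" a i j] ab ij by auto
  let ?w = "sperm \<pi> (\<lambda>l. l = b \<longrightarrow> \<not> s)"
  have "\<exists>x\<in>stab (Fix ?A). side s i j \<star> ?w = ?w \<star> x"
    using side_conj[OF \<pi>(1), of b a "\<lambda>l. l = b \<longrightarrow> \<not> s" s] ab \<pi>(2,3) inv \<open>side False b a \<in> stab (Fix ?A)\<close>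
    by (cases s) (auto intro: sym)
  then show ?thesis
    using side_in_Aut[OF ij] by (intro Fix_conjugate[OF sperm_in_Aut[OF \<pi>(1)] ne]) auto
qed

section \<open>Free groups of multipliers and triangular groups\<close>

text \<open>For \<open>i \<notin> J\<close> these generate the maps \<open>x\<^sub>i \<mapsto> u x\<^sub>i v\<close> with \<open>u\<close> and \<open>v\<close> words in \<open>J\<close>, a direct product of two
  free groups.\<close>

definition multipliers :: "nat \<Rightarrow> nat set \<Rightarrow> ((nat \<times> bool) list \<Rightarrow> (nat \<times> bool) list) set" where
  "multipliers i J = (\<Union>s. side s i ` J)"

lemma multipliers_subset: "i < n \<Longrightarrow> J \<subseteq> others i \<Longrightarrow> multipliers i J \<subseteq> carrier Aut"
  by (auto simp: multipliers_def intro!: side_in_Aut)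

lemma transv_in_stab_multipliers:
  assumes "i < n" "J \<subseteq> others i" "u \<in> words J" "v \<in> words J"
  shows "transv i u v \<in> stab (Fix (multipliers i J))"
proof (rule transv_words_in_subgroup[OF stab_subgroup[OF Fix_subset] assms(1,2) _ _ assms(3,4)])
  fix j assume j: "j \<in> J"
  have "side s i j \<in> stab (Fix (multipliers i J))" for s
    using subset_stab_Fix[OF multipliers_subset[OF assms(1,2)]] j by (auto simp: multipliers_def)
  from this[of True] this[of False]
  show "transv i (gen j) [] \<in> stab (Fix (multipliers i J))" "transv i [] (gen j) \<in> stab (Fix (multipliers i J))"
    by (simp_all add: side_def)
qed

text \<open>The left multipliers and the right multipliers of the generators outside \<open>J\<close> form \<open>2 * (n - card J)\<close>
  commuting families. Single transvections have fixed points, so one of the families has one; the families are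
  conjugate, so all of them have fixed points, and left and right multipliers of \<open>x\<^sub>i\<close> commute.\<close>

lemma multipliers_Fix:
  assumes dim: "covering_dim_at_most mtopology q"
    and single: "\<And>s i j. i < n \<Longrightarrow> j < n \<Longrightarrow> i \<noteq> j \<Longrightarrow> Fix {side s i j} \<noteq> {}"
    and J: "J \<subseteq> {..<n}" and small: "q < 2 * (n - card J)" and i: "i < n" "i \<notin> J"
  shows "Fix (multipliers i J) \<noteq> {}"
proof -
  have finJ: "finite J" using J finite_subset by blast
  define I where "I = ({..<n} - J) \<times> (UNIV :: bool set)"
  have cardI: "card I = 2 * (n - card J)"
    unfolding I_def using J finJ by (simp add: card_cartesian_product card_Diff_subset)
  have Jo: "J \<subseteq> others l" if "l \<notin> J" for l using J that by auto
  have jn: "j < n" "j \<noteq> l" if "j \<in> J" "l \<notin> J" for j l using J that by auto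
  have "\<exists>x\<in>I. Fix ((\<lambda>(l, s). side s l ` J) x) \<noteq> {}"
  proof (rule commuting_families_Fix[OF dim, where k="\<lambda>_. 1"])
    show "finite I" by (simp add: I_def)
    show "q < sum (\<lambda>_. 1) I" using small cardI by simp
    show "finite ((\<lambda>(l, s). side s l ` J) x)" for x using finJ by (cases x) simp
    show "(\<lambda>(l, s). side s l ` J) x \<subseteq> carrier Aut" if "x \<in> I" for x
      using that jn by (force simp: I_def intro!: side_in_Aut)
    show "Fix B \<noteq> {}" if x: "x \<in> I" and B: "B \<subseteq> (\<lambda>(l, s). side s l ` J) x" "card B \<le> 1" for x B
    proof (cases "B = {}")
      case False
      have "finite B" using B(1) finJ finite_subset by (cases x) fastforce
      then have "card B = 1" using False B(2) card_0_eq[of B] by linarith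
      then obtain y where y: "B = {y}" by (rule card_1_singletonE)
      obtain l s where x_eq: "x = (l, s)" by (cases x)
      then have l: "l < n" "l \<notin> J" using x by (auto simp: I_def)
      obtain j where "j \<in> J" "y = side s l j" using B(1) y x_eq by auto
      then show ?thesis using single[of l j s] l jn y by auto
    qed (use Fix_empty in simp)
    fix x y a b
    assume xy: "x \<in> I" "y \<in> I" "x \<noteq> y" and a: "a \<in> (\<lambda>(l, s). side s l ` J) x" and b: "b \<in> (\<lambda>(l, s). side s l ` J) y"
    obtain l s l' s' where ls: "x = (l, s)" "y = (l', s')" by (cases x; cases y)
    then obtain j j' where jj: "j \<in> J" "j' \<in> J" "a = side s l j" "b = side s' l' j'" using a b by auto
    have l: "l < n" "l \<notin> J" "l' < n" "l' \<notin> J" using xy ls by (auto simp: I_def)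
    have gens: "gen j \<in> words (others l)" "gen j' \<in> words (others l)" using l jj Jo by auto
    show "a \<star> b = b \<star> a"
    proof (cases "l = l'")
      case True
      then have "s' = (\<not> s)" using xy ls by auto
      then show ?thesis using gens l True jj words_others by (cases s) (simp_all add: side_def transv_mult)
    next
      case False
      have "J \<subseteq> {..<n} - {l, l'}" using l J by auto
      then show ?thesis
        unfolding jj side_def using jj(1,2) l False by (auto intro!: transv_commute[where J=J])
    qed
  qed
  then obtain l s where ls: "l < n" "l \<notin> J" "Fix (side s l ` J) \<noteq> {}" by (auto simp: I_def)
  let ?H = "stab (Fix (side s l ` J))"
  have H: "subgroup ?H Aut" by (rule stab_subgroup[OF Fix_subset])
  have sub: "side t m ` J \<subseteq> carrier Aut" if "m < n" "m \<notin> J" for t m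
    using that jn by (auto intro!: side_in_Aut)
  have inH: "side s l j \<in> ?H" if "j \<in> J" for j
    using subset_stab_Fix[OF sub[OF ls(1,2)]] that by auto
  have both: "Fix (side t i ` J) \<noteq> {}" for t
  proof -
    define \<pi> where "\<pi> = Transposition.transpose l i"
    have \<pi>: "\<pi> permutes {..<n}" using ls i by (simp add: \<pi>_def permutes_swap_id)
    define e where "e = (\<lambda>m. m = l \<longrightarrow> s = t)"
    have "\<exists>a\<in>?H. side t i j \<star> sperm \<pi> e = sperm \<pi> e \<star> a" if j: "j \<in> J" for j
    proof -
      have "\<pi> l = i" "\<pi> j = j" using j ls i by (auto simp: \<pi>_def Transposition.transpose_def)
      then have eq: "sperm \<pi> e \<star> (if e l then side t l j else inv\<^bsub>Aut\<^esub> side (\<not> t) l j) = side t i j \<star> sperm \<pi> e"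
        using side_conj[OF \<pi> ls(1), of j e t] jn[OF j ls(2)] by (auto simp: e_def)
      have mem: "(if e l then side t l j else inv\<^bsub>Aut\<^esub> side (\<not> t) l j) \<in> ?H"
        using inH[OF j] subgroup.m_inv_closed[OF H inH[OF j]] by (cases "s = t") (auto simp: e_def)
      show ?thesis by (rule bexI[OF _ mem]) (rule eq[symmetric])
    qed
    then show ?thesis
      using sub[OF i] by (intro Fix_conjugate[OF sperm_in_Aut[OF \<pi>] ls(3)]) auto
  qed
  have "Fix (side True i ` J \<union> side False i ` J) \<noteq> {}"
  proof (rule Fix_Un_commuting[OF sub[OF i] sub[OF i] both both])
    fix a b assume "a \<in> side True i ` J" "b \<in> side False i ` J"
    then obtain j j' where jj: "j \<in> J" "j' \<in> J" "a = side True i j" "b = side False i j'" by auto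
    then have "gen j \<in> words (others i)" "gen j' \<in> words (others i)" using Jo[OF i(2)] by auto
    then show "a \<star> b = b \<star> a" using i jj words_others by (simp add: side_def transv_mult)
  qed
  then show ?thesis by (simp add: multipliers_def UNIV_bool Un_commute)
qed

lemma side_gen:
  assumes "i < n" "j < n" "i \<noteq> j" "l < n"
  shows "side s i j (gen l) = (if l = i then (if s then gen j \<cdot> gen i else gen i \<cdot> gen j) else gen l)"
  using assms by (auto simp: side_def transv_gen)

text \<open>The generators are arranged along a path \<open>\<sigma>\<close>, and \<open>R\<close> is a set of edges of it. Vertices are added from the
  end of the path: the transvections of later generators normalise the group of multipliers of \<open>x\<^bsub>\<sigma> h\<^esub>\<close> by those
  generators that are linked to \<open>\<sigma> h\<close> through consecutive edges in \<open>R\<close>, so a fixed point can be projected. Taking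
  only the linked generators bounds their number by the number of edges.\<close>

lemma triangular_Fix:
  assumes mult: "\<And>i J. J \<subseteq> {..<n} \<Longrightarrow> card J \<le> k \<Longrightarrow> i < n \<Longrightarrow> i \<notin> J \<Longrightarrow> Fix (multipliers i J) \<noteq> {}"
    and \<sigma>: "inj_on \<sigma> {..<n}" "\<sigma> ` {..<n} \<subseteq> {..<n}" and R: "R \<subseteq> {..<n - 1}" "card R \<le> k"
  shows "Fix (\<Union>i\<in>R. \<Union>s. {side s (\<sigma> i) (\<sigma> (Suc i))}) \<noteq> {}"
proof -
  define T where "T = (\<lambda>k. \<Union>i\<in>R \<inter> {k..}. \<Union>s. {side s (\<sigma> i) (\<sigma> (Suc i))})"
  have \<sigma>n: "\<sigma> i < n" if "i < n" for i using \<sigma>(2) that by auto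
  have \<sigma>eq: "\<sigma> i = \<sigma> j \<longleftrightarrow> i = j" if "i < n" "j < n" for i j using \<sigma>(1) that by (auto simp: inj_on_eq_iff)
  have Rn: "i < n" "Suc i < n" if "i \<in> R" for i using R(1) that by auto
  have T_Aut: "T l \<subseteq> carrier Aut" for l
    using Rn \<sigma>n \<sigma>eq by (auto simp: T_def intro!: side_in_Aut)
  have "Fix (T (n - l)) \<noteq> {}" if "l \<le> n" for l
    using that
  proof (induction l)
    case 0
    have "T n = {}" using Rn by (force simp: T_def)
    then show ?case using Fix_empty by simp
  next
    case (Suc l)
    define h where "h = n - Suc l"
    have h: "Suc h = n - l" "h < n" using Suc.prems by (auto simp: h_def)
    have IH: "Fix (T (Suc h)) \<noteq> {}" using Suc h by simp
    show ?case
    proof (cases "h \<in> R")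
      case False
      then have "R \<inter> {h..} = R \<inter> {Suc h..}" by (auto simp: not_less_eq_eq[symmetric] le_eq_less_or_eq)
      then show ?thesis using IH by (simp add: T_def h_def)
    next
      case True
      (* The vertices h, ..., e are joined by consecutive edges in R, and the edge leaving e is not in R. *)
      define e where "e = (LEAST e. h < e \<and> e \<notin> R)"
      have ex: "h < n - 1 \<and> n - 1 \<notin> R" using True R(1) by auto
      have e: "h < e" "e \<notin> R" "e \<le> n - 1"
        using LeastI[of "\<lambda>e. h < e \<and> e \<notin> R" "n - 1"] Least_le[of "\<lambda>e. h < e \<and> e \<notin> R" "n - 1"] ex
        by (auto simp: e_def)
      have between: "i \<in> R" if "h \<le> i" "i < e" for i
        using not_less_Least[of i "\<lambda>e. h < e \<and> e \<notin> R"] that True by (cases "i = h") (auto simp: e_def)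
      define J where "J = \<sigma> ` {h<..e}"
      have le: "j < n" if "j \<in> {h<..e}" for j using that e h(2) by auto
      have J: "J \<subseteq> {..<n}" using \<sigma>n le by (auto simp: J_def)
      have "card J \<le> card {h<..e}" unfolding J_def by (intro card_image_le) simp
      also have "\<dots> = card {h..<e}" by simp
      also have "\<dots> \<le> card R" using between R(1) finite_subset[OF R(1)] by (intro card_mono) auto
      finally have cardJ: "card J \<le> k" using R(2) by simp
      have "\<sigma> h \<noteq> \<sigma> j" if "j \<in> {h<..e}" for j using \<sigma>eq[OF h(2) le[OF that]] that by simp
      then have hJ: "\<sigma> h \<notin> J" unfolding J_def by blast
      have Jo: "J \<subseteq> others (\<sigma> h)" using J hJ by auto
      let ?A = "multipliers (\<sigma> h) J"
      have A: "?A \<subseteq> carrier Aut" by (rule multipliers_subset[OF \<sigma>n[OF h(2)] Jo])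
      have "Fix (?A \<union> T (Suc h)) \<noteq> {}"
      proof (rule Fix_Un_nonempty[OF A T_Aut mult[OF J cardJ \<sigma>n[OF h(2)] hJ] IH])
        fix a b assume "a \<in> ?A" "b \<in> T (Suc h)"
        then obtain s j t i where a: "j \<in> J" "a = side s (\<sigma> h) j"
          and i: "i \<in> R" "h < i" and b: "b = side t (\<sigma> i) (\<sigma> (Suc i))"
          by (auto simp: multipliers_def T_def Suc_le_eq)
        note in_ = Rn[OF i(1)]
        have bA: "b \<in> carrier Aut" using b in_ \<sigma>n \<sigma>eq by (auto intro!: side_in_Aut)
        have bgen: "b (gen l) = (if l = \<sigma> i then (if t then gen (\<sigma> (Suc i)) \<cdot> gen (\<sigma> i) else gen (\<sigma> i) \<cdot> gen (\<sigma> (Suc i))) else gen l)"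
          if "l < n" for l unfolding b using in_ \<sigma>n \<sigma>eq that by (intro side_gen) auto
        have neq: "\<sigma> i \<noteq> \<sigma> h" "\<sigma> (Suc i) \<noteq> \<sigma> h" using \<sigma>eq in_ h(2) i(2) by auto
        have b1: "b (gen (\<sigma> h)) = gen (\<sigma> h)" using bgen[OF \<sigma>n[OF h(2)]] neq by simp
        have b2: "b (gen l) \<in> words (others (\<sigma> h))" if "l < n" "l \<noteq> \<sigma> h" for l
        proof (cases "l = \<sigma> i")
          case True
          have "gen (\<sigma> i) \<in> words (others (\<sigma> h))" "gen (\<sigma> (Suc i)) \<in> words (others (\<sigma> h))"
            using neq \<sigma>n[OF in_(1)] \<sigma>n[OF in_(2)] by simp_all
          then show ?thesis using bgen[OF that(1)] True words_mult by (cases t) simp_all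
        qed (use bgen that in simp)
        have b3: "b (gen l) \<in> words J" if "l \<in> J" for l
        proof (cases "l = \<sigma> i")
          case True
          then have "i \<in> {h<..e}" using that \<sigma>eq in_(1) le by (auto simp: J_def)
          then have "Suc i \<in> {h<..e}" using e(2) i(1) by (cases "i = e") auto
          then have "\<sigma> i \<in> J" "\<sigma> (Suc i) \<in> J" using \<open>i \<in> {h<..e}\<close> by (auto simp: J_def)
          then have "gen (\<sigma> i) \<in> words J" "gen (\<sigma> (Suc i)) \<in> words J" by simp_all
          then show ?thesis using bgen[of l] True \<sigma>n[OF in_(1)] words_mult by (cases t) simp_all
        next
          case False
          then show ?thesis using bgen[of l] that J by auto
        qed
        have jw: "gen j \<in> words J" "[] \<in> words J" using a by auto
        have bw: "b w \<in> words J" if "w \<in> words J" for w by (rule Aut_words[OF bA J J b3 that])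
        have jo: "gen j \<in> words (others (\<sigma> h))" "[] \<in> words (others (\<sigma> h))" using a(1) Jo by auto
        have "b \<star> transv (\<sigma> h) u v = transv (\<sigma> h) (b u) (b v) \<star> b"
          if "u \<in> words (others (\<sigma> h))" "v \<in> words (others (\<sigma> h))" for u v
          by (rule transv_conj[OF bA \<sigma>n[OF h(2)] \<sigma>n[OF h(2)] b1 b2 that])
        moreover have "transv (\<sigma> h) (b u) (b v) \<in> stab (Fix ?A)" if "u \<in> words J" "v \<in> words J" for u v
          by (rule transv_in_stab_multipliers[OF \<sigma>n[OF h(2)] Jo bw[OF that(1)] bw[OF that(2)]])
        ultimately show "\<exists>a'\<in>stab (Fix ?A). b \<star> a = a' \<star> b"
          using jw jo unfolding a(2) side_def by (cases s) auto
      qed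
      moreover have "T h \<subseteq> ?A \<union> T (Suc h)"
      proof
        fix x assume "x \<in> T h"
        then obtain i s where i: "i \<in> R" "h \<le> i" "x = side s (\<sigma> i) (\<sigma> (Suc i))" by (auto simp: T_def)
        show "x \<in> ?A \<union> T (Suc h)"
        proof (cases "i = h")
          case True
          have "\<sigma> (Suc h) \<in> J" using e(1) by (auto simp: J_def)
          then show ?thesis using i True by (auto simp: multipliers_def)
        next
          case False
          then show ?thesis using i by (auto simp: T_def)
        qed
      qed
      ultimately show ?thesis using Fix_nonempty_mono unfolding h_def by blast
    qed
  qed
  from this[of n] show ?thesis by (simp add: T_def)
qed

section \<open>The cycle of transvections and the whole group\<close>

definition cyclic_transvections :: "((nat \<times> bool) list \<Rightarrow> (nat \<times> bool) list) set" where
  "cyclic_transvections = (\<Union>i<n. \<Union>s. {side s i (Suc i mod n)})"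

lemma cyclic_transvections_subset: "n \<ge> 2 \<Longrightarrow> cyclic_transvections \<subseteq> carrier Aut"
proof -
  assume n: "n \<ge> 2"
  have "i \<noteq> Suc i mod n" if "i < n" for i
    by (cases "Suc i = n") (use n that in auto)
  then show ?thesis using n by (auto simp: cyclic_transvections_def intro!: side_in_Aut)
qed

text \<open>Helly's principle for a single family: \<open>q + 1\<close> transvections involve at most \<open>q + 1 < n\<close> edges of the
  cycle. Cutting the cycle at a missing edge turns the edges into edges of a path.\<close>

lemma cyclic_transvections_Fix:
  assumes dim: "covering_dim_at_most mtopology q"
    and mult: "\<And>i J. J \<subseteq> {..<n} \<Longrightarrow> card J \<le> q + 1 \<Longrightarrow> i < n \<Longrightarrow> i \<notin> J \<Longrightarrow> Fix (multipliers i J) \<noteq> {}"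
    and n: "q + 1 < n"
  shows "Fix cyclic_transvections \<noteq> {}"
proof -
  have "\<exists>x\<in>{()}. Fix cyclic_transvections \<noteq> {}"
  proof (rule commuting_families_Fix[OF dim, where k="\<lambda>_. q + 1"])
    show "finite cyclic_transvections" by (auto simp: cyclic_transvections_def)
    show "cyclic_transvections \<subseteq> carrier Aut" by (rule cyclic_transvections_subset) (use n in simp)
    fix B assume B: "B \<subseteq> cyclic_transvections" "card B \<le> q + 1"
    then have "\<forall>b\<in>B. \<exists>i. i < n \<and> b \<in> (\<Union>s. {side s i (Suc i mod n)})"
      unfolding cyclic_transvections_def by blast
    then obtain ix where ix: "\<And>b. b \<in> B \<Longrightarrow> ix b < n \<and> b \<in> (\<Union>s. {side s (ix b) (Suc (ix b) mod n)})"
      by metis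
    have finB: "finite B" using B(1) finite_subset by (fastforce simp: cyclic_transvections_def)
    define R0 where "R0 = ix ` B"
    have R0: "R0 \<subseteq> {..<n}" "card R0 \<le> q + 1"
      using ix card_image_le[OF finB, of ix] B(2) by (auto simp: R0_def)
    have "R0 \<noteq> {..<n}" using R0(2) n by auto
    then obtain r where r: "r < n" "r \<notin> R0" using R0(1) by auto
    define \<sigma> where "\<sigma> = (\<lambda>i. (i + Suc r) mod n)"
    have inj: "inj_on \<sigma> {..<n}"
    proof (rule inj_onI)
      fix i j assume ij: "i \<in> {..<n}" "j \<in> {..<n}" "\<sigma> i = \<sigma> j"
      have "\<sigma> l = (if l + Suc r < n then l + Suc r else l + Suc r - n)" if "l < n" for l
        using that r(1) by (simp add: \<sigma>_def mod_if)
      then show "i = j" using ij by (auto split: if_splits)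
    qed
    have into: "\<sigma> ` {..<n} \<subseteq> {..<n}" using n by (auto simp: \<sigma>_def)
    then have surj: "\<sigma> ` {..<n} = {..<n}" using inj by (intro endo_inj_surj) auto
    define R where "R = {i. i < n - 1 \<and> \<sigma> i \<in> R0}"
    have "card R \<le> card R0"
      using inj finite_subset[OF R0(1)] by (intro card_inj_on_le[of \<sigma>]) (auto simp: R_def inj_on_def)
    then have "Fix (\<Union>i\<in>R. \<Union>s. {side s (\<sigma> i) (\<sigma> (Suc i))}) \<noteq> {}"
      using R0(2) by (intro triangular_Fix[OF mult inj into]) (auto simp: R_def)
    moreover have "B \<subseteq> (\<Union>i\<in>R. \<Union>s. {side s (\<sigma> i) (\<sigma> (Suc i))})"
    proof
      fix b assume b: "b \<in> B"
      obtain s where s: "b = side s (ix b) (Suc (ix b) mod n)" using ix[OF b] by auto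
      have ixR: "ix b \<in> R0" using b by (simp add: R0_def)
      obtain i where i: "i < n" "\<sigma> i = ix b" using surj ix[OF b] by (metis imageE lessThan_iff)
      have "\<sigma> (n - 1) = r" using n r by (simp add: \<sigma>_def mod_if)
      then have "i \<noteq> n - 1" using i ixR r by auto
      then have "i \<in> R" using i ixR by (auto simp: R_def)
      moreover have "Suc (ix b) mod n = \<sigma> (Suc i)" unfolding i(2)[symmetric] by (simp add: \<sigma>_def mod_Suc_eq)
      ultimately show "b \<in> (\<Union>i\<in>R. \<Union>s. {side s (\<sigma> i) (\<sigma> (Suc i))})" using s i(2) by (auto intro!: bexI[of _ i])
    qed
    ultimately show "Fix B \<noteq> {}" using Fix_nonempty_mono by blast
  qed auto
  then show ?thesis by simp
qed

text \<open>Conjugating \<open>side s i j\<close> by \<open>x\<^sub>j \<mapsto> x\<^sub>k x\<^sub>j\<close> gives multiplication by \<open>x\<^sub>k x\<^sub>j\<close>, from which multiplication by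
  \<open>x\<^sub>k\<close> is split off.\<close>

lemma side_commutator:
  assumes H: "subgroup H Aut" and ijk: "i < n" "j < n" "k < n" "i \<noteq> j" "j \<noteq> k" "i \<noteq> k"
    and "side s i j \<in> H" and "side True j k \<in> H"
  shows "side s i k \<in> H"
proof -
  let ?b = "side True j k"
  have bA: "?b \<in> carrier Aut" using ijk by (intro side_in_Aut)
  have w: "gen j \<in> words (others i)" "gen k \<in> words (others i)" "[] \<in> words (others i)" using ijk by auto
  have bj: "?b (gen j) = gen k \<cdot> gen j" and bi: "?b (gen i) = gen i" using ijk by (simp_all add: side_gen)
  have bo: "?b (gen l) \<in> words (others i)" if "l < n" "l \<noteq> i" for l
    using that ijk side_gen[of j k l True] by (auto intro!: words_mult)
  note conj = transv_conj[OF bA ijk(1) ijk(1) bi bo]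
  have kj: "gen k \<cdot> gen j \<in> words (others i)" using w words_mult by blast
  have "?b \<star> side s i j = (if s then transv i (gen k \<cdot> gen j) [] else transv i [] (gen k \<cdot> gen j)) \<star> ?b"
    using conj w bj Aut_Nil[OF bA] by (simp add: side_def)
  also have "(if s then transv i (gen k \<cdot> gen j) [] else transv i [] (gen k \<cdot> gen j))
      = (if s then side s i j \<star> side s i k else side s i k \<star> side s i j)"
    using w ijk words_others by (simp add: side_def transv_mult)
  finally have eq: "?b \<star> side s i j = (if s then side s i j \<star> side s i k else side s i k \<star> side s i j) \<star> ?b" .
  define x where "x = ?b \<star> side s i j \<star> inv\<^bsub>Aut\<^esub> ?b"
  have xH: "x \<in> H" unfolding x_def using assms subgroup.m_closed[OF H] subgroup.m_inv_closed[OF H] by blast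
  have A: "side s i j \<in> carrier Aut" "side s i k \<in> carrier Aut" using ijk by (auto intro!: side_in_Aut)
  have x: "x = (if s then side s i j \<star> side s i k else side s i k \<star> side s i j)"
    unfolding x_def eq using A bA by (cases s) (simp_all add: A.m_assoc)
  have "side s i k = (if s then inv\<^bsub>Aut\<^esub> side s i j \<star> x else x \<star> inv\<^bsub>Aut\<^esub> side s i j)"
  proof (cases s)
    case True
    then show ?thesis using A x by (simp flip: A.m_assoc)
  next
    case False
    then show ?thesis using A x by (simp add: A.m_assoc)
  qed
  then show ?thesis
    using xH assms(8) subgroup.m_closed[OF H] subgroup.m_inv_closed[OF H] by (metis (full_types))
qed

lemma all_sides_in_subgroup:
  assumes H: "subgroup H Aut" and cyc: "cyclic_transvections \<subseteq> H" and ij: "i < n" "j < n" "i \<noteq> j"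
  shows "side s i j \<in> H"
proof -
  have cyc': "side s i (Suc i mod n) \<in> H" if "i < n" for s i
    using cyc that by (auto simp: cyclic_transvections_def)
  have "side s i ((i + t) mod n) \<in> H" if "1 \<le> t" "t < n" for t
    using that
  proof (induction t rule: nat_induct_at_least)
    case base
    then show ?case using cyc'[OF ij(1)] by simp
  next
    case (Suc t)
    let ?j = "(i + t) mod n" and ?k = "(i + Suc t) mod n"
    have k: "?k = Suc ?j mod n" by (simp add: mod_Suc_eq)
    have distinct: "i \<noteq> ?j" "i \<noteq> ?k" "?j \<noteq> ?k"
      using Suc.prems Suc.hyps ij(1) by (auto simp: mod_if split: if_splits)
    show ?case
    proof (rule side_commutator[OF H ij(1), of ?j])
      show "side s i ?j \<in> H" using Suc by simp
      show "side True ?j ?k \<in> H" unfolding k using ij by (intro cyc') auto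
    qed (use distinct ij in auto)
  qed
  moreover have "j = (i + (if i < j then j - i else j + n - i)) mod n" using ij by auto
  moreover have "1 \<le> (if i < j then j - i else j + n - i)" "(if i < j then j - i else j + n - i) < n"
    using ij by auto
  ultimately show ?thesis by metis
qed

text \<open>After the transvections, the finite group of signed permutations is adjoined by projection: it
  permutes the two-sided transvections by conjugation.\<close>

theorem Aut_fixed_point:
  assumes dim: "covering_dim_at_most mtopology q"
    and q: "(n \<ge> 3 * m \<and> q < 2 * m) \<or> (n \<ge> 3 * m + 2 \<and> q < 2 * m + 1)"
  shows "Fix (carrier Aut) \<noteq> {}"
proof -
  (* This is what both alternatives have in common: for sets of at most q + 1 generators it leaves
     2 * (n - (q + 1)) > q commuting families, and it makes the cycle longer than q + 1. *)
  have n: "3 * q + 3 \<le> 2 * n" using q by auto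
  obtain a b where ab: "a < n" "b < n" "a \<noteq> b" "Fix {transv b [] [(a, False)]} \<noteq> {}"
    using some_transvection_fixes[OF dim q] by blast
  have single: "Fix {side s i j} \<noteq> {}" if "i < n" "j < n" "i \<noteq> j" for s i j
    by (rule all_transvections_Fix[OF ab that])
  have "Fix (multipliers i J) \<noteq> {}" if "J \<subseteq> {..<n}" "card J \<le> q + 1" "i < n" "i \<notin> J" for i J
    by (rule multipliers_Fix[OF dim single that(1) _ that(3,4)]) (use that(2) n in auto)
  then have "Fix cyclic_transvections \<noteq> {}" using n by (intro cyclic_transvections_Fix[OF dim]) auto
  then obtain p where p: "p \<in> Fix cyclic_transvections" by blast
  define K where "K = {side s i j |s i j. i < n \<and> j < n \<and> i \<noteq> j}"
  have K: "K \<subseteq> carrier Aut" by (auto simp: K_def intro!: side_in_Aut)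
  have pM: "p \<in> M" using p by (simp add: Fix_iff)
  have "cyclic_transvections \<subseteq> stab {p}"
    using p n cyclic_transvections_subset by (auto simp: stab_def Fix_iff)
  then have "K \<subseteq> stab {p}"
    using all_sides_in_subgroup[OF stab_subgroup] pM by (auto simp: K_def)
  then have KF: "Fix K \<noteq> {}" using Fix_stab[OF pM] by blast
  have transvK: "transv i u v \<in> stab (Fix K)" if "i < n" "u \<in> words (others i)" "v \<in> words (others i)" for i u v
  proof -
    have sides: "side s i j \<in> stab (Fix K)" if "j \<in> others i" for s j
      using subset_stab_Fix[OF K] that \<open>i < n\<close> by (auto simp: K_def)
    show ?thesis
      by (rule transv_words_in_subgroup[OF stab_subgroup[OF Fix_subset] that(1) subset_refl _ _ that(2,3)])
        (use sides[of _ True] sides[of _ False] in \<open>simp_all add: side_def\<close>)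
  qed
  have "Fix (K \<union> signed_perms) \<noteq> {}"
  proof (rule Fix_Un_nonempty[OF K signed_perms_subset KF Fix_signed_perms])
    fix x w assume "x \<in> K" and w: "w \<in> signed_perms"
    then obtain s i j where ij: "i < n" "j < n" "i \<noteq> j" and x: "x = side s i j" by (auto simp: K_def)
    define u v where "u = (if s then gen j else [])" and "v = (if s then [] else gen j)"
    then have uv: "u \<in> words (others i)" "v \<in> words (others i)" "x = transv i u v"
      using ij x by (auto simp: side_def)
    have wA: "w \<in> carrier Aut" using w signed_perms_subset by auto
    obtain i' c where i': "i' < n" "w (gen i) = [(i', c)]" using w ij(1) by (auto simp: signed_perms_def)
    note oth = signed_perm_others[OF w ij(1) i'(2)]
    have ww: "w y \<in> words (others i')" if "y \<in> words (others i)" for y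
      by (rule Aut_words[OF wA _ _ _ that]) (use oth in auto)
    have fw: "finv (w y) \<in> words (others i')" if "y \<in> words (others i)" for y
      by (rule words_finv[OF _ ww[OF that]]) auto
    show "\<exists>a'\<in>stab (Fix K). w \<star> x = a' \<star> w"
    proof (cases c)
      case True
      then have "w (gen i) = gen i'" using i' by simp
      from transv_conj[OF wA ij(1) i'(1) this oth uv(1,2)]
      show ?thesis using transvK[OF i'(1) ww[OF uv(1)] ww[OF uv(2)]] uv(3) by auto
    next
      case False
      then have "w (gen i) = [(i', False)]" using i' by simp
      from transv_conj_invert[OF wA ij(1) i'(1) this oth uv(1,2)]
      show ?thesis using transvK[OF i'(1) fw[OF uv(2)] fw[OF uv(1)]] uv(3) by auto
    qed
  qed
  then obtain z where z: "z \<in> Fix (K \<union> signed_perms)" by blast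
  then have zM: "z \<in> M" and sub: "K \<union> signed_perms \<subseteq> stab {z}"
    using K signed_perms_subset by (auto simp: Fix_iff stab_def)
  have "stab {z} = carrier Aut"
  proof (rule Nielsen_generation)
    show "subgroup (stab {z}) Aut" using zM by (intro stab_subgroup) auto
    show "signed_perms \<subseteq> stab {z}" using sub by simp
    show "n \<ge> 1" using ab by simp
    fix i j assume ij: "i < n" "j < n" "i \<noteq> j"
    then have "side s i j \<in> stab {z}" for s using sub by (auto simp: K_def)
    from this[of True] this[of False]
    show "transv i (gen j) [] \<in> stab {z} \<and> transv i [] (gen j) \<in> stab {z}" by (simp add: side_def)
  qed
  then show ?thesis using Fix_stab[OF zM] by blast
qed

end

theorem theorem1:
  fixes n m d :: nat
    and X :: "'a set" and \<delta> :: "'a \<Rightarrow> 'a \<Rightarrow> real"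
    and \<phi> :: "((nat \<times> bool) list \<Rightarrow> (nat \<times> bool) list) \<Rightarrow> 'a \<Rightarrow> 'a"
  assumes "n \<ge> 1"
    and "(n \<ge> 3 * m \<and> d < 2 * m) \<or> (n \<ge> 3 * m + 2 \<and> d < 2 * m + 1)"
    and "complete_CAT0_space X \<delta>"
    and "has_covering_dim (Metric_space.mtopology X \<delta>) d"
    and "\<phi> \<in> hom (AutoGroup (free_group {..<n})) (IsomGroup X \<delta>)"
  shows "\<exists>x\<in>X. \<forall>\<gamma>\<in>carrier (AutoGroup (free_group {..<n})). \<phi> \<gamma> x = x"
proof -
  interpret complete_CAT0_space X \<delta> by fact
  interpret Aut_action X \<delta> n \<phi>
    by unfold_locales (rule assms(5))
  have "Fix (carrier Aut) \<noteq> {}"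
    using assms(2,4) by (intro Aut_fixed_point[of d m]) (auto simp: has_covering_dim_def)
  then obtain x where "x \<in> Fix (carrier Aut)" by blast
  then have "x \<in> X" "\<forall>\<gamma>\<in>carrier Aut. \<phi> \<gamma> x = x" by (simp_all add: Fix_iff)
  then show ?thesis by blast
qed

end
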